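(* Let $(M,S,g,\{\mathcal{L}_\alpha\})$ be a locally Lagrange space, with local Lagrangians $\mathcal{L}_\alpha\in C^\infty(U_\alpha)$, and let a normal bundle $N\mathcal{V}$ of the vertical foliation be chosen. The first Lagrangian obstruction $\mathcal{G}_1$ vanishes if and only if there exists a subordinated structure $\{\tilde{\mathcal{L}}_\alpha\}$ such that the $1$-forms $\theta_{\tilde{\mathcal{L}}_\alpha}$ glue up to a global $1$-form. This subordinated structure defines a locally Lagrangian-symplectic structure on $M$. Furthermore, in this case the second Lagrangian obstruction $\mathcal{G}_2$ is represented by the global $d''$-closed form $\kappa$ of type $(0,1)$ defined by gluing up the local forms $\{d''\tilde{\mathcal{L}}_\alpha\}$.
   Context: Everything is $C^\infty$. A tangent manifold $(M^{2n},S)$ is a manifold with $S\in\Gamma End(TM)$, $S^2=0$, $im\,S=ker\,S$ and vanishing Nijenhuis tensor; equivalently there is an atlas of adapted coordinates $(x^i,y^i)$ with $S(\partial/\partial x^i)=\partial/\partial y^i$, $S(\partial/\partial y^i)=0$. The vertical foliation $\mathcal{V}$ has $T\mathcal{V}=im\,S$, and $\nu\mathcal{V}=TM/T\mathcal{V}$. For a local function $\mathcal{L}$, $g_\mathcal{L}$ is the section of $\odot^2\nu^*\mathcal{V}$ with components $\partial^2\mathcal{L}/\partial y^i\partial y^j$ in adapted coordinates, $\theta_\mathcal{L}=\frac{\partial\mathcal{L}}{\partial y^i}dx^i$, $\omega_\mathcal{L}=d\theta_\mathcal{L}$; $\mathcal{L}$ is regular if $g_\mathcal{L}$ is non degenerate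 on $\nu\mathcal{V}$. A locally Lagrange space is a tangent manifold with a non degenerate $g\in\Gamma\odot^2\nu^*\mathcal{V}$, an open covering $M=\cup U_\alpha$ (by adapted coordinate neighborhoods) and regular $\mathcal{L}_\alpha\in C^\infty(U_\alpha)$ with $g|_{U_\alpha}=g_{\mathcal{L}_\alpha}$. Sheaves on $M$: $\Phi$ = germs of foliated functions (locally functions of $x$); $\underline{A}^0$ = germs of functions locally of the form $\varphi_i(x)y^i+b(x)$; $\underline{\Omega}^{(1,0)}_{pr}$ = germs of foliated $1$-forms (locally $\varphi_i(x)dx^i$). The exact sequence $0\to\Phi\to\underline{A}^0\to\underline{\Omega}^{(1,0)}_{pr}\to0$ (inclusion, then $\varphi_iy^i+b\mapsto\varphi_idx^i$) has a cohomology sequence whose connecting homomorphism is asserted to be zero in dimension $0$, so that one has the exact sequence $$0\to H^1(M,\Phi)\xrightarrow{\iota^*}H^1(M,\underline{A}^0)\xrightarrow{\pi^*}H^1(M,\underline{\Omega}^{(1,0)}_{pr})\to\cdots.$$ One has $\mathcal{L}_\beta-\mathcal{L}_\alpha\in\underline{A}^0(U_\alpha\cap U_\beta)$; $\mathcal{G}\in H^1(M,\underline{A}^0)$ is the class of $\{\mathcal{L}_\beta-\mathcal{L}_\alpha\}$. The first Lagrangian obstruction is $\mathcal{G}_1=\pi^*(\mathcal{G})\in H^1(M,\underline{\Omega}^{(1,0)}_{pr})$, i.e. the class of $\{\theta_{\mathcal{L}_\beta}-\theta_{\mathcal{L}_\alpha}\}$. If $\mathcal{G}_1=0$, the second Lagrangian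 obstruction is the unique class $\mathcal{G}_2\in H^1(M,\Phi)$ such that $\iota^*(\mathcal{G}_2)=\mathcal{G}$, existence and uniqueness being taken from the exact sequence above. A subordinated structure is a family of regular Lagrangians $\tilde{\mathcal{L}}_\alpha\in C^\infty(U_\alpha)$ with $\tilde{\mathcal{L}}_\alpha-\mathcal{L}_\alpha\in\underline{A}^0(U_\alpha)$ for all $\alpha$ (so $g_{\tilde{\mathcal{L}}_\alpha}=g|_{U_\alpha}$). It defines a locally Lagrangian-symplectic structure if there is a global symplectic form $\Omega$ on $M$ with $\Omega|_{U_\alpha}=\omega_{\tilde{\mathcal{L}}_\alpha}$ for all $\alpha$. A normal bundle is a distribution $N\mathcal{V}$ with $TM=N\mathcal{V}\oplus T\mathcal{V}$; a form has type $(p,q)$ if it has $p$ factors in $ann(T\mathcal{V})$ and $q$ in $ann(N\mathcal{V})$, and $d''$ is the type $(0,1)$ component of $d$. Via the fine resolution $0\to\Phi\to\underline{\Omega}^{(0,0)}\xrightarrow{d''}\underline{\Omega}^{(0,1)}\xrightarrow{d''}\cdots$, where $\underline{\Omega}^{(0,q)}$ is the sheaf of germs of forms of type $(0,q)$, a global $d''$-closed form $\kappa$ of type $(0,1)$ with $\kappa|_{U_\alpha}=d''f_\alpha$ represents the class in $H^1(M,\Phi)$ of the cocycle $\{f_\beta-f_\alpha\}$.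
   Formalization: Since ι* on H^1(M,Φ) is not always injective, G_2 need not be unique: it is proved that κ represents some class X with ι*(X)=G, and that G_2 exists uniquely and is represented by κ whenever ι* is injective. *)

theory Defs
  imports "HOL-Analysis.Analysis" "HOL-Library.Function_Algebras"
begin

section \<open>Smooth functions and smooth manifolds\<close>

text \<open>All sets on which smoothness is tested below are open.\<close>

primrec Ck_on :: "nat \<Rightarrow> 'a::real_normed_vector set \<Rightarrow> ('a \<Rightarrow> 'b::real_normed_vector) \<Rightarrow> bool" where
  "Ck_on 0 T f \<longleftrightarrow> continuous_on T f"
| "Ck_on (Suc k) T f \<longleftrightarrow> (\<forall>x\<in>T. f differentiable (at x)) \<and>
     (\<forall>v. Ck_on k T (\<lambda>x. frechet_derivative f (at x) v))"

definition smooth_on :: "'a::real_normed_vector set \<Rightarrow> ('a \<Rightarrow> 'b::real_normed_vector) \<Rightarrow> bool" where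
  "smooth_on T f \<longleftrightarrow> (\<forall>k. Ck_on k T f)"

text \<open>The manifold is a whole type of dimension \<open>2n\<close>, \<open>n = CARD('n)\<close>. A point of the model space is
  a pair \<open>(x, y)\<close>. The value of \<^term>\<open>coord\<close> outside \<^term>\<open>cdom\<close> is irrelevant.\<close>

type_synonym 'n model = "(real ^ 'n) \<times> (real ^ 'n)"

datatype ('m, 'n::finite) chart = Chart (cdom: "'m set") (coord: "'m \<Rightarrow> 'n model")

definition cinv :: "('m, 'n::finite) chart \<Rightarrow> 'n model \<Rightarrow> 'm" where
  "cinv c = inv_into (cdom c) (coord c)"

definition is_chart :: "('m::topological_space, 'n::finite) chart \<Rightarrow> bool" where
  "is_chart c \<longleftrightarrow> open (cdom c) \<and> open (coord c ` cdom c) \<and>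
     homeomorphism (cdom c) (coord c ` cdom c) (coord c) (cinv c)"

definition smooth_transition :: "('m, 'n::finite) chart \<Rightarrow> ('m, 'n) chart \<Rightarrow> bool" where
  "smooth_transition c c' \<longleftrightarrow> smooth_on (coord c ` (cdom c \<inter> cdom c')) (coord c' \<circ> cinv c)"

definition smooth_structure :: "('m::topological_space, 'n::finite) chart set \<Rightarrow> bool" where
  "smooth_structure A \<longleftrightarrow>
     (\<forall>c\<in>A. is_chart c) \<and> (\<Union>c\<in>A. cdom c) = UNIV \<and>
     (\<forall>c\<in>A. \<forall>c'\<in>A. smooth_transition c c') \<and>
     (\<forall>c. is_chart c \<longrightarrow> (\<forall>c'\<in>A. smooth_transition c c' \<and> smooth_transition c' c) \<longrightarrow> c \<in> A)"

definition charts_at :: "('m, 'n::finite) chart set \<Rightarrow> 'm \<Rightarrow> ('m, 'n) chart set" where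
  "charts_at C p = {c \<in> C. p \<in> cdom c}"

definition jac :: "('m, 'n::finite) chart \<Rightarrow> ('m, 'n) chart \<Rightarrow> 'm \<Rightarrow> 'n model \<Rightarrow> 'n model" where
  "jac c c' p = frechet_derivative (coord c' \<circ> cinv c) (at (coord c p))"

definition smooth_fun :: "('m, 'n::finite) chart set \<Rightarrow> 'm set \<Rightarrow> ('m \<Rightarrow> real) \<Rightarrow> bool" where
  "smooth_fun C V f \<longleftrightarrow> (\<forall>c\<in>C. smooth_on (coord c ` (cdom c \<inter> V)) (f \<circ> cinv c))"

section \<open>Tensor fields\<close>

text \<open>A tensor field on \<open>V\<close> is given by its components in the charts of an atlas \<open>C\<close>, subject to the
  usual transformation law: \<open>\<alpha> p c e\<close> is the value at \<open>p\<close> of the form \<open>\<alpha>\<close> on the tangent vector whose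
  coordinate vector in the chart \<open>c\<close> is \<open>e\<close>. Components of forms in the charts that do not
  contain \<open>p\<close> are normalized to \<open>0\<close>, so that the equality of two forms at \<open>p\<close> is plain equality.\<close>

type_synonym ('m, 'n) form1 = "'m \<Rightarrow> ('m, 'n) chart \<Rightarrow> 'n model \<Rightarrow> real"
type_synonym ('m, 'n) form2 = "'m \<Rightarrow> ('m, 'n) chart \<Rightarrow> 'n model \<Rightarrow> 'n model \<Rightarrow> real"

definition one_form_on :: "('m, 'n::finite) chart set \<Rightarrow> 'm set \<Rightarrow> ('m, 'n) form1 \<Rightarrow> bool" where
  "one_form_on C V \<alpha> \<longleftrightarrow>
     (\<forall>p\<in>V. \<forall>c\<in>charts_at C p. linear (\<alpha> p c)) \<and>
     (\<forall>p\<in>V. \<forall>c\<in>charts_at C p. \<forall>c'\<in>charts_at C p. \<forall>e. \<alpha> p c e = \<alpha> p c' (jac c c' p e)) \<and>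
     (\<forall>p\<in>V. \<forall>c. c \<notin> charts_at C p \<longrightarrow> \<alpha> p c = (\<lambda>e. 0)) \<and>
     (\<forall>c\<in>C. \<forall>e. smooth_on (coord c ` (cdom c \<inter> V)) (\<lambda>q. \<alpha> (cinv c q) c e))"

definition tensor2 :: "('m, 'n::finite) chart set \<Rightarrow> ('m, 'n) form2 \<Rightarrow> bool" where
  "tensor2 C \<omega> \<longleftrightarrow>
     (\<forall>p. \<forall>c\<in>charts_at C p. (\<forall>u. linear (\<lambda>v. \<omega> p c u v)) \<and> (\<forall>v. linear (\<lambda>u. \<omega> p c u v))) \<and>
     (\<forall>p. \<forall>c\<in>charts_at C p. \<forall>c'\<in>charts_at C p. \<forall>u v.
        \<omega> p c u v = \<omega> p c' (jac c c' p u) (jac c c' p v)) \<and>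
     (\<forall>p c. c \<notin> charts_at C p \<longrightarrow> \<omega> p c = (\<lambda>u v. 0)) \<and>
     (\<forall>c\<in>C. \<forall>u v. smooth_on (coord c ` cdom c) (\<lambda>q. \<omega> (cinv c q) c u v))"

definition two_form :: "('m, 'n::finite) chart set \<Rightarrow> ('m, 'n) form2 \<Rightarrow> bool" where
  "two_form C \<omega> \<longleftrightarrow> tensor2 C \<omega> \<and> (\<forall>p c u. \<omega> p c u u = 0)"

definition dfun :: "('m \<Rightarrow> real) \<Rightarrow> 'm \<Rightarrow> ('m, 'n::finite) chart \<Rightarrow> 'n model \<Rightarrow> real" where
  "dfun f p c e = frechet_derivative (f \<circ> cinv c) (at (coord c p)) e"

definition d1 :: "('m, 'n::finite) chart set \<Rightarrow> ('m, 'n) form1 \<Rightarrow> ('m, 'n) form2" where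
  "d1 C \<alpha> p c u v = (if c \<in> charts_at C p then
       dfun (\<lambda>q. \<alpha> q c v) p c u - dfun (\<lambda>q. \<alpha> q c u) p c v else 0)"

definition d2 :: "('m, 'n::finite) form2 \<Rightarrow>
    'm \<Rightarrow> ('m, 'n) chart \<Rightarrow> 'n model \<Rightarrow> 'n model \<Rightarrow> 'n model \<Rightarrow> real" where
  "d2 \<omega> p c u v w =
     dfun (\<lambda>q. \<omega> q c v w) p c u - dfun (\<lambda>q. \<omega> q c u w) p c v + dfun (\<lambda>q. \<omega> q c u v) p c w"

definition symplectic_form :: "('m, 'n::finite) chart set \<Rightarrow> ('m, 'n) form2 \<Rightarrow> bool" where
  "symplectic_form C \<Omega> \<longleftrightarrow> two_form C \<Omega> \<and>
     (\<forall>p. \<forall>c\<in>charts_at C p. \<forall>u v w. d2 \<Omega> p c u v w = 0) \<and>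
     (\<forall>p. \<forall>c\<in>charts_at C p. \<forall>u. (\<forall>v. \<Omega> p c u v = 0) \<longrightarrow> u = 0)"

section \<open>Tangent manifolds and normal bundles\<close>

type_synonym ('m, 'n) endo = "'m \<Rightarrow> ('m, 'n) chart \<Rightarrow> 'n model \<Rightarrow> 'n model"

definition endo_field :: "('m, 'n::finite) chart set \<Rightarrow> ('m, 'n) endo \<Rightarrow> bool" where
  "endo_field A S \<longleftrightarrow>
     (\<forall>p. \<forall>c\<in>charts_at A p. linear (S p c)) \<and>
     (\<forall>p. \<forall>c\<in>charts_at A p. \<forall>c'\<in>charts_at A p. \<forall>e. jac c c' p (S p c e) = S p c' (jac c c' p e)) \<and>
     (\<forall>c\<in>A. \<forall>e. smooth_on (coord c ` cdom c) (\<lambda>q. S (cinv c q) c e))"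

definition lie_bracket :: "('n::finite model \<Rightarrow> 'n model) \<Rightarrow> ('n model \<Rightarrow> 'n model) \<Rightarrow> 'n model \<Rightarrow> 'n model" where
  "lie_bracket X Y q = frechet_derivative Y (at q) (X q) - frechet_derivative X (at q) (Y q)"

definition nijenhuis :: "('n::finite model \<Rightarrow> 'n model \<Rightarrow> 'n model) \<Rightarrow>
    ('n model \<Rightarrow> 'n model) \<Rightarrow> ('n model \<Rightarrow> 'n model) \<Rightarrow> 'n model \<Rightarrow> 'n model" where
  "nijenhuis T X Y q =
     lie_bracket (\<lambda>z. T z (X z)) (\<lambda>z. T z (Y z)) q
     - T q (lie_bracket (\<lambda>z. T z (X z)) Y q)
     - T q (lie_bracket X (\<lambda>z. T z (Y z)) q)
     + T q (T q (lie_bracket X Y q))"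

definition tangent_manifold :: "('m::topological_space, 'n::finite) chart set \<Rightarrow> ('m, 'n) endo \<Rightarrow> bool" where
  "tangent_manifold A S \<longleftrightarrow> smooth_structure A \<and> endo_field A S \<and>
     (\<forall>p. \<forall>c\<in>charts_at A p. \<forall>e. S p c (S p c e) = 0) \<and>
     (\<forall>p. \<forall>c\<in>charts_at A p. range (S p c) = {e. S p c e = 0}) \<and>
     (\<forall>c\<in>A. \<forall>X Y. smooth_on (coord c ` cdom c) X \<longrightarrow> smooth_on (coord c ` cdom c) Y \<longrightarrow>
        (\<forall>q\<in>coord c ` cdom c. nijenhuis (\<lambda>z. S (cinv c z) c) X Y q = 0))"

text \<open>The adapted charts: \<open>S (\<partial>/\<partial>x\<^sup>i) = \<partial>/\<partial>y\<^sup>i\<close> and \<open>S (\<partial>/\<partial>y\<^sup>i) = 0\<close>. From here on,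
  \<open>C\<close> always stands for the atlas of adapted charts of a tangent manifold.\<close>

definition adapted_charts :: "('m, 'n::finite) chart set \<Rightarrow> ('m, 'n) endo \<Rightarrow> ('m, 'n) chart set" where
  "adapted_charts A S = {c \<in> A. \<forall>p\<in>cdom c. \<forall>e. S p c e = (0, fst e)}"

text \<open>The tangent space of the vertical foliation (the image of \<open>S\<close>) in an adapted chart.\<close>

definition vert :: "('n::finite) model set" where
  "vert = {e. fst e = 0}"

definition normal_bundle :: "('m::topological_space, 'n::finite) chart set \<Rightarrow>
    ('m \<Rightarrow> ('m, 'n) chart \<Rightarrow> 'n model set) \<Rightarrow> bool" where
  "normal_bundle C N \<longleftrightarrow>
     (\<forall>p. \<forall>c\<in>charts_at C p. subspace (N p c) \<and> N p c \<inter> vert = {0} \<and>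
        {a + b | a b. a \<in> N p c \<and> b \<in> vert} = UNIV) \<and>
     (\<forall>p. \<forall>c\<in>charts_at C p. \<forall>c'\<in>charts_at C p. N p c' = jac c c' p ` N p c) \<and>
     (\<forall>p. \<forall>c\<in>charts_at C p. \<exists>W X. open W \<and> p \<in> W \<and> W \<subseteq> cdom c \<and>
        (\<forall>i::'n. smooth_on (coord c ` W) (X i)) \<and>
        (\<forall>q\<in>W. N q c = span (range (\<lambda>i. X i (coord c q)))))"

definition vproj :: "('m \<Rightarrow> ('m, 'n::finite) chart \<Rightarrow> 'n model set) \<Rightarrow> 'm \<Rightarrow> ('m, 'n) chart \<Rightarrow>
    'n model \<Rightarrow> 'n model" where
  "vproj N p c e = (THE b. b \<in> vert \<and> e - b \<in> N p c)"

definition form01 :: "('m, 'n::finite) chart set \<Rightarrow> ('m \<Rightarrow> ('m, 'n) chart \<Rightarrow> 'n model set) \<Rightarrow>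
    ('m, 'n) form1 \<Rightarrow> bool" where
  "form01 C N \<kappa> \<longleftrightarrow> one_form_on C UNIV \<kappa> \<and>
     (\<forall>p. \<forall>c\<in>charts_at C p. \<forall>e\<in>N p c. \<kappa> p c e = 0)"

text \<open>\<open>d''\<close> on functions and on forms of type \<open>(0,1)\<close>: the components of \<open>d\<close> of types \<open>(0,1)\<close>
  and \<open>(0,2)\<close>.\<close>

definition dpp0 :: "('m, 'n::finite) chart set \<Rightarrow> ('m \<Rightarrow> ('m, 'n) chart \<Rightarrow> 'n model set) \<Rightarrow>
    ('m \<Rightarrow> real) \<Rightarrow> ('m, 'n) form1" where
  "dpp0 C N f p c e = (if c \<in> charts_at C p then dfun f p c (vproj N p c e) else 0)"

definition dpp1 :: "('m, 'n::finite) chart set \<Rightarrow> ('m \<Rightarrow> ('m, 'n) chart \<Rightarrow> 'n model set) \<Rightarrow>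
    ('m, 'n) form1 \<Rightarrow> ('m, 'n) form2" where
  "dpp1 C N \<kappa> p c u v = d1 C \<kappa> p c (vproj N p c u) (vproj N p c v)"

definition dpp_closed01 :: "('m, 'n::finite) chart set \<Rightarrow> ('m \<Rightarrow> ('m, 'n) chart \<Rightarrow> 'n model set) \<Rightarrow>
    ('m, 'n) form1 \<Rightarrow> bool" where
  "dpp_closed01 C N \<kappa> \<longleftrightarrow> form01 C N \<kappa> \<and>
     (\<forall>p. \<forall>c\<in>charts_at C p. \<forall>u v. dpp1 C N \<kappa> p c u v = 0)"

section \<open>Locally Lagrange spaces\<close>

definition partial_y :: "'n \<Rightarrow> ('n::finite model \<Rightarrow> real) \<Rightarrow> 'n model \<Rightarrow> real" where
  "partial_y i F q = frechet_derivative F (at q) (0, axis i 1)"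

definition g_of :: "('m \<Rightarrow> real) \<Rightarrow> 'm \<Rightarrow> ('m, 'n::finite) chart \<Rightarrow> 'n model \<Rightarrow> 'n model \<Rightarrow> real" where
  "g_of L p c u v = (\<Sum>i\<in>UNIV. \<Sum>j\<in>UNIV.
      partial_y i (partial_y j (L \<circ> cinv c)) (coord c p) * fst u $ i * fst v $ j)"

definition theta :: "('m, 'n::finite) chart set \<Rightarrow> ('m \<Rightarrow> real) \<Rightarrow> ('m, 'n) form1" where
  "theta C L p c e = (if c \<in> charts_at C p then
      (\<Sum>i\<in>UNIV. partial_y i (L \<circ> cinv c) (coord c p) * fst e $ i) else 0)"

definition omega :: "('m, 'n::finite) chart set \<Rightarrow> ('m \<Rightarrow> real) \<Rightarrow> ('m, 'n) form2" where
  "omega C L = d1 C (theta C L)"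

definition regular_on :: "('m, 'n::finite) chart set \<Rightarrow> 'm set \<Rightarrow> ('m \<Rightarrow> real) \<Rightarrow> bool" where
  "regular_on C V L \<longleftrightarrow> (\<forall>p\<in>V. \<forall>c\<in>charts_at C p. \<forall>u. (\<forall>v. g_of L p c u v = 0) \<longrightarrow> u \<in> vert)"

text \<open>A section of the symmetric square of the conormal bundle of the vertical foliation is a symmetric
  2-tensor that vanishes on vertical arguments; non degeneracy is meant on the quotient by \<^term>\<open>vert\<close>.\<close>

definition transversal_metric :: "('m, 'n::finite) chart set \<Rightarrow> ('m, 'n) form2 \<Rightarrow> bool" where
  "transversal_metric C g \<longleftrightarrow> tensor2 C g \<and>
     (\<forall>p. \<forall>c\<in>charts_at C p. \<forall>u v. g p c u v = g p c v u) \<and>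
     (\<forall>p. \<forall>c\<in>charts_at C p. \<forall>u\<in>vert. \<forall>v. g p c u v = 0) \<and>
     (\<forall>p. \<forall>c\<in>charts_at C p. \<forall>u. (\<forall>v. g p c u v = 0) \<longrightarrow> u \<in> vert)"

definition locally_lagrange_space :: "('m::topological_space, 'n::finite) chart set \<Rightarrow> ('m, 'n) endo \<Rightarrow>
    ('m, 'n) form2 \<Rightarrow> ('i \<Rightarrow> 'm set) \<Rightarrow> ('i \<Rightarrow> 'm \<Rightarrow> real) \<Rightarrow> bool" where
  "locally_lagrange_space A S g U L \<longleftrightarrow> tangent_manifold A S \<and>
     transversal_metric (adapted_charts A S) g \<and>
     (\<forall>\<alpha>. \<exists>c\<in>adapted_charts A S. cdom c = U \<alpha>) \<and> (\<Union>\<alpha>. U \<alpha>) = UNIV \<and>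
     (\<forall>\<alpha>. smooth_fun (adapted_charts A S) (U \<alpha>) (L \<alpha>) \<and> regular_on (adapted_charts A S) (U \<alpha>) (L \<alpha>)) \<and>
     (\<forall>\<alpha>. \<forall>p\<in>U \<alpha>. \<forall>c\<in>charts_at (adapted_charts A S) p. \<forall>u v. g p c u v = g_of (L \<alpha>) p c u v)"

section \<open>First sheaf cohomology\<close>

text \<open>A sheaf of abelian groups is given by its sections \<open>F V\<close>, where a section over \<open>V\<close> is represented
  by a function on the whole space of which only the values on \<open>V\<close> matter.
  \<open>H\<^sup>1(M, F)\<close> is the direct limit of the Cech groups over all open coverings, formed over the cofinal family of
  the coverings indexed by the points, \<open>x \<in> V x\<close>. Group operations on values come from
  \<open>HOL-Library.Function_Algebras\<close>.\<close>

type_synonym ('m, 'b) sheaf = "'m set \<Rightarrow> ('m \<Rightarrow> 'b) set"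
type_synonym ('m, 'b) cocycle = "('m \<Rightarrow> 'm set) \<times> ('m \<Rightarrow> 'm \<Rightarrow> 'm \<Rightarrow> 'b)"

definition point_cover :: "('m::topological_space \<Rightarrow> 'm set) \<Rightarrow> bool" where
  "point_cover V \<longleftrightarrow> (\<forall>x. open (V x) \<and> x \<in> V x)"

definition Z1 :: "('m::topological_space, 'b::ab_group_add) sheaf \<Rightarrow> ('m, 'b) cocycle set" where
  "Z1 F = {(V, s). point_cover V \<and> (\<forall>x y. s x y \<in> F (V x \<inter> V y)) \<and>
     (\<forall>x y z. \<forall>p\<in>V x \<inter> V y \<inter> V z. s x y p + s y z p = s x z p)}"

definition H1_rel :: "('m::topological_space, 'b::ab_group_add) sheaf \<Rightarrow>
    (('m, 'b) cocycle \<times> ('m, 'b) cocycle) set" where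
  "H1_rel F = {((V, s), (W, t)). (V, s) \<in> Z1 F \<and> (W, t) \<in> Z1 F \<and>
     (\<exists>R h. point_cover R \<and> (\<forall>x. R x \<subseteq> V x \<inter> W x) \<and> (\<forall>x. h x \<in> F (R x)) \<and>
       (\<forall>x y. \<forall>p\<in>R x \<inter> R y. s x y p - t x y p = h y p - h x p))}"

definition H1 :: "('m::topological_space, 'b::ab_group_add) sheaf \<Rightarrow> ('m, 'b) cocycle set set" where
  "H1 F = Z1 F // H1_rel F"

definition H1_zero :: "('m::topological_space, 'b::ab_group_add) sheaf \<Rightarrow> ('m, 'b) cocycle set" where
  "H1_zero F = H1_rel F `` {(\<lambda>x. UNIV, \<lambda>x y p. 0)}"

text \<open>The class of a cocycle on an arbitrarily indexed open covering \<open>U\<close>, by passing to the point-indexed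
  refinements \<open>x \<mapsto> U (r x)\<close>; the class does not depend on the refinement map \<open>r\<close>.\<close>

definition cech_class :: "('m::topological_space, 'b::ab_group_add) sheaf \<Rightarrow> ('i \<Rightarrow> 'm set) \<Rightarrow>
    ('i \<Rightarrow> 'i \<Rightarrow> 'm \<Rightarrow> 'b) \<Rightarrow> ('m, 'b) cocycle set" where
  "cech_class F U s = H1_rel F `` {(\<lambda>x. U (r x), \<lambda>x y. s (r x) (r y)) | r. \<forall>x. x \<in> U (r x)}"

text \<open>The map induced by a morphism of sheaves (with target \<open>G\<close>).\<close>

definition H1_map :: "('m::topological_space, 'b::ab_group_add) sheaf \<Rightarrow>
    (('m \<Rightarrow> 'a) \<Rightarrow> ('m \<Rightarrow> 'b)) \<Rightarrow> ('m, 'a) cocycle set \<Rightarrow> ('m, 'b) cocycle set" where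
  "H1_map G f X = H1_rel G `` {(V, \<lambda>x y. f (s x y)) | V s. (V, s) \<in> X}"

section \<open>The sheaves and the Lagrangian obstructions\<close>

definition Phi :: "('m, 'n::finite) chart set \<Rightarrow> ('m, real) sheaf" where
  "Phi C V = {f. smooth_fun C V f \<and> (\<forall>p\<in>V. \<exists>c\<in>charts_at C p. cdom c \<subseteq> V \<and>
     (\<exists>b. smooth_on (fst ` coord c ` cdom c) b \<and> (\<forall>q\<in>cdom c. f q = b (fst (coord c q)))))}"

definition A0 :: "('m, 'n::finite) chart set \<Rightarrow> ('m, real) sheaf" where
  "A0 C V = {f. smooth_fun C V f \<and> (\<forall>p\<in>V. \<exists>c\<in>charts_at C p. cdom c \<subseteq> V \<and>
     (\<exists>\<phi> b. smooth_on (fst ` coord c ` cdom c) \<phi> \<and> smooth_on (fst ` coord c ` cdom c) b \<and>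
       (\<forall>q\<in>cdom c. f q =
          (\<Sum>i\<in>UNIV. \<phi> (fst (coord c q)) $ i * snd (coord c q) $ i) + b (fst (coord c q)))))}"

definition Omega_pr :: "('m, 'n::finite) chart set \<Rightarrow> ('m, ('m, 'n) chart \<Rightarrow> 'n model \<Rightarrow> real) sheaf" where
  "Omega_pr C V = {\<alpha>. one_form_on C V \<alpha> \<and> (\<forall>p\<in>V. \<exists>c\<in>charts_at C p. cdom c \<subseteq> V \<and>
     (\<exists>\<phi>. smooth_on (fst ` coord c ` cdom c) \<phi> \<and>
       (\<forall>q\<in>cdom c. \<forall>e. \<alpha> q c e = (\<Sum>i\<in>UNIV. \<phi> (fst (coord c q)) $ i * fst e $ i))))}"

definition iota_star :: "('m::topological_space, 'n::finite) chart set \<Rightarrow>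
    ('m, real) cocycle set \<Rightarrow> ('m, real) cocycle set" where
  "iota_star C = H1_map (A0 C) (\<lambda>f. f)"

text \<open>On a function \<open>\<phi>\<^sub>i(x) y\<^sup>i + b(x)\<close> the operator \<^term>\<open>theta C\<close> is \<open>\<phi>\<^sub>i dx\<^sup>i\<close>, that is, the
  projection of the sheaf \<^term>\<open>A0 C\<close> onto \<^term>\<open>Omega_pr C\<close>.\<close>

definition pi_star :: "('m::topological_space, 'n::finite) chart set \<Rightarrow>
    ('m, real) cocycle set \<Rightarrow> ('m, ('m, 'n) chart \<Rightarrow> 'n model \<Rightarrow> real) cocycle set" where
  "pi_star C = H1_map (Omega_pr C) (theta C)"

definition lagr_class :: "('m::topological_space, 'n::finite) chart set \<Rightarrow> ('i \<Rightarrow> 'm set) \<Rightarrow>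
    ('i \<Rightarrow> 'm \<Rightarrow> real) \<Rightarrow> ('m, real) cocycle set" where
  "lagr_class C U L = cech_class (A0 C) U (\<lambda>\<alpha> \<beta> p. L \<beta> p - L \<alpha> p)"

definition first_obstruction :: "('m::topological_space, 'n::finite) chart set \<Rightarrow> ('i \<Rightarrow> 'm set) \<Rightarrow>
    ('i \<Rightarrow> 'm \<Rightarrow> real) \<Rightarrow> ('m, ('m, 'n) chart \<Rightarrow> 'n model \<Rightarrow> real) cocycle set" where
  "first_obstruction C U L = pi_star C (lagr_class C U L)"

text \<open>The defining property of the second obstruction. A class with this property is unique if
  \<^term>\<open>iota_star C\<close> is injective on \<^term>\<open>H1 (Phi C)\<close>, that is, if the connecting homomorphism
  from \<open>H\<^sup>0(M, \<Omega>\<^sub>p\<^sub>r)\<close> to \<open>H\<^sup>1(M, \<Phi>)\<close> is zero. This does not hold for all tangent manifolds: if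
  \<open>y\<^sup>1\<close> is periodic, the global form \<open>dx\<^sup>1\<close> does not come from a global section of \<^term>\<open>A0 C\<close>.\<close>

definition is_second_obstruction :: "('m::topological_space, 'n::finite) chart set \<Rightarrow> ('i \<Rightarrow> 'm set) \<Rightarrow>
    ('i \<Rightarrow> 'm \<Rightarrow> real) \<Rightarrow> ('m, real) cocycle set \<Rightarrow> bool" where
  "is_second_obstruction C U L X \<longleftrightarrow> X \<in> H1 (Phi C) \<and> iota_star C X = lagr_class C U L"

definition second_obstruction :: "('m::topological_space, 'n::finite) chart set \<Rightarrow> ('i \<Rightarrow> 'm set) \<Rightarrow>
    ('i \<Rightarrow> 'm \<Rightarrow> real) \<Rightarrow> ('m, real) cocycle set" where
  "second_obstruction C U L = (THE X. is_second_obstruction C U L X)"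

definition represents :: "('m::topological_space, 'n::finite) chart set \<Rightarrow>
    ('m \<Rightarrow> ('m, 'n) chart \<Rightarrow> 'n model set) \<Rightarrow> ('m, 'n) form1 \<Rightarrow> ('m, real) cocycle set \<Rightarrow> bool" where
  "represents C N \<kappa> X \<longleftrightarrow> dpp_closed01 C N \<kappa> \<and>
     (\<exists>V f. point_cover V \<and> (\<forall>x. smooth_fun C (V x) (f x)) \<and>
       (\<forall>x. \<forall>p\<in>V x. \<kappa> p = dpp0 C N (f x) p) \<and>
       X = cech_class (Phi C) V (\<lambda>x y p. f y p - f x p))"

section \<open>Subordinated structures\<close>

definition subordinated :: "('m, 'n::finite) chart set \<Rightarrow> ('i \<Rightarrow> 'm set) \<Rightarrow>
    ('i \<Rightarrow> 'm \<Rightarrow> real) \<Rightarrow> ('i \<Rightarrow> 'm \<Rightarrow> real) \<Rightarrow> bool" where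
  "subordinated C U L L' \<longleftrightarrow> (\<forall>\<alpha>. smooth_fun C (U \<alpha>) (L' \<alpha>) \<and> regular_on C (U \<alpha>) (L' \<alpha>) \<and>
     (\<lambda>p. L' \<alpha> p - L \<alpha> p) \<in> A0 C (U \<alpha>))"

definition thetas_glue :: "('m, 'n::finite) chart set \<Rightarrow> ('i \<Rightarrow> 'm set) \<Rightarrow> ('i \<Rightarrow> 'm \<Rightarrow> real) \<Rightarrow> bool" where
  "thetas_glue C U L' \<longleftrightarrow> (\<exists>\<Theta>. one_form_on C UNIV \<Theta> \<and> (\<forall>\<alpha>. \<forall>p\<in>U \<alpha>. \<Theta> p = theta C (L' \<alpha>) p))"

definition locally_lagrangian_symplectic :: "('m, 'n::finite) chart set \<Rightarrow> ('i \<Rightarrow> 'm set) \<Rightarrow>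
    ('i \<Rightarrow> 'm \<Rightarrow> real) \<Rightarrow> bool" where
  "locally_lagrangian_symplectic C U L' \<longleftrightarrow>
     (\<exists>\<Omega>. symplectic_form C \<Omega> \<and> (\<forall>\<alpha>. \<forall>p\<in>U \<alpha>. \<Omega> p = omega C (L' \<alpha>) p))"

end

theory Submission
  imports Defs
begin

text \<open>
  In adapted charts \<open>\<theta>\<^sub>L\<close> is \<open>dL \<circ> S\<close>, a genuine 1-form, and \<open>\<iota>\<^bsub>Sv\<^esub> \<omega>\<^sub>L = g\<^sub>L(v, \<cdot>)\<close>. Hence \<open>\<Phi>\<close> consists of the
  functions with \<open>\<theta>\<^sub>f = 0\<close>, and \<open>A\<^sup>0\<close> of those whose \<open>\<theta>\<^sub>f\<close> is a foliated form, equivalently with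
  \<open>g\<^sub>f = 0\<close>. If the first obstruction vanishes, then on a refinement \<open>\<theta>\<close> of \<open>L\<^sub>y - L\<^sub>x\<close> is \<open>h\<^sub>y - h\<^sub>x\<close> with foliated forms
  \<open>h\<^sub>x\<close>, and the forms \<open>\<theta>\<close> of \<open>L\<^sub>x\<close> minus \<open>h\<^sub>x\<close> glue to a global form \<open>\<Theta>\<close>. On each \<open>U\<^sub>\<alpha>\<close>, \<open>\<Theta>\<close> differs from \<open>\<theta>\<close> of
  \<open>L\<^sub>\<alpha>\<close> by a foliated form \<open>\<phi>\<^sub>i dx\<^sup>i\<close>, which is \<open>\<theta>\<close> of \<open>\<phi>\<^sub>i y\<^sup>i\<close>; adding that function to \<open>L\<^sub>\<alpha>\<close> gives the
  subordinated structure. The symplectic form is \<open>d\<Theta>\<close>, and \<open>\<kappa>\<close> is obtained from \<open>\<Theta>\<close> and the projection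
  onto the vertical bundle along the normal bundle.
\<close>

section \<open>Calculus of smooth functions\<close>

text \<open>The sheaves are given by formulas valid in some chart around each point, and two
  sections come with two different charts, so that even closure under sums is not visible. The
  invariant descriptions involve no choice of chart, and the group properties then follow from the
  linearity of differentiation. From a formula to the invariant condition one differentiates; the
  converse needs charts whose image is a box with convex fibres, where vanishing vertical
  derivatives force independence of y.

  The other obstacle is the covering. A class that vanishes in the direct limit gives a coboundary
  on some refinement only, while the corrected Lagrangians must live on the given sets
  \<open>U \<alpha>\<close>. Passing to the global form \<Theta> forgets the refinement, and on a
  chart domain the primitive is an explicit sum, because the coordinates y^i are defined on the
  whole domain.

  For the second obstruction, the differences of the corrected Lagrangians are sections of
  \<open>Phi C\<close>, and the corrections themselves form the cochain in \<open>A0 C\<close> that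
  compares them with the differences of the original ones.\<close>

abbreviation pd :: "'a::real_normed_vector \<Rightarrow> ('a \<Rightarrow> 'b::real_normed_vector) \<Rightarrow> 'a \<Rightarrow> 'b" where
  "pd v f \<equiv> \<lambda>x. frechet_derivative f (at x) v"

lemma pd_eq: "(f has_derivative f') (at x) \<Longrightarrow> pd v f x = f' v"
  using frechet_derivative_at by metis

text \<open>The predicates \<open>has_derivative\<close> of the two functions coincide, hence so do
  the choices made by \<open>frechet_derivative\<close>. This remains true at points where neither
  function is differentiable.\<close>

lemma pd_cong:
  assumes "open T" "x \<in> T" "\<And>z. z \<in> T \<Longrightarrow> f z = g z"
  shows "frechet_derivative f (at x) = frechet_derivative g (at x)"
proof -
  have "(f has_derivative f') (at x) \<longleftrightarrow> (g has_derivative f') (at x)" for f'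
    using has_derivative_transform_within_open[of f f' x UNIV T g]
      has_derivative_transform_within_open[of g f' x UNIV T f] assms by auto
  then show ?thesis by (simp add: frechet_derivative_def)
qed

lemma differentiable_cong_open:
  assumes "open T" "x \<in> T" "\<And>z. z \<in> T \<Longrightarrow> f z = g z" "f differentiable at x"
  shows "g differentiable at x"
  using assms has_derivative_transform_within_open[of f _ x UNIV T g]
  unfolding differentiable_def by blast

declare Ck_on.simps(2) [simp del]

section \<open>Rules for C^k maps: locality, algebraic operations, composition\<close>

lemma Ck_on_SucI:
  "(\<And>x. x \<in> T \<Longrightarrow> f differentiable at x) \<Longrightarrow> (\<And>v. Ck_on k T (pd v f)) \<Longrightarrow> Ck_on (Suc k) T f"
  by (simp add: Ck_on.simps(2))

lemma Ck_on_SucD: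
  assumes "Ck_on (Suc k) T f"
  shows "x \<in> T \<Longrightarrow> f differentiable at x" and "Ck_on k T (pd v f)"
  using assms by (simp_all add: Ck_on.simps(2))

lemma Ck_on_cong:
  assumes "open T" "\<And>z. z \<in> T \<Longrightarrow> f z = g z" "Ck_on k T f"
  shows "Ck_on k T g"
  using assms(2,3)
proof (induction k arbitrary: f g)
  case 0
  then show ?case by (simp cong: continuous_on_cong)
next
  case (Suc k)
  have "Ck_on k T (pd v g)" for v
  proof (rule Suc.IH)
    show "pd v f z = pd v g z" if "z \<in> T" for z
      using pd_cong[OF assms(1) that Suc.prems(1)] by simp
  qed (rule Ck_on_SucD(2)[OF Suc.prems(2)])
  moreover have "g differentiable at x" if "x \<in> T" for x
    by (rule differentiable_cong_open[OF assms(1) that Suc.prems(1) Ck_on_SucD(1)[OF Suc.prems(2) that]])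
  ultimately show ?case by (auto intro!: Ck_on_SucI)
qed

lemma Ck_on_mono: "Ck_on k T f \<Longrightarrow> W \<subseteq> T \<Longrightarrow> Ck_on k W f"
proof (induction k arbitrary: f)
  case 0
  then show ?case using continuous_on_subset by auto
next
  case (Suc k)
  then show ?case using Ck_on_SucI[of W f k] Ck_on_SucD[of k T f] by (meson subsetD)
qed

lemma Ck_on_local:
  assumes "open T" "\<And>x. x \<in> T \<Longrightarrow> \<exists>W. open W \<and> x \<in> W \<and> Ck_on k W f"
  shows "Ck_on k T f"
  using assms(2)
proof (induction k arbitrary: f)
  case 0
  have "continuous (at x) f" if x: "x \<in> T" for x
  proof -
    obtain W where "open W" "x \<in> W" "Ck_on 0 W f" using 0[OF x] by (elim exE conjE)
    then show ?thesis using continuous_on_eq_continuous_at[of W f] by simp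
  qed
  then show ?case using assms(1) by (simp add: continuous_on_eq_continuous_at)
next
  case (Suc k)
  have "Ck_on k T (pd v f)" for v
  proof (rule Suc.IH)
    fix x assume "x \<in> T"
    then obtain W where "open W" "x \<in> W" "Ck_on (Suc k) W f" using Suc.prems by meson
    then show "\<exists>W. open W \<and> x \<in> W \<and> Ck_on k W (pd v f)" using Ck_on_SucD(2)[of k W f v] by meson
  qed
  moreover have "f differentiable at x" if "x \<in> T" for x
    using Suc.prems[OF that] Ck_on_SucD(1)[of k _ f x] by meson
  ultimately show ?case by (auto intro!: Ck_on_SucI)
qed

lemma Ck_on_continuous: "Ck_on k T f \<Longrightarrow> continuous_on T f"
  by (cases k) (auto simp: Ck_on.simps(2) intro!: continuous_at_imp_continuous_on differentiable_imp_continuous_within)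

text \<open>Beyond order 0 the recursion does not state continuity of the function itself;
  differentiability supplies it in the base case.\<close>

lemma Ck_on_Suc: "Ck_on (Suc k) T f \<Longrightarrow> Ck_on k T f"
proof (induction k arbitrary: f)
  case 0
  then show ?case using Ck_on_continuous by (metis Ck_on.simps(1))
next
  case (Suc k)
  have "Ck_on k T (pd v f)" for v using Suc.IH Ck_on_SucD(2)[OF Suc.prems] .
  then show ?case using Ck_on_SucD(1)[OF Suc.prems] by (auto intro!: Ck_on_SucI)
qed

lemma Ck_on_const: "Ck_on k T (\<lambda>x. c)"
  by (induction k arbitrary: c) (auto simp: Ck_on.simps(2))

lemma Ck_on_bounded_linear:
  assumes "bounded_linear f" shows "Ck_on k T f"
proof (cases k)
  case 0
  then show ?thesis using assms by (simp add: linear_continuous_on)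
next
  case (Suc l)
  have "pd v f = (\<lambda>x. f v)" for v
    using pd_eq[OF bounded_linear_imp_has_derivative[OF assms]] by auto
  moreover have "f differentiable at x" for x
    using bounded_linear_imp_has_derivative[OF assms] differentiable_def by blast
  ultimately show ?thesis using Suc by (simp add: Ck_on_const Ck_on.simps(2))
qed

lemma Ck_on_bounded_linear_comp:
  assumes "bounded_linear h" "open T" "Ck_on k T f" shows "Ck_on k T (\<lambda>x. h (f x))"
  using assms(3)
proof (induction k arbitrary: f)
  case 0
  then show ?case using bounded_linear.continuous_on[OF assms(1)] by auto
next
  case (Suc k)
  have d: "((\<lambda>x. h (f x)) has_derivative (\<lambda>v. h (pd v f x))) (at x)" if "x \<in> T" for x
    using bounded_linear.has_derivative[OF assms(1)] Ck_on_SucD(1)[OF Suc.prems that]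
    by (simp add: frechet_derivative_works)
  have "Ck_on k T (pd v (\<lambda>x. h (f x)))" for v
    by (rule Ck_on_cong[where f = "\<lambda>x. h (pd v f x)"])
      (use assms Suc.IH Ck_on_SucD(2)[OF Suc.prems] pd_eq[OF d] in auto)
  then show ?case using d by (auto intro!: Ck_on_SucI) (auto simp: differentiable_def)
qed

lemma Ck_on_add:
  assumes "open T" "Ck_on k T f" "Ck_on k T g" shows "Ck_on k T (\<lambda>x. f x + g x)"
  using assms(2,3)
proof (induction k arbitrary: f g)
  case 0
  then show ?case by (auto intro: continuous_intros)
next
  case (Suc k)
  have d: "((\<lambda>x. f x + g x) has_derivative (\<lambda>v. pd v f x + pd v g x)) (at x)" if "x \<in> T" for x
    using Ck_on_SucD(1)[OF Suc.prems(1) that] Ck_on_SucD(1)[OF Suc.prems(2) that]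
    by (auto intro!: has_derivative_add simp: frechet_derivative_works[symmetric])
  have "Ck_on k T (pd v (\<lambda>x. f x + g x))" for v
    by (rule Ck_on_cong[where f = "\<lambda>x. pd v f x + pd v g x"])
      (use assms Suc.IH Ck_on_SucD(2)[OF Suc.prems(1)] Ck_on_SucD(2)[OF Suc.prems(2)] pd_eq[OF d] in auto)
  then show ?case using d by (auto intro!: Ck_on_SucI) (auto simp: differentiable_def)
qed

lemma Ck_on_sum:
  assumes "open T" "\<And>i. i \<in> I \<Longrightarrow> Ck_on k T (f i)" shows "Ck_on k T (\<lambda>x. \<Sum>i\<in>I. f i x)"
  using assms(2)
  by (induction I rule: infinite_finite_induct) (auto simp: Ck_on_const intro!: Ck_on_add assms(1))

lemma Ck_on_scaleR:
  fixes f :: "'a::real_normed_vector \<Rightarrow> real"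
  assumes "open T" "Ck_on k T f" "Ck_on k T g" shows "Ck_on k T (\<lambda>x. f x *\<^sub>R g x)"
  using assms(2,3)
proof (induction k arbitrary: f g)
  case 0
  then show ?case by (auto intro: continuous_intros)
next
  case (Suc k)
  have d: "((\<lambda>x. f x *\<^sub>R g x) has_derivative (\<lambda>v. f x *\<^sub>R pd v g x + pd v f x *\<^sub>R g x)) (at x)"
    if "x \<in> T" for x
    using Ck_on_SucD(1)[OF Suc.prems(1) that] Ck_on_SucD(1)[OF Suc.prems(2) that]
    by (auto intro!: has_derivative_scaleR simp: frechet_derivative_works[symmetric])
  have "Ck_on k T (pd v (\<lambda>x. f x *\<^sub>R g x))" for v
    by (rule Ck_on_cong[where f = "\<lambda>x. f x *\<^sub>R pd v g x + pd v f x *\<^sub>R g x"])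
      (use assms(1) pd_eq[OF d] in
        \<open>auto intro!: Ck_on_add Suc.IH Ck_on_Suc[OF Suc.prems(1)] Ck_on_Suc[OF Suc.prems(2)]
          Ck_on_SucD(2)[OF Suc.prems(1)] Ck_on_SucD(2)[OF Suc.prems(2)]\<close>)
  then show ?case using d by (auto intro!: Ck_on_SucI) (auto simp: differentiable_def)
qed

lemma pd_chain:
  fixes f :: "'a::real_normed_vector \<Rightarrow> 'b::euclidean_space"
  assumes "f differentiable at x" "g differentiable at (f x)"
  shows "pd v (g \<circ> f) x = pd (pd v f x) g (f x)"
    and "(g \<circ> f) differentiable at x"
  by (simp_all add: frechet_derivative_compose[OF assms] differentiable_chain_at[OF assms])

text \<open>The chain rule differentiates the outer map in a direction that varies with the point,
  whereas \<open>Ck_on\<close> speaks of fixed directions. This expansion reduces a varying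
  direction to finitely many fixed ones.\<close>

lemma pd_basis:
  fixes f :: "'a::euclidean_space \<Rightarrow> 'b::real_normed_vector"
  assumes "f differentiable at x"
  shows "pd v f x = (\<Sum>b\<in>Basis. (v \<bullet> b) *\<^sub>R pd b f x)"
proof -
  have l: "linear (frechet_derivative f (at x))" by (rule linear_frechet_derivative[OF assms])
  have "pd v f x = pd (\<Sum>b\<in>Basis. (v \<bullet> b) *\<^sub>R b) f x" by (simp add: euclidean_representation)
  also have "\<dots> = (\<Sum>b\<in>Basis. (v \<bullet> b) *\<^sub>R pd b f x)"
    by (simp add: linear_sum[OF l] linear_cmul[OF l])
  finally show ?thesis .
qed

text \<open>The induction varies the outer map only: its partial derivatives composed with
  \<open>f\<close> are covered by the hypothesis, one order lower.\<close>

lemma Ck_on_compose: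
  fixes f :: "'a::real_normed_vector \<Rightarrow> 'b::euclidean_space"
  assumes "open T" "open W" "f ` T \<subseteq> W" "Ck_on k T f" "Ck_on k W g"
  shows "Ck_on k T (g \<circ> f)"
  using assms(4,5)
proof (induction k arbitrary: g)
  case 0
  then show ?case using assms(3) continuous_on_compose continuous_on_subset
    by (metis Ck_on.simps(1))
next
  case (Suc k)
  have df: "f differentiable at x" and dg: "g differentiable at (f x)" if "x \<in> T" for x
    using Ck_on_SucD(1)[OF Suc.prems(1) that] Ck_on_SucD(1)[OF Suc.prems(2)] assms(3) that by auto
  have "Ck_on k T (pd v (g \<circ> f))" for v
  proof (rule Ck_on_cong[where f = "\<lambda>x. \<Sum>b\<in>Basis. (pd v f x \<bullet> b) *\<^sub>R (pd b g \<circ> f) x"])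
    show "(\<Sum>b\<in>Basis. (pd v f z \<bullet> b) *\<^sub>R (pd b g \<circ> f) z) = pd v (g \<circ> f) z" if "z \<in> T" for z
    proof -
      have "pd v (g \<circ> f) z = pd (pd v f z) g (f z)" by (rule pd_chain(1)[OF df dg, OF that that])
      also have "\<dots> = (\<Sum>b\<in>Basis. (pd v f z \<bullet> b) *\<^sub>R pd b g (f z))" by (rule pd_basis[OF dg[OF that]])
      finally show ?thesis by simp
    qed
    show "Ck_on k T (\<lambda>x. \<Sum>b\<in>Basis. (pd v f x \<bullet> b) *\<^sub>R (pd b g \<circ> f) x)"
    proof (intro Ck_on_sum Ck_on_scaleR assms(1))
      show "Ck_on k T (\<lambda>x. pd v f x \<bullet> b)" for b
        by (rule Ck_on_bounded_linear_comp[OF bounded_linear_inner_left assms(1)])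
          (rule Ck_on_SucD(2)[OF Suc.prems(1)])
      show "Ck_on k T (pd b g \<circ> f)" for b
        by (rule Suc.IH[OF Ck_on_Suc[OF Suc.prems(1)] Ck_on_SucD(2)[OF Suc.prems(2)]])
    qed
  qed (rule assms(1))
  then show ?case by (intro Ck_on_SucI pd_chain(2)[OF df dg])
qed

text \<open>The derivative is built from the inverse itself and from derivatives of
  \<open>f\<close>, so the induction hypothesis closes the argument. The denominator in Cramer's
  rule requires it.\<close>

lemma Ck_on_inverse:
  fixes f :: "'a::real_normed_vector \<Rightarrow> real"
  assumes "open T" "\<And>x. x \<in> T \<Longrightarrow> f x \<noteq> 0" "Ck_on k T f"
  shows "Ck_on k T (\<lambda>x. inverse (f x))"
  using assms(3)
proof (induction k)
  case 0
  then show ?case using assms(2) by (auto intro: continuous_intros)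
next
  case (Suc k)
  have d: "((\<lambda>x. inverse (f x)) has_derivative
      (\<lambda>v. - (inverse (f x) * pd v f x * inverse (f x)))) (at x)" if "x \<in> T" for x
    using Ck_on_SucD(1)[OF Suc.prems that] that by (auto intro!: Deriv.has_derivative_inverse assms(2) simp: frechet_derivative_works[symmetric])
  have i: "Ck_on k T (\<lambda>x. inverse (f x))" using Suc.IH Ck_on_Suc[OF Suc.prems] .
  have "Ck_on k T (pd v (\<lambda>x. inverse (f x)))" for v
  proof (rule Ck_on_cong[where f = "\<lambda>x. inverse (f x) *\<^sub>R pd v f x *\<^sub>R (- 1 * inverse (f x))"])
    have "Ck_on k T (\<lambda>x. - 1 * inverse (f x))"
      by (rule Ck_on_bounded_linear_comp[OF bounded_linear_mult_right assms(1) i])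
    then show "Ck_on k T (\<lambda>x. inverse (f x) *\<^sub>R pd v f x *\<^sub>R (- 1 * inverse (f x)))"
      by (intro Ck_on_scaleR assms(1) i Ck_on_SucD(2)[OF Suc.prems])
  qed (use pd_eq[OF d] assms(1) in auto)
  then show ?case using d by (auto intro!: Ck_on_SucI) (auto simp: differentiable_def)
qed

lemma smooth_on_cong: "open T \<Longrightarrow> (\<And>z. z \<in> T \<Longrightarrow> f z = g z) \<Longrightarrow> smooth_on T f \<Longrightarrow> smooth_on T g"
  unfolding smooth_on_def using Ck_on_cong by blast

lemma smooth_on_mono: "smooth_on T f \<Longrightarrow> W \<subseteq> T \<Longrightarrow> smooth_on W f"
  unfolding smooth_on_def using Ck_on_mono by blast

lemma smooth_on_local:
  "open T \<Longrightarrow> (\<And>x. x \<in> T \<Longrightarrow> \<exists>W. open W \<and> x \<in> W \<and> smooth_on W f) \<Longrightarrow> smooth_on T f"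
  unfolding smooth_on_def by (intro allI, rule Ck_on_local) meson+

lemma smooth_on_const: "smooth_on T (\<lambda>x. c)"
  unfolding smooth_on_def using Ck_on_const by blast

lemma smooth_on_bounded_linear: "bounded_linear f \<Longrightarrow> smooth_on T f"
  unfolding smooth_on_def using Ck_on_bounded_linear by blast

lemma smooth_on_bounded_linear_comp:
  "bounded_linear h \<Longrightarrow> open T \<Longrightarrow> smooth_on T f \<Longrightarrow> smooth_on T (\<lambda>x. h (f x))"
  unfolding smooth_on_def using Ck_on_bounded_linear_comp by blast

lemma smooth_on_add:
  "open T \<Longrightarrow> smooth_on T f \<Longrightarrow> smooth_on T g \<Longrightarrow> smooth_on T (\<lambda>x. f x + g x)"
  by (simp add: smooth_on_def Ck_on_add)

lemma smooth_on_sum: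
  "open T \<Longrightarrow> (\<And>i. i \<in> I \<Longrightarrow> smooth_on T (f i)) \<Longrightarrow> smooth_on T (\<lambda>x. \<Sum>i\<in>I. f i x)"
  by (simp add: smooth_on_def Ck_on_sum)

lemma smooth_on_scaleR:
  fixes f :: "'a::real_normed_vector \<Rightarrow> real"
  shows "open T \<Longrightarrow> smooth_on T f \<Longrightarrow> smooth_on T g \<Longrightarrow> smooth_on T (\<lambda>x. f x *\<^sub>R g x)"
  by (simp add: smooth_on_def Ck_on_scaleR)

lemma smooth_on_mult:
  fixes f g :: "'a::real_normed_vector \<Rightarrow> real"
  shows "open T \<Longrightarrow> smooth_on T f \<Longrightarrow> smooth_on T g \<Longrightarrow> smooth_on T (\<lambda>x. f x * g x)"
  using smooth_on_scaleR[of T f g] by simp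

lemma smooth_on_diff:
  assumes "open T" "smooth_on T f" "smooth_on T g" shows "smooth_on T (\<lambda>x. f x - g x)"
  using smooth_on_add[OF assms(1,2) smooth_on_bounded_linear_comp[OF bounded_linear_minus[OF bounded_linear_ident] assms(1,3)]]
  by simp

lemma smooth_on_prod:
  fixes f :: "'i \<Rightarrow> 'a::real_normed_vector \<Rightarrow> real"
  assumes "open T" "\<And>i. i \<in> I \<Longrightarrow> smooth_on T (f i)" shows "smooth_on T (\<lambda>x. \<Prod>i\<in>I. f i x)"
  using assms(2)
  by (induction I rule: infinite_finite_induct) (auto simp: smooth_on_const intro!: smooth_on_mult assms(1))

lemma smooth_on_inverse:
  fixes f :: "'a::real_normed_vector \<Rightarrow> real"
  shows "open T \<Longrightarrow> (\<And>x. x \<in> T \<Longrightarrow> f x \<noteq> 0) \<Longrightarrow> smooth_on T f \<Longrightarrow> smooth_on T (\<lambda>x. inverse (f x))"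
  by (simp add: smooth_on_def Ck_on_inverse)

lemma smooth_on_compose:
  fixes f :: "'a::real_normed_vector \<Rightarrow> 'b::euclidean_space"
  shows "open T \<Longrightarrow> open W \<Longrightarrow> f ` T \<subseteq> W \<Longrightarrow> smooth_on T f \<Longrightarrow> smooth_on W g \<Longrightarrow> smooth_on T (g \<circ> f)"
  by (simp only: smooth_on_def) (blast intro: Ck_on_compose[of T W])

lemma smooth_on_pd: "smooth_on T f \<Longrightarrow> smooth_on T (pd v f)"
  unfolding smooth_on_def by (intro allI Ck_on_SucD(2)) (rule spec)

lemma smooth_on_differentiable: "smooth_on T f \<Longrightarrow> x \<in> T \<Longrightarrow> f differentiable at x"
  unfolding smooth_on_def by (rule Ck_on_SucD(1)) (rule spec)

lemma smooth_on_continuous: "smooth_on T f \<Longrightarrow> continuous_on T f"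
  unfolding smooth_on_def using Ck_on.simps(1) by blast

lemma smooth_on_euclidean:
  fixes f :: "'a::real_normed_vector \<Rightarrow> 'b::euclidean_space"
  assumes "open T" "\<And>b. b \<in> Basis \<Longrightarrow> smooth_on T (\<lambda>x. f x \<bullet> b)"
  shows "smooth_on T f"
proof -
  have "smooth_on T (\<lambda>x. \<Sum>b\<in>Basis. (f x \<bullet> b) *\<^sub>R b)"
    by (intro smooth_on_sum smooth_on_scaleR smooth_on_const assms)
  then show ?thesis by (simp add: euclidean_representation)
qed

lemma smooth_on_vec:
  fixes f :: "'a::real_normed_vector \<Rightarrow> real ^ 'n"
  assumes "open T" "\<And>i. smooth_on T (\<lambda>x. f x $ i)"
  shows "smooth_on T f"
  by (rule smooth_on_euclidean[OF assms(1)]) (auto simp: Basis_vec_def inner_axis assms(2))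

lemma smooth_on_det:
  fixes M :: "'a::real_normed_vector \<Rightarrow> real ^ 'n ^ 'n"
  assumes "open T" "\<And>i j. smooth_on T (\<lambda>x. M x $ i $ j)"
  shows "smooth_on T (\<lambda>x. det (M x))"
  unfolding det_def
  by (intro smooth_on_sum smooth_on_mult smooth_on_prod smooth_on_const assms)

text \<open>Both mixed partial derivatives are limits of the same second difference quotient.\<close>

lemma mixed_difference:
  fixes f :: "'a::real_normed_vector \<Rightarrow> real"
  assumes T: "ball p r \<subseteq> T" and df: "\<And>x. x \<in> T \<Longrightarrow> f differentiable at x"
    and du: "\<And>x. x \<in> T \<Longrightarrow> pd u f differentiable at x"
    and h: "h > 0" "h * norm u + h * norm v < r"
  shows "\<exists>q\<in>ball p r. f (p + h *\<^sub>R u + h *\<^sub>R v) - f (p + h *\<^sub>R u) - f (p + h *\<^sub>R v) + f p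
           = h * h * pd v (pd u f) q"
proof -
  have mem: "p + s *\<^sub>R u + t *\<^sub>R v \<in> ball p r" if "0 \<le> s" "s \<le> h" "0 \<le> t" "t \<le> h" for s t
  proof -
    have "norm (t *\<^sub>R v + s *\<^sub>R u) \<le> s * norm u + t * norm v"
      using norm_triangle_ineq[of "t *\<^sub>R v" "s *\<^sub>R u"] that by simp
    also have "\<dots> \<le> h * norm u + h * norm v"
      using that by (intro add_mono mult_right_mono) auto
    finally show ?thesis using h(2)
      by (simp add: dist_norm norm_minus_commute add.assoc)
  qed
  have fd: "((\<lambda>s. f (p + s *\<^sub>R u + t *\<^sub>R v)) has_derivative
      (\<lambda>k. k * pd u f (p + s *\<^sub>R u + t *\<^sub>R v))) (at s)"
    if "0 \<le> s" "s \<le> h" "0 \<le> t" "t \<le> h" for s t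
  proof -
    have "f differentiable at (p + s *\<^sub>R u + t *\<^sub>R v)" using mem[OF that] T df by blast
    then have 1: "(f has_derivative frechet_derivative f (at (p + s *\<^sub>R u + t *\<^sub>R v)))
        (at (p + s *\<^sub>R u + t *\<^sub>R v))" and l: "linear (frechet_derivative f (at (p + s *\<^sub>R u + t *\<^sub>R v)))"
      by (auto simp: frechet_derivative_works[symmetric] linear_frechet_derivative)
    have 2: "((\<lambda>s. p + s *\<^sub>R u + t *\<^sub>R v) has_derivative (\<lambda>k. k *\<^sub>R u)) (at s)"
      by (auto intro!: derivative_eq_intros)
    show ?thesis using has_derivative_compose[OF 2 1] by (simp add: linear_cmul[OF l])
  qed
  have gd: "((\<lambda>t. pd u f (p + s *\<^sub>R u + t *\<^sub>R v)) has_derivative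
      (\<lambda>k. k * pd v (pd u f) (p + s *\<^sub>R u + t *\<^sub>R v))) (at t)"
    if "0 \<le> s" "s \<le> h" "0 \<le> t" "t \<le> h" for s t
  proof -
    have "pd u f differentiable at (p + s *\<^sub>R u + t *\<^sub>R v)" using mem[OF that] T du by blast
    then have 1: "(pd u f has_derivative frechet_derivative (pd u f) (at (p + s *\<^sub>R u + t *\<^sub>R v)))
        (at (p + s *\<^sub>R u + t *\<^sub>R v))" and l: "linear (frechet_derivative (pd u f) (at (p + s *\<^sub>R u + t *\<^sub>R v)))"
      by (auto simp: frechet_derivative_works[symmetric] linear_frechet_derivative)
    have 2: "((\<lambda>t. p + s *\<^sub>R u + t *\<^sub>R v) has_derivative (\<lambda>k. k *\<^sub>R v)) (at t)"
      by (auto intro!: derivative_eq_intros)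
    show ?thesis using has_derivative_compose[OF 2 1] by (simp add: linear_cmul[OF l])
  qed
  \<comment> \<open>Mean value theorem in s for the difference of \<open>f\<close> across the edge
    in direction v; a second one, in t, then acts on \<open>pd u f\<close>. The terms with factor 0
    only put the endpoints into the required shape.\<close>
  have "\<exists>s\<in>{0<..<h}. (f (p + h *\<^sub>R u + h *\<^sub>R v) - f (p + h *\<^sub>R u + 0 *\<^sub>R v))
      - (f (p + 0 *\<^sub>R u + h *\<^sub>R v) - f (p + 0 *\<^sub>R u + 0 *\<^sub>R v))
      = (h - 0) * pd u f (p + s *\<^sub>R u + h *\<^sub>R v) - (h - 0) * pd u f (p + s *\<^sub>R u + 0 *\<^sub>R v)"
    by (rule mvt_simple[OF h(1)])
      (use h in \<open>auto intro!: has_derivative_diff has_derivative_at_withinI[OF fd]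
          has_derivative_at_withinI[OF fd[where t=0, simplified]]\<close>)
  then obtain s where s: "0 < s" "s < h"
    "(f (p + h *\<^sub>R u + h *\<^sub>R v) - f (p + h *\<^sub>R u)) - (f (p + h *\<^sub>R v) - f p)
      = h * (pd u f (p + s *\<^sub>R u + h *\<^sub>R v) - pd u f (p + s *\<^sub>R u))"
    by (auto simp: algebra_simps)
  have "\<exists>t\<in>{0<..<h}. pd u f (p + s *\<^sub>R u + h *\<^sub>R v) - pd u f (p + s *\<^sub>R u + 0 *\<^sub>R v)
      = (h - 0) * pd v (pd u f) (p + s *\<^sub>R u + t *\<^sub>R v)"
    by (rule mvt_simple[OF h(1)])
      (use h s in \<open>auto intro!: has_derivative_at_withinI[OF gd]\<close>)
  then obtain t where t: "0 < t" "t < h"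
    "pd u f (p + s *\<^sub>R u + h *\<^sub>R v) - pd u f (p + s *\<^sub>R u)
      = h * pd v (pd u f) (p + s *\<^sub>R u + t *\<^sub>R v)"
    by auto
  have "f (p + h *\<^sub>R u + h *\<^sub>R v) - f (p + h *\<^sub>R u) - f (p + h *\<^sub>R v) + f p
    = h * h * pd v (pd u f) (p + s *\<^sub>R u + t *\<^sub>R v)"
    using s(3) t(3) by simp
  then show ?thesis using mem[of s t] s t by auto
qed

lemma pd_commute:
  fixes f :: "'a::real_normed_vector \<Rightarrow> real"
  assumes "open T" "p \<in> T" "smooth_on T f"
  shows "pd v (pd u f) p = pd u (pd v f) p"
proof (rule ccontr)
  let ?a = "pd v (pd u f)" and ?b = "pd u (pd v f)"
  assume ne: "?a p \<noteq> ?b p"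
  \<comment> \<open>Half the gap: two equal values, each within \<open>e\<close> of one of the
    limits, would bring the limits closer together than they are.\<close>
  define e where "e = \<bar>?a p - ?b p\<bar> / 2"
  have e: "e > 0" using ne by (simp add: e_def)
  have c: "continuous (at p) (pd x (pd y f))" for x y
    using smooth_on_continuous[OF smooth_on_pd[OF smooth_on_pd[OF assms(3)]]] assms(1,2)
    by (simp add: continuous_on_eq_continuous_at)
  obtain r1 where r1: "r1 > 0" "\<And>q. dist q p < r1 \<Longrightarrow> dist (?a q) (?a p) < e"
    using c[where x=v and y=u, unfolded continuous_at_eps_delta, rule_format, OF e] by (elim exE conjE) meson
  obtain r2 where r2: "r2 > 0" "\<And>q. dist q p < r2 \<Longrightarrow> dist (?b q) (?b p) < e"
    using c[where x=u and y=v, unfolded continuous_at_eps_delta, rule_format, OF e] by (elim exE conjE) meson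
  obtain r3 where r3: "r3 > 0" "ball p r3 \<subseteq> T" using assms(1,2) openE by blast
  define r where "r = min r1 (min r2 r3)"
  \<comment> \<open>Small enough for the parallelogram spanned by h u and h v to lie in the ball;
    the summand 1 keeps the denominator positive when u and v vanish.\<close>
  define h where "h = r / (2 * (norm u + norm v + 1))"
  have pos: "norm u + norm v + 1 > 0" using norm_ge_zero[of u] norm_ge_zero[of v] by linarith
  have r: "r > 0" using r1 r2 r3 by (simp add: r_def)
  have h: "h > 0" using r pos by (simp add: h_def)
  have "h * (norm u + norm v) < 2 * h * (norm u + norm v + 1)" using h pos
    by (simp add: algebra_simps) (smt (verit) mult_nonneg_nonneg norm_ge_zero)
  also have "\<dots> = r" using pos by (simp add: h_def field_simps)
  finally have hr: "h * norm u + h * norm v < r" by (simp add: algebra_simps)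
  have sub: "ball p r \<subseteq> T" using r3 by (auto simp: r_def)
  note d = smooth_on_differentiable[OF assms(3)] smooth_on_differentiable[OF smooth_on_pd[OF assms(3)]]
  obtain q where q: "q \<in> ball p r"
    "f (p + h *\<^sub>R u + h *\<^sub>R v) - f (p + h *\<^sub>R u) - f (p + h *\<^sub>R v) + f p = h * h * ?a q"
    using mixed_difference[OF sub d h hr] by blast
  obtain q' where q': "q' \<in> ball p r"
    "f (p + h *\<^sub>R v + h *\<^sub>R u) - f (p + h *\<^sub>R v) - f (p + h *\<^sub>R u) + f p = h * h * ?b q'"
    using mixed_difference[OF sub d h, of v u] hr by auto
  have "h * h * ?a q = h * h * ?b q'" using q(2) q'(2) by (simp add: algebra_simps)
  then have "?a q = ?b q'" using h by simp
  moreover have "dist (?a q) (?a p) < e" using r1(2)[of q] q(1) by (auto simp: r_def dist_commute)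
  moreover have "dist (?b q') (?b p) < e" using r2(2)[of q'] q'(1) by (auto simp: r_def dist_commute)
  ultimately have "\<bar>?a p - ?b p\<bar> < 2 * e" by (simp add: dist_real_def)
  then show False by (simp add: e_def)
qed

lemma pd_inner:
  assumes "f differentiable at x"
  shows "pd v (\<lambda>x. f x \<bullet> b) x = pd v f x \<bullet> b"
  by (rule pd_eq[OF has_derivative_inner_left])
    (use assms in \<open>simp add: frechet_derivative_works[symmetric]\<close>)

text \<open>Componentwise reduction to real values. It is meant for transition maps, whose symmetric
  second derivative cancels when d of a 1-form changes chart.\<close>

lemma pd_commute_euclidean:
  fixes f :: "'a::real_normed_vector \<Rightarrow> 'b::euclidean_space"
  assumes "open T" "p \<in> T" "smooth_on T f"
  shows "pd v (pd u f) p = pd u (pd v f) p"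
proof (rule euclidean_eqI)
  fix b :: 'b assume "b \<in> Basis"
  have eq: "pd x (pd y (\<lambda>x. f x \<bullet> b)) p = pd x (pd y f) p \<bullet> b" for x y
  proof -
    have "pd x (pd y (\<lambda>x. f x \<bullet> b)) p = pd x (\<lambda>x. pd y f x \<bullet> b) p"
      by (subst pd_cong[OF assms(1,2), where g = "\<lambda>x. pd y f x \<bullet> b"])
        (auto intro: pd_inner smooth_on_differentiable[OF assms(3)])
    also have "\<dots> = pd x (pd y f) p \<bullet> b"
      by (rule pd_inner[OF smooth_on_differentiable[OF smooth_on_pd[OF assms(3)] assms(2)]])
    finally show ?thesis .
  qed
  have "smooth_on T (\<lambda>x. f x \<bullet> b)"
    by (rule smooth_on_bounded_linear_comp[OF bounded_linear_inner_left assms(1,3)])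
  from pd_commute[OF assms(1,2) this, of v u] show "pd v (pd u f) p \<bullet> b = pd u (pd v f) p \<bullet> b"
    by (simp add: eq)
qed

lemma pd_linear: "f differentiable at x \<Longrightarrow> linear (\<lambda>v. pd v f x)"
  by (rule linear_frechet_derivative)

lemma pd_add:
  assumes "f differentiable at x" "g differentiable at x"
  shows "pd v (\<lambda>x. f x + g x) x = pd v f x + pd v g x"
  by (rule pd_eq) (use assms in \<open>auto intro!: has_derivative_add simp: frechet_derivative_works[symmetric]\<close>)

lemma pd_diff:
  assumes "f differentiable at x" "g differentiable at x"
  shows "pd v (\<lambda>x. f x - g x) x = pd v f x - pd v g x"
  by (rule pd_eq) (use assms in \<open>auto intro!: has_derivative_diff simp: frechet_derivative_works[symmetric]\<close>)

lemma pd_sum: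
  assumes "\<And>i. i \<in> I \<Longrightarrow> f i differentiable at x"
  shows "pd v (\<lambda>x. \<Sum>i\<in>I. f i x) x = (\<Sum>i\<in>I. pd v (f i) x)"
  by (rule pd_eq) (use assms in \<open>auto intro!: has_derivative_sum simp: frechet_derivative_works[symmetric]\<close>)

lemma pd_mult:
  fixes f g :: "'a::real_normed_vector \<Rightarrow> real"
  assumes "f differentiable at x" "g differentiable at x"
  shows "pd v (\<lambda>x. f x * g x) x = f x * pd v g x + pd v f x * g x"
  by (rule pd_eq) (use assms in \<open>auto intro!: has_derivative_mult simp: frechet_derivative_works[symmetric]\<close>)

text \<open>Along a fibre the derivative vanishes, and convexity of \<open>Y\<close> makes the fibre
  connected. Each local normal form of a sheaf section rests on this.\<close>

lemma constant_on_fibres: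
  fixes G :: "('a::real_normed_vector \<times> 'b::real_normed_vector) \<Rightarrow> 'c::real_normed_vector"
  assumes "convex Y" "x \<in> X" "y \<in> Y" "y' \<in> Y"
    and d: "\<And>z. z \<in> X \<times> Y \<Longrightarrow> G differentiable at z"
    and 0: "\<And>z w. z \<in> X \<times> Y \<Longrightarrow> pd (0, w) G z = 0"
  shows "G (x, y) = G (x, y')"
proof (rule has_derivative_zero_unique[OF assms(1) _ assms(3,4), where f = "\<lambda>y. G (x, y)"])
  fix z assume z: "z \<in> Y"
  have 1: "((\<lambda>y. (x, y)) has_derivative (\<lambda>h. (0, h))) (at z within Y)"
    by (auto intro!: derivative_eq_intros)
  have 2: "(G has_derivative frechet_derivative G (at (x, z))) (at (x, z))"
    using d[of "(x, z)"] z assms(2) by (simp add: frechet_derivative_works[symmetric])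
  show "((\<lambda>y. G (x, y)) has_derivative (\<lambda>h. 0)) (at z within Y)"
    using has_derivative_compose[OF 1 2] 0[of "(x, z)"] z assms(2) by simp
qed

section \<open>Adapted atlases\<close>

context
  fixes c :: "('m::topological_space, 'n::finite) chart"
  assumes c: "is_chart c"
begin

lemma cinv_coord [simp]: "p \<in> cdom c \<Longrightarrow> cinv c (coord c p) = p"
  using c homeomorphism_apply1 unfolding is_chart_def by metis

lemma chart_inj_on: "inj_on (coord c) (cdom c)"
  by (metis inj_on_def cinv_coord)

lemma open_cdom: "open (cdom c)"
  using c by (simp add: is_chart_def)

lemma open_coord_image:
  assumes "open V" "V \<subseteq> cdom c" shows "open (coord c ` V)"
proof -
  have "openin (top_of_set (coord c ` cdom c)) (coord c ` V)"
    by (rule homeomorphism_imp_open_map[where S = "cdom c" and g = "cinv c"])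
      (use c assms in \<open>auto simp: is_chart_def openin_open_eq\<close>)
  then show ?thesis using c openin_open_trans unfolding is_chart_def by blast
qed

lemma open_coord_preimage:
  assumes "open W" shows "open (cdom c \<inter> coord c -` W)"
  using c assms unfolding is_chart_def homeomorphism_def
  by (meson continuous_on_open_vimage continuous_open_preimage)

text \<open>\<open>cinv\<close> is formed with \<open>inv_into\<close> on the chart domain, so the
  inverse of a restricted chart is another total function; the second claim says that it can differ
  only off the image of \<open>V\<close>.\<close>

lemma is_chart_restrict:
  assumes "open V" "V \<subseteq> cdom c"
  shows "is_chart (Chart V (coord c))"
    and "z \<in> coord c ` V \<Longrightarrow> cinv (Chart V (coord c)) z = cinv c z"
proof -
  have i: "inj_on (coord c) V" using chart_inj_on assms(2) inj_on_subset by blast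
  have *: "cinv (Chart V (coord c)) (coord c p) = p" if "p \<in> V" for p
    using i that by (simp add: cinv_def)
  then show eq: "z \<in> coord c ` V \<Longrightarrow> cinv (Chart V (coord c)) z = cinv c z" for z
    using assms(2) by auto
  have h: "homeomorphism (cdom c) (coord c ` cdom c) (coord c) (cinv c)"
    using c by (simp add: is_chart_def)
  have "homeomorphism V (coord c ` V) (coord c) (cinv c)"
    by (rule homeomorphism_of_subsets[OF h]) (use assms(2) in auto)
  then have "homeomorphism V (coord c ` V) (coord c) (cinv (Chart V (coord c)))"
    by (rule homeomorphism_cong) (auto simp: eq)
  then show "is_chart (Chart V (coord c))"
    using assms open_coord_image[OF assms] by (simp add: is_chart_def)
qed

end

text \<open>Collects what the sequel uses of the manifold and of \<open>S\<close>. Closure under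
  restriction is there because the sheaves ask for charts with domain inside a given open set. The
  last condition says that Jacobians commute with the standard endomorphism
  \<open>e \<mapsto> (0, fst e)\<close>, which is \<open>S\<close> in adapted charts.\<close>

locale adapted_atlas =
  fixes C :: "('m::topological_space, 'n::finite) chart set"
  assumes chart: "c \<in> C \<Longrightarrow> is_chart c"
    and covering: "\<exists>c. c \<in> charts_at C p"
    and transition: "c \<in> C \<Longrightarrow> c' \<in> C \<Longrightarrow> smooth_transition c c'"
    and restriction: "c \<in> C \<Longrightarrow> open V \<Longrightarrow> V \<subseteq> cdom c \<Longrightarrow> Chart V (coord c) \<in> C"
    and adapted: "c \<in> charts_at C p \<Longrightarrow> c' \<in> charts_at C p \<Longrightarrow>
      jac c c' p (0, fst e) = (0, fst (jac c c' p e))"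

lemma smooth_transition_restrict:
  assumes "is_chart c" "open V" "V \<subseteq> cdom c" "is_chart c'"
  shows "smooth_transition c c' \<Longrightarrow> smooth_transition (Chart V (coord c)) c'"
    and "smooth_transition c' c \<Longrightarrow> smooth_transition c' (Chart V (coord c))"
proof -
  assume s: "smooth_transition c c'"
  have o: "open (coord c ` (V \<inter> cdom c'))"
    by (rule open_coord_image[OF assms(1)]) (use assms open_cdom[OF assms(4)] in auto)
  have "smooth_on (coord c ` (V \<inter> cdom c')) (coord c' \<circ> cinv c)"
    by (rule smooth_on_mono[OF s[unfolded smooth_transition_def]]) (use assms(3) in auto)
  then have "smooth_on (coord c ` (V \<inter> cdom c')) (coord c' \<circ> cinv (Chart V (coord c)))"
    by (rule smooth_on_cong[OF o, rotated]) (auto simp: is_chart_restrict(2)[OF assms(1-3)])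
  then show "smooth_transition (Chart V (coord c)) c'"
    unfolding smooth_transition_def by simp
next
  assume "smooth_transition c' c"
  then show "smooth_transition c' (Chart V (coord c))"
    using assms(3) unfolding smooth_transition_def
    by (auto intro!: smooth_on_mono[where T = "coord c' ` (cdom c' \<inter> cdom c)"])
qed

lemma jac_restrict:
  assumes "is_chart c" "open V" "V \<subseteq> cdom c" "p \<in> V"
  shows "jac (Chart V (coord c)) c' p = jac c c' p"
    and "jac c' (Chart V (coord c)) p = jac c' c p"
  unfolding jac_def
   by (simp_all, rule pd_cong[where T = "coord c ` V"])
     (use assms open_coord_image[OF assms(1-3)] is_chart_restrict(2)[OF assms(1-3)] in auto)

lemma jac_self:
  assumes "is_chart c" "p \<in> cdom c" shows "jac c c p e = e"
proof -
  have "jac c c p = frechet_derivative (\<lambda>z. z) (at (coord c p))"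
    unfolding jac_def
    by (rule pd_cong[where T = "coord c ` cdom c"]) (use assms in \<open>auto simp: is_chart_def\<close>)
  then show ?thesis by simp
qed

text \<open>Restrictions remain adapted since the atlas is maximal and the Jacobian between a chart
  and its restriction is the identity. The covering hypothesis will be met by the domains of the
  Lagrangians, which are domains of adapted charts.\<close>

lemma adapted_atlas_adapted_charts:
  assumes tm: "tangent_manifold A S" and cov: "\<And>p. \<exists>c\<in>adapted_charts A S. p \<in> cdom c"
  shows "adapted_atlas (adapted_charts A S)"
proof
  have ss: "smooth_structure A" and ef: "endo_field A S"
    using tm by (auto simp: tangent_manifold_def)
  have A: "is_chart c" "smooth_transition c c'" if "c \<in> A" "c' \<in> A" for c c'
    using ss that by (auto simp: smooth_structure_def)
  have max: "c \<in> A" if "is_chart c" "\<And>c'. c' \<in> A \<Longrightarrow> smooth_transition c c' \<and> smooth_transition c' c" for c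
    using ss that unfolding smooth_structure_def by blast
  have nat: "jac c c' p (S p c e) = S p c' (jac c c' p e)"
    if "c \<in> A" "c' \<in> A" "p \<in> cdom c" "p \<in> cdom c'" for c c' p e
    using ef that unfolding endo_field_def charts_at_def by blast
  show "is_chart c" if "c \<in> adapted_charts A S" for c
    using that A by (auto simp: adapted_charts_def)
  show "\<exists>c. c \<in> charts_at (adapted_charts A S) p" for p
    using cov[of p] by (auto simp: charts_at_def)
  show "smooth_transition c c'" if "c \<in> adapted_charts A S" "c' \<in> adapted_charts A S" for c c'
    using that A by (auto simp: adapted_charts_def)
  show "Chart V (coord c) \<in> adapted_charts A S"
    if c: "c \<in> adapted_charts A S" and V: "open V" "V \<subseteq> cdom c" for c V
  proof -
    have cA: "c \<in> A" and Sc: "\<And>p e. p \<in> cdom c \<Longrightarrow> S p c e = (0, fst e)"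
      using c by (auto simp: adapted_charts_def)
    have cc: "is_chart c" using A cA by blast
    have in_A: "Chart V (coord c) \<in> A"
      by (rule max) (use is_chart_restrict(1)[OF cc V] smooth_transition_restrict[OF cc V] A cA in auto)
    have "S p (Chart V (coord c)) e = (0, fst e)" if p: "p \<in> V" for p e
      using nat[OF cA in_A, of p e] p V Sc[of p e] jac_restrict(2)[OF cc V p, of c] jac_self[OF cc, of p]
      by auto
    then show ?thesis using in_A by (auto simp: adapted_charts_def)
  qed
  show "jac c c' p (0, fst e) = (0, fst (jac c c' p e))"
    if "c \<in> charts_at (adapted_charts A S) p" "c' \<in> charts_at (adapted_charts A S) p" for c c' p e
  proof -
    have "S p c e = (0, fst e)" "S p c' (jac c c' p e) = (0, fst (jac c c' p e))"
      using that unfolding charts_at_def adapted_charts_def by blast+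
    then show ?thesis using nat[of c c' p e] that unfolding charts_at_def adapted_charts_def by auto
  qed
qed

context adapted_atlas
begin

section \<open>Smooth functions and their differentials under change of chart\<close>

lemma charts_at_iff: "c \<in> charts_at C p \<longleftrightarrow> c \<in> C \<and> p \<in> cdom c"
  by (simp add: charts_at_def)

lemma open_image: "c \<in> C \<Longrightarrow> open V \<Longrightarrow> V \<subseteq> cdom c \<Longrightarrow> open (coord c ` V)"
  using open_coord_image chart by blast

lemma open_image_Int: "c \<in> C \<Longrightarrow> open V \<Longrightarrow> open (coord c ` (cdom c \<inter> V))"
  using open_image open_cdom[OF chart] by (simp add: open_Int)

lemma transition_facts:
  assumes "c \<in> C" "c' \<in> C" "open V" "V \<subseteq> cdom c" "V \<subseteq> cdom c'"
  shows "smooth_on (coord c ` V) (coord c' \<circ> cinv c)"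
    and "(coord c' \<circ> cinv c) ` coord c ` V = coord c' ` V"
    and "z \<in> coord c ` V \<Longrightarrow> cinv c' ((coord c' \<circ> cinv c) z) = cinv c z"
proof -
  show "smooth_on (coord c ` V) (coord c' \<circ> cinv c)"
    by (rule smooth_on_mono[where T = "coord c ` (cdom c \<inter> cdom c')"])
      (use transition[OF assms(1,2)] assms in \<open>auto simp: smooth_transition_def\<close>)
  show "(coord c' \<circ> cinv c) ` coord c ` V = coord c' ` V"
    using assms(4) by (force simp: image_image cinv_coord[OF chart[OF assms(1)]] intro!: image_cong)
  show "z \<in> coord c ` V \<Longrightarrow> cinv c' ((coord c' \<circ> cinv c) z) = cinv c z"
    using assms(4,5) by (auto simp: cinv_coord[OF chart[OF assms(1)]] cinv_coord[OF chart[OF assms(2)]] subset_iff)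
qed

lemma smooth_change_chart:
  assumes "c \<in> C" "c' \<in> C" "open V" "V \<subseteq> cdom c" "V \<subseteq> cdom c'"
    and "smooth_on (coord c' ` V) (f \<circ> cinv c')"
  shows "smooth_on (coord c ` V) (f \<circ> cinv c)"
proof -
  note t = transition_facts[OF assms(1-5)]
  have "smooth_on (coord c ` V) ((f \<circ> cinv c') \<circ> (coord c' \<circ> cinv c))"
    by (rule smooth_on_compose[OF _ _ _ t(1) assms(6)]) (use t(2) open_image assms in auto)
  then show ?thesis
    by (rule smooth_on_cong[rotated 2]) (use t(3) open_image assms in auto)
qed

lemma jac_transition:
  assumes "c \<in> charts_at C p" "c' \<in> charts_at C p"
  shows "(coord c' \<circ> cinv c) differentiable at (coord c p)" and "linear (jac c c' p)"
proof -
  let ?V = "cdom c \<inter> cdom c'"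
  have "smooth_on (coord c ` ?V) (coord c' \<circ> cinv c)"
    by (rule transition_facts) (use assms open_cdom[OF chart] in \<open>auto simp: charts_at_iff\<close>)
  then show d: "(coord c' \<circ> cinv c) differentiable at (coord c p)"
    by (rule smooth_on_differentiable) (use assms in \<open>auto simp: charts_at_iff\<close>)
  show "linear (jac c c' p)" unfolding jac_def by (rule linear_frechet_derivative[OF d])
qed

lemma dfun_change_chart:
  assumes c: "c \<in> charts_at C p" and c': "c' \<in> charts_at C p"
    and d: "(f \<circ> cinv c') differentiable at (coord c' p)"
  shows "dfun f p c e = dfun f p c' (jac c c' p e)"
proof -
  let ?V = "cdom c \<inter> cdom c'"
  have V: "c \<in> C" "c' \<in> C" "open ?V" "?V \<subseteq> cdom c" "?V \<subseteq> cdom c'" "p \<in> ?V"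
    using c c' open_cdom[OF chart] by (auto simp: charts_at_iff)
  have eq: "(coord c' \<circ> cinv c) (coord c p) = coord c' p"
    using V by (simp add: cinv_coord[OF chart])
  have "dfun f p c e = pd e ((f \<circ> cinv c') \<circ> (coord c' \<circ> cinv c)) (coord c p)"
    unfolding dfun_def
    by (subst pd_cong[where T = "coord c ` ?V" and g = "(f \<circ> cinv c') \<circ> (coord c' \<circ> cinv c)"])
      (use V open_image transition_facts(3)[OF V(1-5)] in auto)
  also have "\<dots> = dfun f p c' (jac c c' p e)"
    using pd_chain(1)[OF jac_transition(1)[OF c c'], of "f \<circ> cinv c'" e] d
    unfolding eq dfun_def jac_def by simp
  finally show ?thesis .
qed

lemma smooth_fun_at:
  assumes "smooth_fun C V f" "c \<in> charts_at C p" "p \<in> V"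
  shows "smooth_on (coord c ` (cdom c \<inter> V)) (f \<circ> cinv c)"
    and "coord c p \<in> coord c ` (cdom c \<inter> V)"
    and "(f \<circ> cinv c) differentiable at (coord c p)"
proof -
  show 1: "smooth_on (coord c ` (cdom c \<inter> V)) (f \<circ> cinv c)"
    using assms by (simp add: smooth_fun_def charts_at_iff)
  show 2: "coord c p \<in> coord c ` (cdom c \<inter> V)" using assms by (simp add: charts_at_iff)
  show "(f \<circ> cinv c) differentiable at (coord c p)" by (rule smooth_on_differentiable[OF 1 2])
qed

text \<open>One chart around each point is enough because transition maps are smooth.\<close>

lemma smooth_funI:
  assumes V: "open V" and *: "\<And>p. p \<in> V \<Longrightarrow> \<exists>c\<in>charts_at C p. \<exists>W. open W \<and> p \<in> W \<and> W \<subseteq> cdom c \<and>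
     smooth_on (coord c ` W) (f \<circ> cinv c)"
  shows "smooth_fun C V f"
  unfolding smooth_fun_def
proof
  fix c assume c: "c \<in> C"
  show "smooth_on (coord c ` (cdom c \<inter> V)) (f \<circ> cinv c)"
  proof (rule smooth_on_local)
    show "open (coord c ` (cdom c \<inter> V))" by (rule open_image_Int[OF c V])
    fix z assume "z \<in> coord c ` (cdom c \<inter> V)"
    then obtain p where p: "p \<in> cdom c" "p \<in> V" "z = coord c p" by auto
    obtain c' W where W: "c' \<in> charts_at C p" "open W" "p \<in> W" "W \<subseteq> cdom c'"
      "smooth_on (coord c' ` W) (f \<circ> cinv c')" using *[OF p(2)] by meson
    let ?W = "W \<inter> cdom c"
    have o: "open ?W" using W open_cdom[OF chart[OF c]] by auto
    have "smooth_on (coord c ` ?W) (f \<circ> cinv c)"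
      by (rule smooth_change_chart[where c' = c'])
        (use W o c in \<open>auto simp: charts_at_iff intro: smooth_on_mono\<close>)
    then show "\<exists>W. open W \<and> z \<in> W \<and> smooth_on W (f \<circ> cinv c)"
      using p W(3) open_image[OF c o] by (intro exI[of _ "coord c ` ?W"]) auto
  qed
qed

lemma smooth_fun_mono:
  "smooth_fun C V f \<Longrightarrow> W \<subseteq> V \<Longrightarrow> smooth_fun C W f"
  unfolding smooth_fun_def by (meson Int_mono image_mono order_refl smooth_on_mono)

lemma smooth_fun_add:
  assumes "open V" "smooth_fun C V f" "smooth_fun C V h" shows "smooth_fun C V (\<lambda>p. f p + h p)"
  unfolding smooth_fun_def o_def
  by (intro ballI smooth_on_add[OF open_image_Int[OF _ assms(1)]])
    (use assms(2,3) in \<open>auto simp: smooth_fun_def o_def\<close>)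

lemma smooth_fun_diff:
  assumes "open V" "smooth_fun C V f" "smooth_fun C V h" shows "smooth_fun C V (\<lambda>p. f p - h p)"
  unfolding smooth_fun_def o_def
  by (intro ballI smooth_on_diff[OF open_image_Int[OF _ assms(1)]])
    (use assms(2,3) in \<open>auto simp: smooth_fun_def o_def\<close>)

lemma smooth_fun_const: "smooth_fun C V (\<lambda>p. k)"
  by (simp add: smooth_fun_def o_def smooth_on_const)

lemma dfun_add:
  assumes "smooth_fun C V f" "smooth_fun C V h" "c \<in> charts_at C p" "p \<in> V"
  shows "dfun (\<lambda>p. f p + h p) p c e = dfun f p c e + dfun h p c e"
  using pd_add[OF smooth_fun_at(3)[OF assms(1,3,4)] smooth_fun_at(3)[OF assms(2,3,4)]]
  by (simp add: dfun_def o_def)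

lemma dfun_diff:
  assumes "smooth_fun C V f" "smooth_fun C V h" "c \<in> charts_at C p" "p \<in> V"
  shows "dfun (\<lambda>p. f p - h p) p c e = dfun f p c e - dfun h p c e"
  using pd_diff[OF smooth_fun_at(3)[OF assms(1,3,4)] smooth_fun_at(3)[OF assms(2,3,4)]]
  by (simp add: dfun_def o_def)

lemma dfun_cong:
  assumes "c \<in> charts_at C p" "open V" "p \<in> V" "\<And>q. q \<in> V \<Longrightarrow> f q = h q"
  shows "dfun f p c = dfun h p c"
proof -
  have "frechet_derivative (f \<circ> cinv c) (at (coord c p)) = frechet_derivative (h \<circ> cinv c) (at (coord c p))"
    by (rule pd_cong[where T = "coord c ` (cdom c \<inter> V)"])
      (use assms open_image_Int in \<open>auto simp: charts_at_iff cinv_coord[OF chart]\<close>)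
  then show ?thesis by (simp add: dfun_def fun_eq_iff)
qed

section \<open>1-forms and the exterior derivative in charts\<close>

lemma one_form_onD:
  assumes "one_form_on C V \<alpha>"
  shows "p \<in> V \<Longrightarrow> c \<in> charts_at C p \<Longrightarrow> linear (\<alpha> p c)"
    and "p \<in> V \<Longrightarrow> c \<in> charts_at C p \<Longrightarrow> c' \<in> charts_at C p \<Longrightarrow> \<alpha> p c' (jac c c' p e) = \<alpha> p c e"
    and "p \<in> V \<Longrightarrow> c \<notin> charts_at C p \<Longrightarrow> \<alpha> p c = (\<lambda>e. 0)"
    and "c \<in> C \<Longrightarrow> smooth_on (coord c ` (cdom c \<inter> V)) (\<lambda>z. \<alpha> (cinv c z) c e)"
  using assms unfolding one_form_on_def by metis+

lemma one_form_on_differentiable: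
  assumes "one_form_on C V \<alpha>" "p \<in> V" "c \<in> charts_at C p"
  shows "((\<lambda>q. \<alpha> q c v) \<circ> cinv c) differentiable at (coord c p)"
  unfolding o_def
  by (rule smooth_on_differentiable[OF one_form_onD(4)[OF assms(1)]])
    (use assms in \<open>auto simp: charts_at_iff\<close>)

lemma one_form_on_mono:
  assumes "one_form_on C V \<alpha>" "W \<subseteq> V" shows "one_form_on C W \<alpha>"
  using assms smooth_on_mono[OF _ image_mono[OF Int_mono[OF order_refl assms(2)]]]
  unfolding one_form_on_def by blast

lemma one_form_on_local:
  assumes "open V" and *: "\<And>p. p \<in> V \<Longrightarrow> \<exists>W. open W \<and> p \<in> W \<and> one_form_on C W \<alpha>"
  shows "one_form_on C V \<alpha>"
proof -
  have "\<exists>W. p \<in> W \<and> one_form_on C W \<alpha>" if "p \<in> V" for p using *[OF that] by blast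
  moreover have "smooth_on (coord c ` (cdom c \<inter> V)) (\<lambda>q. \<alpha> (cinv c q) c e)" if c: "c \<in> C" for c e
  proof (rule smooth_on_local)
    show "open (coord c ` (cdom c \<inter> V))" by (rule open_image_Int[OF c assms(1)])
    fix z assume "z \<in> coord c ` (cdom c \<inter> V)"
    then obtain p where p: "p \<in> cdom c" "p \<in> V" "z = coord c p" by auto
    obtain W where W: "open W" "p \<in> W" "one_form_on C W \<alpha>" using *[OF p(2)] by blast
    show "\<exists>W. open W \<and> z \<in> W \<and> smooth_on W (\<lambda>q. \<alpha> (cinv c q) c e)"
      using one_form_onD(4)[OF W(3) c] open_image_Int[OF c W(1)] W(2) p
      by (intro exI[of _ "coord c ` (cdom c \<inter> W)"]) auto
  qed
  ultimately show ?thesis unfolding one_form_on_def by meson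
qed

lemma one_form_on_cong:
  assumes "open V" "one_form_on C V \<alpha>" "\<And>p. p \<in> V \<Longrightarrow> \<beta> p = \<alpha> p"
  shows "one_form_on C V \<beta>"
proof -
  have "smooth_on (coord c ` (cdom c \<inter> V)) (\<lambda>z. \<beta> (cinv c z) c e)" if c: "c \<in> C" for c e
    by (rule smooth_on_cong[OF open_image_Int[OF c assms(1)] _ one_form_onD(4)[OF assms(2) c, of e]])
      (use assms(3) cinv_coord[OF chart[OF c]] in auto)
  then show ?thesis using assms(2,3) unfolding one_form_on_def by auto
qed

lemma one_form_on_zero: "one_form_on C V (\<lambda>p c e. 0)"
  unfolding one_form_on_def by (simp add: smooth_on_const linear_iff)

lemma one_form_on_add:
  assumes "open V" "one_form_on C V \<alpha>" "one_form_on C V \<beta>"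
  shows "one_form_on C V (\<lambda>p c e. \<alpha> p c e + \<beta> p c e)"
  unfolding one_form_on_def
  by (intro conjI ballI allI impI linear_compose_add smooth_on_add[OF open_image_Int[OF _ assms(1)]])
    (simp_all add: one_form_onD[OF assms(2)] one_form_onD[OF assms(3)])

lemma one_form_on_diff:
  assumes "open V" "one_form_on C V \<alpha>" "one_form_on C V \<beta>"
  shows "one_form_on C V (\<lambda>p c e. \<alpha> p c e - \<beta> p c e)"
  unfolding one_form_on_def
  by (intro conjI ballI allI impI linear_compose_sub smooth_on_diff[OF open_image_Int[OF _ assms(1)]])
    (simp_all add: one_form_onD[OF assms(2)] one_form_onD[OF assms(3)])

lemma d1_add:
  assumes "one_form_on C V \<alpha>" "one_form_on C V \<beta>" "c \<in> charts_at C p" "p \<in> V"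
  shows "d1 C (\<lambda>p c e. \<alpha> p c e + \<beta> p c e) p c u v = d1 C \<alpha> p c u v + d1 C \<beta> p c u v"
  using pd_add[OF one_form_on_differentiable[OF assms(1,4,3)] one_form_on_differentiable[OF assms(2,4,3)]]
  by (simp add: d1_def dfun_def o_def)

lemma d1_diff:
  assumes "one_form_on C V \<alpha>" "one_form_on C V \<beta>" "c \<in> charts_at C p" "p \<in> V"
  shows "d1 C (\<lambda>p c e. \<alpha> p c e - \<beta> p c e) p c u v = d1 C \<alpha> p c u v - d1 C \<beta> p c u v"
  using pd_diff[OF one_form_on_differentiable[OF assms(1,4,3)] one_form_on_differentiable[OF assms(2,4,3)]]
  by (simp add: d1_def dfun_def o_def)

lemma d1_cong:
  assumes "open V" "p \<in> V" "\<And>q. q \<in> V \<Longrightarrow> \<alpha> q = \<beta> q"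
  shows "d1 C \<alpha> p = d1 C \<beta> p"
proof -
  have "dfun (\<lambda>q. \<alpha> q c v) p c = dfun (\<lambda>q. \<beta> q c v) p c" if "c \<in> charts_at C p" for c v
    by (rule dfun_cong[OF that assms(1,2)]) (simp add: assms(3))
  then show ?thesis by (auto simp: d1_def fun_eq_iff)
qed

text \<open>The sum on the right is symmetric in \<open>u\<close> and \<open>v\<close>, hence cancels in the exterior derivative.\<close>

lemma dfun_one_form_change_chart:
  assumes \<alpha>: "one_form_on C V \<alpha>" and V: "open V" "p \<in> V"
    and c: "c \<in> charts_at C p" and c': "c' \<in> charts_at C p"
  defines "\<phi> \<equiv> coord c' \<circ> cinv c"
  shows "dfun (\<lambda>q. \<alpha> q c v) p c u = dfun (\<lambda>q. \<alpha> q c' (jac c c' p v)) p c' (jac c c' p u)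
    + (\<Sum>k\<in>Basis. (pd u (pd v \<phi>) (coord c p) \<bullet> k) * \<alpha> p c' k)"
proof -
  let ?W = "V \<inter> (cdom c \<inter> cdom c')" and ?z = "coord c p"
  have C: "c \<in> C" "c' \<in> C" "p \<in> cdom c" "p \<in> cdom c'" using c c' by (auto simp: charts_at_iff)
  have W: "open ?W" "?W \<subseteq> cdom c" "?W \<subseteq> cdom c'" using V C open_cdom[OF chart] by auto
  note t = transition_facts[OF C(1,2) W, folded \<phi>_def]
  have o: "open (coord c ` ?W)" "?z \<in> coord c ` ?W" using open_image C W V by auto
  have \<phi>z: "\<phi> ?z = coord c' p" using C by (simp add: \<phi>_def cinv_coord[OF chart])
  define b where "b k = (\<lambda>q. \<alpha> q c' k) \<circ> cinv c'" for k
  have db: "b k differentiable at (coord c' p)" for k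
    unfolding b_def by (rule one_form_on_differentiable[OF \<alpha> V(2) c'])
  have d\<phi>: "\<phi> differentiable at ?z" "pd v \<phi> differentiable at ?z"
    using smooth_on_differentiable[OF t(1) o(2)] smooth_on_differentiable[OF smooth_on_pd[OF t(1)] o(2)] .
  have dv: "(\<lambda>x. pd v \<phi> x \<bullet> k) differentiable at ?z" for k
    using d\<phi>(2) by (auto simp: differentiable_def intro: has_derivative_inner_left)
  have exp: "\<alpha> q c' w = (\<Sum>k\<in>Basis. (w \<bullet> k) * \<alpha> q c' k)" if "q \<in> ?W" for q w
  proof -
    have l: "linear (\<alpha> q c')" by (rule one_form_onD(1)[OF \<alpha>]) (use that C in \<open>auto simp: charts_at_iff\<close>)
    have "\<alpha> q c' w = \<alpha> q c' (\<Sum>k\<in>Basis. (w \<bullet> k) *\<^sub>R k)" by (simp add: euclidean_representation)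
    then show ?thesis by (simp add: linear_sum[OF l] linear_cmul[OF l])
  qed
  \<comment> \<open>Transformation law of \<alpha> with the Jacobian written as
    \<open>pd v \<phi>\<close>. Its coefficients vary with the point, which is where second
    derivatives of the transition map enter.\<close>
  have a: "((\<lambda>q. \<alpha> q c v) \<circ> cinv c) x = (\<Sum>k\<in>Basis. (pd v \<phi> x \<bullet> k) * (b k \<circ> \<phi>) x)"
    if x: "x \<in> coord c ` ?W" for x
  proof -
    obtain q where q: "q \<in> ?W" "x = coord c q" using x by auto
    have cq: "c \<in> charts_at C q" "c' \<in> charts_at C q" "cinv c x = q"
      using q C by (auto simp: charts_at_iff cinv_coord[OF chart])
    have "\<alpha> q c v = \<alpha> q c' (jac c c' q v)"
      using one_form_onD(2)[OF \<alpha> _ cq(1,2)] q by auto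
    also have "\<dots> = (\<Sum>k\<in>Basis. (jac c c' q v \<bullet> k) * \<alpha> q c' k)" by (rule exp[OF q(1)])
    also have "\<dots> = (\<Sum>k\<in>Basis. (pd v \<phi> x \<bullet> k) * (b k \<circ> \<phi>) x)"
      using t(3)[OF x] cq q by (simp add: b_def jac_def \<phi>_def)
    finally show ?thesis using cq by simp
  qed
  have chain: "pd u (b k \<circ> \<phi>) ?z = pd (jac c c' p u) (b k) (coord c' p)" "(b k \<circ> \<phi>) differentiable at ?z" for k
    using pd_chain(1)[OF d\<phi>(1), of "b k" u] pd_chain(2)[OF d\<phi>(1), of "b k"] db[of k] \<phi>z by (simp_all add: jac_def \<phi>_def)
  have "dfun (\<lambda>q. \<alpha> q c v) p c u = pd u (\<lambda>x. \<Sum>k\<in>Basis. (pd v \<phi> x \<bullet> k) * (b k \<circ> \<phi>) x) ?z"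
    unfolding dfun_def by (rule fun_cong[OF pd_cong[OF o]]) (rule a)
  also have "\<dots> = (\<Sum>k\<in>Basis. pd u (\<lambda>x. (pd v \<phi> x \<bullet> k) * (b k \<circ> \<phi>) x) ?z)"
    by (rule pd_sum) (intro differentiable_mult dv chain(2))
  \<comment> \<open>Product rule: one summand differentiates the components of \<alpha>, the other
    the Jacobian.\<close>
  also have "\<dots> = (\<Sum>k\<in>Basis. (pd v \<phi> ?z \<bullet> k) * pd u (b k \<circ> \<phi>) ?z
      + pd u (\<lambda>x. pd v \<phi> x \<bullet> k) ?z * (b k \<circ> \<phi>) ?z)"
    by (intro sum.cong refl pd_mult dv chain(2))
  also have "\<dots> = (\<Sum>k\<in>Basis. (jac c c' p v \<bullet> k) * pd (jac c c' p u) (b k) (coord c' p))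
      + (\<Sum>k\<in>Basis. (pd u (pd v \<phi>) ?z \<bullet> k) * \<alpha> p c' k)"
    unfolding chain(1) pd_inner[OF d\<phi>(2)] sum.distrib
    using \<phi>z C by (simp add: b_def cinv_coord[OF chart] jac_def \<phi>_def)
  \<comment> \<open>The Jacobian at p is a constant here, so the sum moves inside the derivative and
    becomes the component of \<alpha> on one fixed vector.\<close>
  also have "(\<Sum>k\<in>Basis. (jac c c' p v \<bullet> k) * pd (jac c c' p u) (b k) (coord c' p))
      = pd (jac c c' p u) (\<lambda>x. \<Sum>k\<in>Basis. (jac c c' p v \<bullet> k) * b k x) (coord c' p)"
    by (subst pd_sum) (auto intro!: db differentiable_mult simp: pd_mult[OF differentiable_const db])
  also have "\<dots> = dfun (\<lambda>q. \<alpha> q c' (jac c c' p v)) p c' (jac c c' p u)"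
  proof -
    have "frechet_derivative (\<lambda>x. \<Sum>k\<in>Basis. (jac c c' p v \<bullet> k) * b k x) (at (coord c' p))
        = frechet_derivative ((\<lambda>q. \<alpha> q c' (jac c c' p v)) \<circ> cinv c') (at (coord c' p))"
    proof (rule pd_cong)
      show "open (coord c' ` ?W)" "coord c' p \<in> coord c' ` ?W" using open_image C W V by auto
      fix x assume "x \<in> coord c' ` ?W"
      then obtain q where q: "q \<in> ?W" "x = coord c' q" by auto
      then have "cinv c' x = q" using C by (auto simp: cinv_coord[OF chart])
      then show "(\<Sum>k\<in>Basis. (jac c c' p v \<bullet> k) * b k x) = ((\<lambda>q. \<alpha> q c' (jac c c' p v)) \<circ> cinv c') x"
        using exp[OF q(1), of "jac c c' p v"] by (simp add: b_def)
    qed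
    then show ?thesis by (simp add: dfun_def)
  qed
  finally show ?thesis .
qed

lemma d1_change_chart:
  assumes \<alpha>: "one_form_on C V \<alpha>" and V: "open V" "p \<in> V"
    and c: "c \<in> charts_at C p" and c': "c' \<in> charts_at C p"
  shows "d1 C \<alpha> p c u v = d1 C \<alpha> p c' (jac c c' p u) (jac c c' p v)"
proof -
  let ?W = "cdom c \<inter> cdom c'"
  have C: "c \<in> C" "c' \<in> C" "p \<in> cdom c" "p \<in> cdom c'" using c c' by (auto simp: charts_at_iff)
  have W: "open ?W" "?W \<subseteq> cdom c" "?W \<subseteq> cdom c'" using C open_cdom[OF chart] by auto
  have "pd u (pd v (coord c' \<circ> cinv c)) (coord c p) = pd v (pd u (coord c' \<circ> cinv c)) (coord c p)"
    by (rule pd_commute_euclidean[OF _ _ transition_facts(1)[OF C(1,2) W]])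
      (use open_image C W in auto)
  then show ?thesis
    using dfun_one_form_change_chart[OF assms] c c' by (simp add: d1_def)
qed

end

section \<open>The sheaves in invariant terms\<close>

lemma differentiable_vec_nth:
  assumes "f differentiable F" shows "(\<lambda>x. f x $ i) differentiable F"
  using assms bounded_linear.has_derivative[OF bounded_linear_vec_nth] unfolding differentiable_def by blast

text \<open>Turns the coordinate sums in \<open>theta\<close> and \<open>g_of\<close> into
  derivatives in one vertical direction, after which indices disappear.\<close>

lemma partial_y_sum:
  fixes F :: "'n::finite model \<Rightarrow> real"
  assumes "F differentiable at z"
  shows "(\<Sum>i\<in>UNIV. partial_y i F z * w $ i) = pd (0, w) F z"
proof -
  have l: "linear (frechet_derivative F (at z))" by (rule linear_frechet_derivative[OF assms])
  have "(0, w) = (\<Sum>i\<in>UNIV. w $ i *\<^sub>R ((0::real ^ 'n), axis i (1::real)))"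
    using basis_expansion[of w]
    by (simp add: prod_eq_iff fst_sum snd_sum scalar_mult_eq_scaleR)
  then have "pd (0, w) F z = pd (\<Sum>i\<in>UNIV. w $ i *\<^sub>R (0, axis i 1)) F z" by simp
  also have "\<dots> = (\<Sum>i\<in>UNIV. partial_y i F z * w $ i)"
    by (simp only: linear_sum[OF l] linear_cmul[OF l] partial_y_def real_scaleR_def mult.commute)
  finally show ?thesis by simp
qed

lemma smooth_on_slice:
  fixes G :: "('a::euclidean_space \<times> 'b::euclidean_space) \<Rightarrow> 'c::real_normed_vector"
  assumes "open X" "open Y" "y \<in> Y" "smooth_on (X \<times> Y) G"
  shows "smooth_on X (\<lambda>x. G (x, y))"
proof -
  have "bounded_linear (\<lambda>x::'a. (x, 0::'b))"
    by (rule bounded_linear_Pair[OF bounded_linear_ident bounded_linear_zero])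
  then have "smooth_on X (\<lambda>x::'a. (x, 0::'b) + (0, y))"
    by (intro smooth_on_add smooth_on_const smooth_on_bounded_linear assms(1))
  then have "smooth_on X (\<lambda>x. (x, y))" by simp
  from smooth_on_compose[OF assms(1) _ _ this assms(4)] assms(2,3) show ?thesis
    by (simp add: o_def open_Times assms(1) image_subset_iff)
qed

lemma pd_fst_compose:
  fixes H :: "'a::euclidean_space \<Rightarrow> 'c::real_normed_vector" and z :: "'a \<times> 'b::euclidean_space"
  assumes "H differentiable at (fst z)"
  shows "(\<lambda>z. H (fst z)) differentiable at z" and "pd (0, w) (\<lambda>z. H (fst z)) z = 0"
proof -
  have d: "(fst has_derivative fst) (at z)"
    by (rule bounded_linear_imp_has_derivative[OF bounded_linear_fst])
  then have d': "fst differentiable at z" by (auto simp: differentiable_def)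
  show "(\<lambda>z. H (fst z)) differentiable at z"
    using pd_chain(2)[OF d' assms] by (simp add: o_def)
  have "pd (0, w) (\<lambda>z. H (fst z)) z = pd (pd (0, w) fst z) H (fst z)"
    using pd_chain(1)[OF d' assms, of "(0, w)"] by (simp add: o_def)
  also have "pd (0, w) fst z = 0" using pd_eq[OF d, of "(0, w)"] by simp
  finally show "pd (0, w) (\<lambda>z. H (fst z)) z = 0"
    using linear_0[OF linear_frechet_derivative[OF assms]] by simp
qed

lemma pd_affine_fibre:
  fixes \<phi> :: "real ^ 'n \<Rightarrow> real ^ 'n" and z :: "'n::finite model"
  assumes "\<phi> differentiable at (fst z)"
  shows "(\<lambda>z. \<Sum>i\<in>UNIV. \<phi> (fst z) $ i * snd z $ i) differentiable at z"
    and "pd (0, w) (\<lambda>z. \<Sum>i\<in>UNIV. \<phi> (fst z) $ i * snd z $ i) z = (\<Sum>i\<in>UNIV. \<phi> (fst z) $ i * w $ i)"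
proof -
  have \<phi>i: "(\<lambda>x. \<phi> x $ i) differentiable at (fst z)" for i
    by (rule differentiable_vec_nth[OF assms])
  have bl: "bounded_linear (\<lambda>z::'n model. snd z $ i)" for i
    by (rule bounded_linear_compose[OF bounded_linear_vec_nth bounded_linear_snd])
  have y: "((\<lambda>z::'n model. snd z $ i) has_derivative (\<lambda>z. snd z $ i)) (at z)" for i
    by (rule bounded_linear_imp_has_derivative[OF bl])
  then have y': "(\<lambda>z::'n model. snd z $ i) differentiable at z" for i
    by (auto simp: differentiable_def)
  note d = differentiable_mult[OF pd_fst_compose(1)[OF \<phi>i] y']
  show "(\<lambda>z. \<Sum>i\<in>UNIV. \<phi> (fst z) $ i * snd z $ i) differentiable at z"
    by (intro differentiable_sum finite ballI d)
  have "pd (0, w) (\<lambda>z. \<Sum>i\<in>UNIV. \<phi> (fst z) $ i * snd z $ i) z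
      = (\<Sum>i\<in>UNIV. pd (0, w) (\<lambda>z. \<phi> (fst z) $ i * snd z $ i) z)"
    by (rule pd_sum) (rule d)
  also have "\<dots> = (\<Sum>i\<in>UNIV. \<phi> (fst z) $ i * w $ i)"
    unfolding pd_mult[OF pd_fst_compose(1)[OF \<phi>i] y'] pd_fst_compose(2)[OF \<phi>i] pd_eq[OF y] by simp
  finally show "pd (0, w) (\<lambda>z. \<Sum>i\<in>UNIV. \<phi> (fst z) $ i * snd z $ i) z
      = (\<Sum>i\<in>UNIV. \<phi> (fst z) $ i * w $ i)" .
qed

context adapted_atlas
begin

section \<open>The tensors of a Lagrangian in adapted coordinates\<close>

lemma theta_eq_dfun:
  assumes "c \<in> charts_at C p" "(f \<circ> cinv c) differentiable at (coord c p)"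
  shows "theta C f p c e = dfun f p c (0, fst e)"
  using assms partial_y_sum[OF assms(2)] by (simp add: theta_def dfun_def)

lemma theta_eq:
  assumes "smooth_fun C V f" "p \<in> V" "c \<in> charts_at C p"
  shows "theta C f p c e = dfun f p c (0, fst e)"
  by (rule theta_eq_dfun[OF assms(3) smooth_fun_at(3)[OF assms(1,3,2)]])

lemma theta_cong:
  assumes "open V" "p \<in> V" "\<And>q. q \<in> V \<Longrightarrow> f q = h q"
  shows "theta C f p = theta C h p"
proof -
  have "partial_y i (f \<circ> cinv c) (coord c p) = partial_y i (h \<circ> cinv c) (coord c p)"
    if "c \<in> charts_at C p" for c i
    using dfun_cong[OF that assms] by (simp add: partial_y_def dfun_def fun_eq_iff)
  then show ?thesis by (auto simp: theta_def fun_eq_iff)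
qed

lemma theta_add:
  assumes "smooth_fun C V f" "smooth_fun C V h" "open V" "p \<in> V"
  shows "theta C (\<lambda>p. f p + h p) p = theta C f p + theta C h p"
proof -
  have "theta C (\<lambda>p. f p + h p) p c e = theta C f p c e + theta C h p c e" for c e
  proof (cases "c \<in> charts_at C p")
    case True
    then show ?thesis
      using theta_eq[OF smooth_fun_add[OF assms(3,1,2)] assms(4) True]
      by (simp add: theta_eq[OF assms(1,4)] theta_eq[OF assms(2,4)] dfun_add[OF assms(1,2) _ assms(4)])
  qed (simp add: theta_def)
  then show ?thesis by (simp add: fun_eq_iff)
qed

lemma theta_diff:
  assumes "smooth_fun C V f" "smooth_fun C V h" "open V" "p \<in> V"
  shows "theta C (\<lambda>p. f p - h p) p = theta C f p - theta C h p"
proof -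
  have "theta C (\<lambda>p. f p - h p) p c e = theta C f p c e - theta C h p c e" for c e
  proof (cases "c \<in> charts_at C p")
    case True
    then show ?thesis
      using theta_eq[OF smooth_fun_diff[OF assms(3,1,2)] assms(4) True]
      by (simp add: theta_eq[OF assms(1,4)] theta_eq[OF assms(2,4)] dfun_diff[OF assms(1,2) _ assms(4)])
  qed (simp add: theta_def)
  then show ?thesis by (simp add: fun_eq_iff)
qed

lemma theta_const: "theta C (\<lambda>p. k) p = 0"
  by (simp add: theta_def fun_eq_iff partial_y_def o_def)

lemma theta_in_coordinates:
  assumes "smooth_fun C V f" "c \<in> C" "z \<in> coord c ` (cdom c \<inter> V)"
  shows "theta C f (cinv c z) c e = pd (0, fst e) (f \<circ> cinv c) z"
proof -
  obtain p where p: "p \<in> cdom c" "p \<in> V" "z = coord c p" using assms(3) by auto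
  then show ?thesis using theta_eq[OF assms(1) p(2), of c e] assms(2)
    by (simp add: cinv_coord[OF chart] charts_at_iff dfun_def)
qed

text \<open>The transformation law joins the chain rule for df with \<open>adapted\<close>, by which
  Jacobians commute with \<open>S\<close>.\<close>

lemma one_form_on_theta:
  assumes "open V" "smooth_fun C V f" shows "one_form_on C V (theta C f)"
  unfolding one_form_on_def
proof (intro conjI ballI allI impI)
  fix p c assume p: "p \<in> V" "c \<in> charts_at C p"
  have l: "linear (dfun f p c)"
    unfolding dfun_def by (rule linear_frechet_derivative[OF smooth_fun_at(3)[OF assms(2) p(2,1)]])
  show "linear (theta C f p c)"
  proof (rule linearI)
    fix x y :: "'n model" and r :: real
    show "theta C f p c (x + y) = theta C f p c x + theta C f p c y"
      using linear_add[OF l, of "(0, fst x)" "(0, fst y)"] by (simp add: theta_eq[OF assms(2) p])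
    show "theta C f p c (r *\<^sub>R x) = r *\<^sub>R theta C f p c x"
      using linear_cmul[OF l, of r "(0, fst x)"] by (simp add: theta_eq[OF assms(2) p])
  qed
next
  fix p c c' e assume p: "p \<in> V" "c \<in> charts_at C p" "c' \<in> charts_at C p"
  show "theta C f p c e = theta C f p c' (jac c c' p e)"
    using dfun_change_chart[OF p(2,3) smooth_fun_at(3)[OF assms(2) p(3,1)]] adapted[OF p(2,3)]
    by (simp add: theta_eq[OF assms(2)] p)
next
  fix p c assume "c \<notin> charts_at C p"
  then show "theta C f p c = (\<lambda>e. 0)" by (simp add: theta_def fun_eq_iff)
next
  fix c and e :: "'n model" assume c: "c \<in> C"
  have "smooth_on (coord c ` (cdom c \<inter> V)) (pd (0, fst e) (f \<circ> cinv c))"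
    by (rule smooth_on_pd) (use assms(2) c in \<open>simp add: smooth_fun_def\<close>)
  then show "smooth_on (coord c ` (cdom c \<inter> V)) (\<lambda>q. theta C f (cinv c q) c e)"
    by (rule smooth_on_cong[OF open_image_Int[OF c assms(1)], rotated])
      (simp add: theta_in_coordinates[OF assms(2) c])
qed

lemma dfun_theta:
  assumes "open V" "smooth_fun C V f" "p \<in> V" "c \<in> charts_at C p"
  shows "dfun (\<lambda>q. theta C f q c v) p c u = pd u (pd (0, fst v) (f \<circ> cinv c)) (coord c p)"
  unfolding dfun_def
proof (rule fun_cong[OF pd_cong])
  show "open (coord c ` (cdom c \<inter> V))" "coord c p \<in> coord c ` (cdom c \<inter> V)"
    using open_image_Int assms by (auto simp: charts_at_iff)
  show "((\<lambda>q. theta C f q c v) \<circ> cinv c) z = pd (0, fst v) (f \<circ> cinv c) z"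
    if "z \<in> coord c ` (cdom c \<inter> V)" for z
    using theta_in_coordinates[OF assms(2) _ that] assms(4) by (simp add: charts_at_iff)
qed

lemma omega_eq:
  assumes "open V" "smooth_fun C V f" "p \<in> V" "c \<in> charts_at C p"
  shows "omega C f p c u v = pd u (pd (0, fst v) (f \<circ> cinv c)) (coord c p)
    - pd v (pd (0, fst u) (f \<circ> cinv c)) (coord c p)"
  using assms(4) by (simp add: omega_def d1_def dfun_theta[OF assms])

lemma g_of_eq:
  assumes "open V" "smooth_fun C V f" "p \<in> V" "c \<in> charts_at C p"
  shows "g_of f p c u v = pd (0, fst u) (pd (0, fst v) (f \<circ> cinv c)) (coord c p)"
proof -
  let ?F = "f \<circ> cinv c" and ?z = "coord c p" and ?T = "coord c ` (cdom c \<inter> V)"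
  note F = smooth_fun_at(1,2)[OF assms(2,4,3)]
  have o: "open ?T" using open_image_Int assms by (auto simp: charts_at_iff)
  note d = smooth_on_differentiable[OF F(1)]
  note d2 = smooth_on_differentiable[OF smooth_on_pd[OF F(1)] F(2)]
  have d3: "(\<lambda>x. partial_y j ?F x) differentiable at ?z" for j
    unfolding partial_y_def by (rule d2)
  have "pd (0, fst u) (pd (0, fst v) ?F) ?z = (\<Sum>i\<in>UNIV. partial_y i (pd (0, fst v) ?F) ?z * fst u $ i)"
    by (rule partial_y_sum[OF d2, symmetric])
  also have "\<dots> = (\<Sum>i\<in>UNIV. (\<Sum>j\<in>UNIV. partial_y i (partial_y j ?F) ?z * fst v $ j) * fst u $ i)"
  proof (intro sum.cong refl arg_cong2[where f = "(*)"])
    fix i :: 'n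
    have "partial_y i (pd (0, fst v) ?F) ?z = partial_y i (\<lambda>z. \<Sum>j\<in>UNIV. partial_y j ?F z * fst v $ j) ?z"
      unfolding partial_y_def[of i]
      by (rule fun_cong[OF pd_cong[OF o F(2)]]) (simp add: partial_y_sum[OF d])
    also have "\<dots> = (\<Sum>j\<in>UNIV. pd (0, axis i 1) (\<lambda>z. partial_y j ?F z * fst v $ j) ?z)"
      unfolding partial_y_def[of i] by (rule pd_sum) (intro differentiable_mult d3 differentiable_const)
    also have "\<dots> = (\<Sum>j\<in>UNIV. partial_y i (partial_y j ?F) ?z * fst v $ j)"
      by (simp add: pd_mult[OF d3 differentiable_const] partial_y_def[of i])
    finally show "partial_y i (pd (0, fst v) ?F) ?z = (\<Sum>j\<in>UNIV. partial_y i (partial_y j ?F) ?z * fst v $ j)" .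
  qed
  also have "\<dots> = g_of f p c u v"
    unfolding g_of_def by (simp add: sum_distrib_left sum_distrib_right mult_ac)
  finally show ?thesis by simp
qed

text \<open>Of the two second derivatives in \<open>omega_eq\<close>, the one that starts with
  \<open>pd (0, 0)\<close> differentiates a function that vanishes near the point. The entry
  \<open>w'\<close> is free because \<open>g_of\<close> sees only the first component.\<close>

lemma omega_vertical:
  assumes "open V" "smooth_fun C V f" "p \<in> V" "c \<in> charts_at C p"
  shows "omega C f p c (0, w) v = g_of f p c (w, w') v"
proof -
  let ?F = "f \<circ> cinv c"
  note F = smooth_fun_at(1,2)[OF assms(2,4,3)]
  have "frechet_derivative (pd (0, 0) ?F) (at (coord c p)) = frechet_derivative (\<lambda>z. 0) (at (coord c p))"
    by (rule pd_cong[OF _ F(2)])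
      (use open_image_Int assms linear_0[OF linear_frechet_derivative[OF smooth_on_differentiable[OF F(1)]]]
        in \<open>auto simp: charts_at_iff zero_prod_def\<close>)
  then show ?thesis by (simp add: omega_eq[OF assms] g_of_eq[OF assms])
qed

text \<open>The invariant form of \<^term>\<open>Omega_pr C\<close>: for a form that vanishes on vertical vectors,
  contracting its differential with a vertical vector differentiates its components along the leaves.
  Both conditions are tensorial, so that one chart around each point suffices.\<close>

definition foliated :: "'m set \<Rightarrow> ('m, 'n) form1 \<Rightarrow> bool" where
  "foliated V \<alpha> \<longleftrightarrow> one_form_on C V \<alpha> \<and>
     (\<forall>p\<in>V. \<forall>c\<in>charts_at C p. \<forall>w v. \<alpha> p c (0, w) = 0 \<and> d1 C \<alpha> p c (0, w) v = 0)"

lemma foliatedD: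
  assumes "foliated V \<alpha>"
  shows "one_form_on C V \<alpha>" and "p \<in> V \<Longrightarrow> \<alpha> p c (0, w) = 0"
    and "p \<in> V \<Longrightarrow> c \<in> charts_at C p \<Longrightarrow> d1 C \<alpha> p c (0, w) v = 0"
  using assms one_form_onD(3)[of V \<alpha> p c] unfolding foliated_def by (blast, metis, blast)

lemma foliated_mono: "foliated V \<alpha> \<Longrightarrow> W \<subseteq> V \<Longrightarrow> foliated W \<alpha>"
  unfolding foliated_def using one_form_on_mono by blast

lemma foliated_zero: "foliated V (\<lambda>p c e. 0)"
  unfolding foliated_def by (simp add: one_form_on_zero d1_def dfun_def o_def)

lemma foliated_add:
  assumes "open V" "foliated V \<alpha>" "foliated V \<beta>" shows "foliated V (\<lambda>p c e. \<alpha> p c e + \<beta> p c e)"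
  unfolding foliated_def
  by (intro conjI ballI allI one_form_on_add assms(1) foliatedD(1)[OF assms(2)] foliatedD(1)[OF assms(3)])
    (simp_all add: foliatedD[OF assms(2)] foliatedD[OF assms(3)]
      d1_add[OF foliatedD(1)[OF assms(2)] foliatedD(1)[OF assms(3)]])

lemma foliated_diff:
  assumes "open V" "foliated V \<alpha>" "foliated V \<beta>" shows "foliated V (\<lambda>p c e. \<alpha> p c e - \<beta> p c e)"
  unfolding foliated_def
  by (intro conjI ballI allI one_form_on_diff assms(1) foliatedD(1)[OF assms(2)] foliatedD(1)[OF assms(3)])
    (simp_all add: foliatedD[OF assms(2)] foliatedD[OF assms(3)]
      d1_diff[OF foliatedD(1)[OF assms(2)] foliatedD(1)[OF assms(3)]])

lemma foliated_cong:
  assumes "open V" "foliated V \<alpha>" "\<And>p. p \<in> V \<Longrightarrow> \<beta> p = \<alpha> p" shows "foliated V \<beta>"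
  using assms(2) one_form_on_cong[OF assms(1) _ assms(3)] d1_cong[OF assms(1) _ assms(3)] assms(3)
  unfolding foliated_def by auto

lemma foliated_local:
  assumes "open V" "\<And>p. p \<in> V \<Longrightarrow> \<exists>W. open W \<and> p \<in> W \<and> foliated W \<alpha>"
  shows "foliated V \<alpha>"
proof -
  have "one_form_on C V \<alpha>" by (rule one_form_on_local[OF assms(1)]) (use assms(2) foliatedD(1) in blast)
  moreover have "\<alpha> p c (0, w) = 0 \<and> d1 C \<alpha> p c (0, w) v = 0"
    if "p \<in> V" "c \<in> charts_at C p" for p c w v
    using assms(2)[OF that(1)] foliatedD(2,3) that(2) by meson
  ultimately show ?thesis unfolding foliated_def by blast
qed

text \<open>In the formula for d the other term differentiates \<alpha> on a fixed vertical vector,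
  which is identically zero on \<open>V\<close>.\<close>

lemma foliated_derivative:
  assumes "foliated V \<alpha>" "open V" "p \<in> V" "c \<in> charts_at C p"
  shows "dfun (\<lambda>q. \<alpha> q c v) p c (0, w) = 0"
proof -
  have "dfun (\<lambda>q. \<alpha> q c (0, w)) p c = dfun (\<lambda>q. 0) p c"
    by (rule dfun_cong[OF assms(4,2,3)]) (rule foliatedD(2)[OF assms(1)])
  then show ?thesis using foliatedD(3)[OF assms(1,3,4), of w v] assms(4)
    by (simp add: d1_def dfun_def o_def)
qed

lemma foliatedI:
  assumes V: "open V" and \<alpha>: "one_form_on C V \<alpha>"
    and *: "\<And>p. p \<in> V \<Longrightarrow> \<exists>c\<in>charts_at C p. \<exists>W. open W \<and> p \<in> W \<and>
      (\<forall>q\<in>W. \<forall>w. \<alpha> q c (0, w) = 0) \<and> (\<forall>w v. dfun (\<lambda>q. \<alpha> q c v) p c (0, w) = 0)"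
  shows "foliated V \<alpha>"
  unfolding foliated_def
proof (intro conjI \<alpha> ballI allI)
  fix p c w v assume p: "p \<in> V" and c: "c \<in> charts_at C p"
  obtain c' W where c': "c' \<in> charts_at C p" and W: "open W" "p \<in> W"
    and 0: "\<And>q w. q \<in> W \<Longrightarrow> \<alpha> q c' (0, w) = 0" "\<And>w v. dfun (\<lambda>q. \<alpha> q c' v) p c' (0, w) = 0"
    using *[OF p] by meson
  \<comment> \<open>Vertical vectors go to vertical vectors: (0, w) is \<open>S\<close> applied to
    (w, 0).\<close>
  have j: "jac c c' p (0, w) = (0, fst (jac c c' p (w, 0)))" using adapted[OF c c', of "(w, 0)"] by simp
  have "dfun (\<lambda>q. \<alpha> q c' (0, w)) p c' = dfun (\<lambda>q. 0) p c'" for w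
    by (rule dfun_cong[OF c' W]) (rule 0)
  then have "d1 C \<alpha> p c' (0, w) v = 0" for w v
    using 0(2) by (simp add: d1_def dfun_def o_def)
  then show "d1 C \<alpha> p c (0, w) v = 0"
    by (simp add: d1_change_chart[OF \<alpha> V p c c'] j)
  show "\<alpha> p c (0, w) = 0"
    using one_form_onD(2)[OF \<alpha> p c c', of "(0, w)"] 0(1)[OF W(2)] by (simp add: j)
qed

text \<open>A product of two balls inside the image, pulled back. The convex second factor lets
  vanishing vertical derivatives imply independence of y, and the restricted chart has its domain
  inside \<open>V\<close>, as the sheaves demand.\<close>

lemma box_chart:
  assumes "c \<in> charts_at C p" "open V" "p \<in> V"
  obtains X Y W where "open X" "open Y" "convex X" "convex Y" "X \<times> Y = coord c ` W" "open W" "p \<in> W"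
    "W \<subseteq> cdom c" "W \<subseteq> V" "Chart W (coord c) \<in> charts_at C p"
proof -
  have c: "c \<in> C" "p \<in> cdom c" using assms by (auto simp: charts_at_iff)
  let ?T = "coord c ` (cdom c \<inter> V)"
  have "open ?T" "coord c p \<in> ?T" using open_image_Int c assms by auto
  then obtain A B where AB: "open A" "open B" "coord c p \<in> A \<times> B" "A \<times> B \<subseteq> ?T"
    using open_prod_def[of ?T] by metis
  obtain r s where r: "r > 0" "ball (fst (coord c p)) r \<subseteq> A" "s > 0" "ball (snd (coord c p)) s \<subseteq> B"
    using AB by (metis mem_Times_iff openE)
  define X Y where "X = ball (fst (coord c p)) r" and "Y = ball (snd (coord c p)) s"
  define W where "W = cdom c \<inter> coord c -` (X \<times> Y)"
  have XY: "open X" "open Y" "convex X" "convex Y" "X \<times> Y \<subseteq> ?T" "coord c p \<in> X \<times> Y"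
    using r AB(4) by (auto simp: X_def Y_def mem_Times_iff)
  have W: "open W" unfolding W_def by (rule open_coord_preimage[OF chart[OF c(1)]]) (simp add: XY open_Times)
  have "B = coord c ` (cdom c \<inter> coord c -` B)" if "B \<subseteq> ?T" for B using that by auto
  from this[OF XY(5)] have im: "X \<times> Y = coord c ` W" by (simp add: W_def)
  have sub: "W \<subseteq> cdom c" "p \<in> W" using XY c by (auto simp: W_def)
  have "W \<subseteq> V"
  proof
    fix q assume q: "q \<in> W"
    then have "coord c q \<in> ?T" using XY(5) by (auto simp: W_def)
    then show "q \<in> V" using chart_inj_on[OF chart[OF c(1)]] q sub by (auto simp: inj_on_def)
  qed
  then show thesis using that[OF XY(1-4) im W sub(2,1)] restriction[OF c(1) W sub(1)] sub
    by (simp add: charts_at_iff)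
qed

section \<open>Local normal forms: sections of the three sheaves as solutions of invariant
  equations\<close>

lemma Omega_pr_foliated:
  assumes "\<alpha> \<in> Omega_pr C V" "open V" shows "foliated V \<alpha>"
proof (rule foliatedI[OF assms(2)])
  show \<alpha>: "one_form_on C V \<alpha>" using assms(1) by (simp add: Omega_pr_def)
  fix p assume p: "p \<in> V"
  obtain c \<phi> where c: "c \<in> charts_at C p" "cdom c \<subseteq> V" and \<phi>: "smooth_on (fst ` coord c ` cdom c) \<phi>"
    and eq: "\<And>q e. q \<in> cdom c \<Longrightarrow> \<alpha> q c e = (\<Sum>i\<in>UNIV. \<phi> (fst (coord c q)) $ i * fst e $ i)"
    using assms(1) p by (auto simp: Omega_pr_def)
  have cC: "c \<in> C" "p \<in> cdom c" using c by (auto simp: charts_at_iff)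
  have o: "open (coord c ` cdom c)" "coord c p \<in> coord c ` cdom c"
    using chart[OF cC(1)] cC by (auto simp: is_chart_def)
  have "dfun (\<lambda>q. \<alpha> q c v) p c (0, w) = 0" for v w
  proof -
    let ?H = "\<lambda>x. \<Sum>i\<in>UNIV. \<phi> x $ i * fst v $ i"
    have "\<phi> differentiable at (fst (coord c p))"
      by (rule smooth_on_differentiable[OF \<phi>]) (use cC in auto)
    then have "?H differentiable at (fst (coord c p))"
      by (intro differentiable_sum finite ballI differentiable_mult differentiable_const
          differentiable_vec_nth)
    note 0 = pd_fst_compose(2)[OF this]
    have "frechet_derivative ((\<lambda>q. \<alpha> q c v) \<circ> cinv c) (at (coord c p))
        = frechet_derivative (\<lambda>z. ?H (fst z)) (at (coord c p))"
      by (rule pd_cong[OF o]) (auto simp: eq cinv_coord[OF chart[OF cC(1)]])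
    then show ?thesis using 0 by (simp add: dfun_def)
  qed
  then show "\<exists>c\<in>charts_at C p. \<exists>W. open W \<and> p \<in> W \<and>
      (\<forall>q\<in>W. \<forall>w. \<alpha> q c (0, w) = 0) \<and> (\<forall>w v. dfun (\<lambda>q. \<alpha> q c v) p c (0, w) = 0)"
    using c(1) cC open_cdom[OF chart] by (intro bexI[of _ c] exI[of _ "cdom c"]) (auto simp: eq)
qed

lemma foliated_Omega_pr:
  assumes fol: "foliated V \<alpha>" and V: "open V" shows "\<alpha> \<in> Omega_pr C V"
proof -
  note \<alpha> = foliatedD(1)[OF fol]
  have "\<exists>c\<in>charts_at C p. cdom c \<subseteq> V \<and> (\<exists>\<phi>. smooth_on (fst ` coord c ` cdom c) \<phi> \<and>
       (\<forall>q\<in>cdom c. \<forall>e. \<alpha> q c e = (\<Sum>i\<in>UNIV. \<phi> (fst (coord c q)) $ i * fst e $ i)))"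
    if p: "p \<in> V" for p
  proof -
    obtain c where c: "c \<in> charts_at C p" using covering by blast
    then have cC: "c \<in> C" by (simp add: charts_at_iff)
    obtain X Y W where XY: "open X" "open Y" "convex X" "convex Y" "X \<times> Y = coord c ` W"
      and W: "open W" "p \<in> W" "W \<subseteq> cdom c" "W \<subseteq> V" "Chart W (coord c) \<in> charts_at C p"
      using box_chart[OF c V p] .
    let ?c = "Chart W (coord c)"
    define y0 where "y0 = snd (coord c p)"
    have y0: "y0 \<in> Y" using XY(5) W(2) unfolding y0_def by (metis imageI mem_Times_iff)
    define G where "G v = (\<lambda>z. \<alpha> (cinv c z) c v)" for v
    \<comment> \<open>The coefficients are frozen at the fibre coordinate of p; on the box they turn
      out not to depend on it.\<close>
    define \<phi> where "\<phi> x = (\<chi> i. G (axis i 1, 0) (x, y0))" for x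
    have smG: "smooth_on (X \<times> Y) (G v)" for v
      unfolding G_def by (rule smooth_on_mono[OF one_form_onD(4)[OF \<alpha> cC]]) (use XY W in auto)
    have "smooth_on X \<phi>"
      by (rule smooth_on_vec[OF XY(1)]) (simp add: \<phi>_def smooth_on_slice[OF XY(1,2) y0 smG])
    moreover have "fst ` coord c ` W = X" using XY(5) y0 by (metis fst_image_times equals0D)
    moreover have "\<alpha> q ?c e = (\<Sum>i\<in>UNIV. \<phi> (fst (coord c q)) $ i * fst e $ i)" if q: "q \<in> W" for q e
    proof -
      have cq: "c \<in> charts_at C q" "?c \<in> charts_at C q" "q \<in> V"
        using q W cC by (auto simp: charts_at_iff)
      \<comment> \<open>A form has separate components for each chart, so those in the restricted
        chart must be compared with those in \<open>c\<close>; the Jacobian between the two is the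
        identity.\<close>
      have "jac c ?c q e = e"
        using jac_restrict(2)[OF chart[OF cC] W(1,3) q, of c] jac_self[OF chart[OF cC], of q e] W(3) q by auto
      then have "\<alpha> q ?c e = \<alpha> q c e" using one_form_onD(2)[OF \<alpha> cq(3,1,2), of e] by simp
      also have "\<dots> = \<alpha> q c (\<Sum>i\<in>UNIV. fst e $ i *\<^sub>R (axis i 1, 0)) + \<alpha> q c (0, snd e)"
      proof -
        have "e = (\<Sum>i\<in>UNIV. fst e $ i *\<^sub>R (axis i (1::real), 0::real ^ 'n)) + (0, snd e)"
          using basis_expansion[of "fst e"]
          by (simp add: prod_eq_iff fst_sum snd_sum scalar_mult_eq_scaleR)
        then have "\<alpha> q c e = \<alpha> q c ((\<Sum>i\<in>UNIV. fst e $ i *\<^sub>R (axis i 1, 0)) + (0, snd e))" by (rule arg_cong)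
        also have "\<dots> = \<alpha> q c (\<Sum>i\<in>UNIV. fst e $ i *\<^sub>R (axis i 1, 0)) + \<alpha> q c (0, snd e)"
          by (rule linear_add[OF one_form_onD(1)[OF \<alpha> cq(3,1)]])
        finally show ?thesis .
      qed
      also have "\<dots> = (\<Sum>i\<in>UNIV. \<alpha> q c (axis i 1, 0) * fst e $ i)"
        unfolding linear_sum[OF one_form_onD(1)[OF \<alpha> cq(3,1)]] linear_cmul[OF one_form_onD(1)[OF \<alpha> cq(3,1)]]
          foliatedD(2)[OF fol cq(3)] by (simp add: mult.commute)
      also have "\<dots> = (\<Sum>i\<in>UNIV. \<phi> (fst (coord c q)) $ i * fst e $ i)"
      proof (intro sum.cong refl arg_cong2[where f = "(*)"])
        fix i :: 'n
        have z: "fst (coord c q) \<in> X" "snd (coord c q) \<in> Y" using XY(5) q by (metis imageI mem_Times_iff)+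
        have "G (axis i 1, 0) (fst (coord c q), snd (coord c q)) = G (axis i 1, 0) (fst (coord c q), y0)"
        proof (rule constant_on_fibres[OF XY(4) z y0])
          fix x assume x: "x \<in> X \<times> Y"
          show "G (axis i 1, 0) differentiable at x" by (rule smooth_on_differentiable[OF smG x])
          fix w
          obtain q' where q': "q' \<in> W" "x = coord c q'" using x XY(5) by auto
          then have "c \<in> charts_at C q'" "q' \<in> V" using W cC by (auto simp: charts_at_iff)
          then show "pd (0, w) (G (axis i 1, 0)) x = 0"
            using foliated_derivative[OF fol V] q' by (simp add: dfun_def G_def o_def)
        qed
        then show "\<alpha> q c (axis i 1, 0) = \<phi> (fst (coord c q)) $ i"
          using q W(3) by (auto simp: G_def \<phi>_def cinv_coord[OF chart[OF cC]] subset_iff)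
      qed
      finally show ?thesis .
    qed
    ultimately show ?thesis using W(4,5) by (intro bexI[of _ ?c]) auto
  qed
  then show ?thesis using \<alpha> by (simp add: Omega_pr_def)
qed

lemma Omega_pr_iff: "open V \<Longrightarrow> \<alpha> \<in> Omega_pr C V \<longleftrightarrow> foliated V \<alpha>"
  using Omega_pr_foliated foliated_Omega_pr by blast

text \<open>The values of \<open>theta C f\<close> are the vertical derivatives of f. If they
  vanish, then on a box f equals its restriction to the slice through p, and this restriction is the
  required function of x.\<close>

lemma Phi_iff:
  assumes V: "open V"
  shows "f \<in> Phi C V \<longleftrightarrow> smooth_fun C V f \<and> (\<forall>p\<in>V. theta C f p = 0)"
proof safe
  assume f: "f \<in> Phi C V"
  then show sm: "smooth_fun C V f" by (simp add: Phi_def)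
  fix p assume p: "p \<in> V"
  obtain c b where c: "c \<in> charts_at C p" "cdom c \<subseteq> V" and b: "smooth_on (fst ` coord c ` cdom c) b"
    and eq: "\<And>q. q \<in> cdom c \<Longrightarrow> f q = b (fst (coord c q))"
    using f p by (auto simp: Phi_def)
  have cC: "c \<in> C" "p \<in> cdom c" using c by (auto simp: charts_at_iff)
  have "b differentiable at (fst (coord c p))"
    by (rule smooth_on_differentiable[OF b]) (use cC in auto)
  note 0 = pd_fst_compose(2)[OF this]
  have "frechet_derivative (f \<circ> cinv c) (at (coord c p))
      = frechet_derivative (\<lambda>z. b (fst z)) (at (coord c p))"
    by (rule pd_cong[where T = "coord c ` cdom c"])
      (use chart[OF cC(1)] cC in \<open>auto simp: is_chart_def eq cinv_coord[OF chart[OF cC(1)]]\<close>)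
  then have "theta C f p c e = 0" for e
    using 0 by (simp add: theta_eq[OF sm p c(1)] dfun_def)
  \<comment> \<open>The formula for f is known in one chart only; the transformation law carries the
    vanishing to the others, and the normalization covers charts that miss p.\<close>
  then have "theta C f p c' e = 0" for c' e
    using one_form_onD(2)[OF one_form_on_theta[OF V sm] p _ c(1), of c' e]
      one_form_onD(3)[OF one_form_on_theta[OF V sm] p, of c'] by (cases "c' \<in> charts_at C p") auto
  then show "theta C f p = 0" by (simp add: fun_eq_iff)
next
  assume sm: "smooth_fun C V f" and 0: "\<forall>p\<in>V. theta C f p = 0"
  have "\<exists>c\<in>charts_at C p. cdom c \<subseteq> V \<and> (\<exists>b. smooth_on (fst ` coord c ` cdom c) b \<and>
       (\<forall>q\<in>cdom c. f q = b (fst (coord c q))))" if p: "p \<in> V" for p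
  proof -
    obtain c where c: "c \<in> charts_at C p" using covering by blast
    then have cC: "c \<in> C" by (simp add: charts_at_iff)
    obtain X Y W where XY: "open X" "open Y" "convex X" "convex Y" "X \<times> Y = coord c ` W"
      and W: "open W" "p \<in> W" "W \<subseteq> cdom c" "W \<subseteq> V" "Chart W (coord c) \<in> charts_at C p"
      using box_chart[OF c V p] .
    define y0 where "y0 = snd (coord c p)"
    have y0: "y0 \<in> Y" using XY(5) W(2) unfolding y0_def by (metis imageI mem_Times_iff)
    define F where "F = f \<circ> cinv c"
    have smF: "smooth_on (X \<times> Y) F" unfolding F_def
      by (rule smooth_on_mono[OF smooth_fun_at(1)[OF sm c p]]) (use XY W in auto)
    have "fst ` coord c ` W = X" using XY(5) y0 by (metis fst_image_times equals0D)
    moreover have "f q = F (fst (coord c q), y0)" if q: "q \<in> W" for q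
    proof -
      have z: "fst (coord c q) \<in> X" "snd (coord c q) \<in> Y" using XY(5) q by (metis imageI mem_Times_iff)+
      have "F (fst (coord c q), snd (coord c q)) = F (fst (coord c q), y0)"
      proof (rule constant_on_fibres[OF XY(4) z y0])
        fix x assume x: "x \<in> X \<times> Y"
        show "F differentiable at x" by (rule smooth_on_differentiable[OF smF x])
        fix w
        obtain q' where q': "q' \<in> W" "x = coord c q'" using x XY(5) by auto
        then have "c \<in> charts_at C q'" "q' \<in> V" using W cC by (auto simp: charts_at_iff)
        then show "pd (0, w) F x = 0"
          using theta_eq[OF sm, of q' c "(w, 0)"] 0 q' by (simp add: dfun_def F_def)
      qed
      then show ?thesis using q W(3) by (auto simp: F_def cinv_coord[OF chart[OF cC]] subset_iff)
    qed
    ultimately show ?thesis using W(4,5) smooth_on_slice[OF XY(1,2) y0 smF]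
      by (intro bexI[of _ "Chart W (coord c)"] conjI exI[of _ "\<lambda>x. F (x, y0)"]) auto
  qed
  then show "f \<in> Phi C V" using sm by (simp add: Phi_def)
qed

text \<open>If \<open>theta C f\<close> is foliated, its coefficients \<phi> depend locally on x
  alone and are the fibre gradient of f, so that f is affine along the convex fibres of a
  box.\<close>

lemma A0_iff:
  assumes V: "open V"
  shows "f \<in> A0 C V \<longleftrightarrow> smooth_fun C V f \<and> foliated V (theta C f)"
proof safe
  assume f: "f \<in> A0 C V"
  then show sm: "smooth_fun C V f" by (simp add: A0_def)
  have "\<exists>c\<in>charts_at C p. cdom c \<subseteq> V \<and> (\<exists>\<phi>. smooth_on (fst ` coord c ` cdom c) \<phi> \<and>
       (\<forall>q\<in>cdom c. \<forall>e. theta C f q c e = (\<Sum>i\<in>UNIV. \<phi> (fst (coord c q)) $ i * fst e $ i)))"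
    if p: "p \<in> V" for p
  proof -
    obtain c \<phi> b where c: "c \<in> charts_at C p" "cdom c \<subseteq> V"
      and \<phi>: "smooth_on (fst ` coord c ` cdom c) \<phi>" and b: "smooth_on (fst ` coord c ` cdom c) b"
      and eq: "\<And>q. q \<in> cdom c \<Longrightarrow> f q =
        (\<Sum>i\<in>UNIV. \<phi> (fst (coord c q)) $ i * snd (coord c q) $ i) + b (fst (coord c q))"
      using f p unfolding A0_def by blast
    have cC: "c \<in> C" using c by (auto simp: charts_at_iff)
    have "theta C f q c e = (\<Sum>i\<in>UNIV. \<phi> (fst (coord c q)) $ i * fst e $ i)" if q: "q \<in> cdom c" for q e
    proof -
      have d: "\<phi> differentiable at (fst (coord c q))" "b differentiable at (fst (coord c q))"
        using smooth_on_differentiable[OF \<phi>] smooth_on_differentiable[OF b] q by auto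
      have "frechet_derivative (f \<circ> cinv c) (at (coord c q)) = frechet_derivative
          (\<lambda>z. (\<Sum>i\<in>UNIV. \<phi> (fst z) $ i * snd z $ i) + b (fst z)) (at (coord c q))"
        by (rule pd_cong[where T = "coord c ` cdom c"])
          (use chart[OF cC] q in \<open>auto simp: is_chart_def eq cinv_coord[OF chart[OF cC]]\<close>)
      then show ?thesis
        using theta_eq[OF sm, of q c e] c(2) q cC
          pd_add[OF pd_affine_fibre(1)[OF d(1)] pd_fst_compose(1)[OF d(2)], of "(0, fst e)"]
          pd_affine_fibre(2)[OF d(1)] pd_fst_compose(2)[OF d(2)]
        by (auto simp: dfun_def charts_at_iff)
    qed
    then show ?thesis using c \<phi> by blast
  qed
  then have "theta C f \<in> Omega_pr C V" using one_form_on_theta[OF V sm] by (simp add: Omega_pr_def)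
  then show "foliated V (theta C f)" using Omega_pr_foliated V by blast
next
  assume sm: "smooth_fun C V f" and "foliated V (theta C f)"
  then have \<theta>: "theta C f \<in> Omega_pr C V" using foliated_Omega_pr V by blast
  have "\<exists>c\<in>charts_at C p. cdom c \<subseteq> V \<and>
     (\<exists>\<phi> b. smooth_on (fst ` coord c ` cdom c) \<phi> \<and> smooth_on (fst ` coord c ` cdom c) b \<and>
       (\<forall>q\<in>cdom c. f q =
          (\<Sum>i\<in>UNIV. \<phi> (fst (coord c q)) $ i * snd (coord c q) $ i) + b (fst (coord c q))))"
    if p: "p \<in> V" for p
  proof -
    obtain c \<phi> where c: "c \<in> charts_at C p" "cdom c \<subseteq> V" and \<phi>: "smooth_on (fst ` coord c ` cdom c) \<phi>"
      and eq: "\<And>q e. q \<in> cdom c \<Longrightarrow> theta C f q c e = (\<Sum>i\<in>UNIV. \<phi> (fst (coord c q)) $ i * fst e $ i)"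
      using \<theta> p by (auto simp: Omega_pr_def)
    have cC: "c \<in> C" "p \<in> cdom c" using c by (auto simp: charts_at_iff)
    obtain X Y W where XY: "open X" "open Y" "convex X" "convex Y" "X \<times> Y = coord c ` W"
      and W: "open W" "p \<in> W" "W \<subseteq> cdom c" "W \<subseteq> V" "Chart W (coord c) \<in> charts_at C p"
      using box_chart[OF c(1) V p] .
    define y0 where "y0 = snd (coord c p)"
    have y0: "y0 \<in> Y" using XY(5) W(2) unfolding y0_def by (metis imageI mem_Times_iff)
    have im: "fst ` coord c ` W = X" using XY(5) y0 by (metis fst_image_times equals0D)
    have \<phi>X: "smooth_on X \<phi>" by (rule smooth_on_mono[OF \<phi>]) (use im W(3) in auto)
    define F where "F = f \<circ> cinv c"
    \<comment> \<open>The value of f on the slice y = \<open>y0\<close> minus its linear part there.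
      Since f minus the linear part is constant along fibres, this is the remainder at every y of
      the box.\<close>
    define b where "b x = F (x, y0) - (\<Sum>i\<in>UNIV. \<phi> x $ i * y0 $ i)" for x
    have smF: "smooth_on (X \<times> Y) F" unfolding F_def
      by (rule smooth_on_mono[OF smooth_fun_at(1)[OF sm c(1) p]]) (use XY W in auto)
    have "smooth_on X (\<lambda>x. \<phi> x $ i)" for i
      by (rule smooth_on_bounded_linear_comp[OF bounded_linear_vec_nth XY(1) \<phi>X])
    then have "smooth_on X b" unfolding b_def
      by (intro smooth_on_diff smooth_on_sum smooth_on_mult smooth_on_const XY(1)
          smooth_on_slice[OF XY(1,2) y0 smF])
    moreover have "f q = (\<Sum>i\<in>UNIV. \<phi> (fst (coord c q)) $ i * snd (coord c q) $ i) + b (fst (coord c q))"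
      if q: "q \<in> W" for q
    proof -
      let ?G = "\<lambda>z. F z - (\<Sum>i\<in>UNIV. \<phi> (fst z) $ i * snd z $ i)"
      have z: "fst (coord c q) \<in> X" "snd (coord c q) \<in> Y" using XY(5) q by (metis imageI mem_Times_iff)+
      have "?G (fst (coord c q), snd (coord c q)) = ?G (fst (coord c q), y0)"
      proof (rule constant_on_fibres[OF XY(4) z y0])
        fix x assume x: "x \<in> X \<times> Y"
        have d: "F differentiable at x" by (rule smooth_on_differentiable[OF smF x])
        have d2: "\<phi> differentiable at (fst x)" by (rule smooth_on_differentiable[OF \<phi>X]) (use x in auto)
        show "?G differentiable at x" by (intro differentiable_diff d pd_affine_fibre(1) d2)
        fix w
        obtain q' where q': "q' \<in> W" "x = coord c q'" using x XY(5) by auto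
        then have "c \<in> charts_at C q'" "q' \<in> V" using W cC by (auto simp: charts_at_iff)
        then have "pd (0, w) F x = (\<Sum>i\<in>UNIV. \<phi> (fst x) $ i * w $ i)"
          using theta_eq[OF sm, of q' c "(w, 0)"] eq[of q' "(w, 0)"] q' W(3) by (auto simp: dfun_def F_def)
        then show "pd (0, w) ?G x = 0"
          using pd_diff[OF d pd_affine_fibre(1)[OF d2], of "(0, w)"] pd_affine_fibre(2)[OF d2, of w] by simp
      qed
      then have "F (coord c q) = (\<Sum>i\<in>UNIV. \<phi> (fst (coord c q)) $ i * snd (coord c q) $ i) + b (fst (coord c q))"
        by (simp add: b_def)
      then show ?thesis using q W(3) by (auto simp: F_def cinv_coord[OF chart[OF cC(1)]] subset_iff)
    qed
    ultimately show ?thesis using W(4,5) \<phi>X im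
      by (intro bexI[of _ "Chart W (coord c)"] conjI exI[of _ \<phi>] exI[of _ b]) auto
  qed
  then show "f \<in> A0 C V" using sm by (simp add: A0_def)
qed

end

section \<open>Cech classes of presheaves of groups\<close>

text \<open>A section over V is a total function that matters on V only, so restriction is an
  inclusion of sets of functions. These closure properties make \<open>H1_rel\<close> an equivalence
  relation.\<close>

definition subgroup_presheaf :: "('m::topological_space, 'b::ab_group_add) sheaf \<Rightarrow> bool" where
  "subgroup_presheaf F \<longleftrightarrow>
     (\<forall>V. open V \<longrightarrow> (\<lambda>p. 0) \<in> F V) \<and>
     (\<forall>V. open V \<longrightarrow> (\<forall>f\<in>F V. \<forall>h\<in>F V. (\<lambda>p. f p + h p) \<in> F V \<and> (\<lambda>p. f p - h p) \<in> F V)) \<and>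
     (\<forall>V W. open V \<longrightarrow> open W \<longrightarrow> W \<subseteq> V \<longrightarrow> F V \<subseteq> F W)"

lemma subgroup_presheafD:
  assumes "subgroup_presheaf F"
  shows "open V \<Longrightarrow> (\<lambda>p. 0) \<in> F V"
    and "open V \<Longrightarrow> f \<in> F V \<Longrightarrow> h \<in> F V \<Longrightarrow> (\<lambda>p. f p + h p) \<in> F V"
    and "open V \<Longrightarrow> f \<in> F V \<Longrightarrow> h \<in> F V \<Longrightarrow> (\<lambda>p. f p - h p) \<in> F V"
    and "open V \<Longrightarrow> open W \<Longrightarrow> W \<subseteq> V \<Longrightarrow> f \<in> F V \<Longrightarrow> f \<in> F W"
  using assms unfolding subgroup_presheaf_def by blast+

lemma point_cover_Int: "point_cover V \<Longrightarrow> point_cover W \<Longrightarrow> point_cover (\<lambda>x. V x \<inter> W x)"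
  by (simp add: point_cover_def open_Int)

lemma point_coverD: "point_cover V \<Longrightarrow> open (V x)" "point_cover V \<Longrightarrow> x \<in> V x"
  by (simp_all add: point_cover_def)

lemma Z1D:
  assumes "(V, s) \<in> Z1 F"
  shows "point_cover V" and "s x y \<in> F (V x \<inter> V y)"
    and "p \<in> V x \<Longrightarrow> p \<in> V y \<Longrightarrow> p \<in> V z \<Longrightarrow> s x y p + s y z p = s x z p"
  using assms by (auto simp: Z1_def)

lemma H1_relI:
  assumes "(V, s) \<in> Z1 F" "(W, t) \<in> Z1 F" "point_cover R" "\<And>x. R x \<subseteq> V x \<inter> W x"
    "\<And>x. h x \<in> F (R x)" "\<And>x y p. p \<in> R x \<Longrightarrow> p \<in> R y \<Longrightarrow> s x y p - t x y p = h y p - h x p"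
  shows "((V, s), (W, t)) \<in> H1_rel F"
  unfolding H1_rel_def using assms by blast

lemma H1_relE:
  assumes "((V, s), (W, t)) \<in> H1_rel F"
  obtains R h where "(V, s) \<in> Z1 F" "(W, t) \<in> Z1 F" "point_cover R" "\<And>x. R x \<subseteq> V x \<inter> W x"
    "\<And>x. h x \<in> F (R x)" "\<And>x y p. p \<in> R x \<Longrightarrow> p \<in> R y \<Longrightarrow> s x y p - t x y p = h y p - h x p"
proof -
  from assms have Z: "(V, s) \<in> Z1 F" "(W, t) \<in> Z1 F" and "\<exists>R h. point_cover R \<and> (\<forall>x. R x \<subseteq> V x \<inter> W x) \<and>
      (\<forall>x. h x \<in> F (R x)) \<and> (\<forall>x y. \<forall>p\<in>R x \<inter> R y. s x y p - t x y p = h y p - h x p)"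
    by (simp_all add: H1_rel_def)
  then obtain R h where R: "point_cover R" "\<forall>x. R x \<subseteq> V x \<inter> W x" "\<forall>x. h x \<in> F (R x)"
    "\<forall>x y. \<forall>p\<in>R x \<inter> R y. s x y p - t x y p = h y p - h x p" by (elim exE conjE)
  show thesis by (rule that[OF Z R(1)]) (use R in simp_all)
qed

text \<open>Transitivity passes to the common refinement of the two coverings and adds the
  restricted cochains there.\<close>

lemma equiv_H1_rel:
  assumes F: "subgroup_presheaf F" shows "equiv (Z1 F) (H1_rel F)"
proof (rule equivI)
  note D = subgroup_presheafD[OF F]
  show "H1_rel F \<subseteq> Z1 F \<times> Z1 F" by (auto simp: H1_rel_def)
  show "refl_on (Z1 F) (H1_rel F)"
  proof (rule refl_onI)
    fix X assume X: "X \<in> Z1 F"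
    obtain V s where Vs: "X = (V, s)" by (cases X)
    have V: "point_cover V" using Z1D(1) X Vs by metis
    show "(X, X) \<in> H1_rel F" unfolding Vs
      by (rule H1_relI[where R = V and h = "\<lambda>x p. 0"])
        (use X Vs V D(1) point_coverD[OF V] in auto)
  qed
  show "sym (H1_rel F)"
  proof (rule symI)
    fix X Y assume XY: "(X, Y) \<in> H1_rel F"
    obtain V s W t where e: "X = (V, s)" "Y = (W, t)" by (cases X, cases Y)
    from XY[unfolded e] obtain R h where R: "(V, s) \<in> Z1 F" "(W, t) \<in> Z1 F" "point_cover R"
      "\<And>x. R x \<subseteq> V x \<inter> W x" "\<And>x. h x \<in> F (R x)"
      "\<And>x y p. p \<in> R x \<Longrightarrow> p \<in> R y \<Longrightarrow> s x y p - t x y p = h y p - h x p"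
      by (rule H1_relE) blast
    show "(Y, X) \<in> H1_rel F" unfolding e
    proof (rule H1_relI[where R = R and h = "\<lambda>x p. 0 - h x p"])
      show "(\<lambda>p. 0 - h x p) \<in> F (R x)" for x
        by (rule D(3)) (use D(1) R(5) point_coverD[OF R(3)] in auto)
      show "t x y p - s x y p = 0 - h y p - (0 - h x p)" if "p \<in> R x" "p \<in> R y" for x y p
        using arg_cong[OF R(6)[OF that], of uminus] by simp
    qed (use R in auto)
  qed
  show "trans (H1_rel F)"
  proof (rule transI)
    fix X Y Z assume XY: "(X, Y) \<in> H1_rel F" and YZ: "(Y, Z) \<in> H1_rel F"
    obtain V s W t U u where e: "X = (V, s)" "Y = (W, t)" "Z = (U, u)" by (cases X, cases Y, cases Z)
    from XY[unfolded e] obtain R h where R: "(V, s) \<in> Z1 F" "(W, t) \<in> Z1 F" "point_cover R"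
      "\<And>x. R x \<subseteq> V x \<inter> W x" "\<And>x. h x \<in> F (R x)"
      "\<And>x y p. p \<in> R x \<Longrightarrow> p \<in> R y \<Longrightarrow> s x y p - t x y p = h y p - h x p"
      by (rule H1_relE) blast
    from YZ[unfolded e] obtain R' h' where R': "(W, t) \<in> Z1 F" "(U, u) \<in> Z1 F" "point_cover R'"
      "\<And>x. R' x \<subseteq> W x \<inter> U x" "\<And>x. h' x \<in> F (R' x)"
      "\<And>x y p. p \<in> R' x \<Longrightarrow> p \<in> R' y \<Longrightarrow> t x y p - u x y p = h' y p - h' x p"
      by (rule H1_relE) blast
    have o: "open (R x \<inter> R' x)" for x using point_coverD R(3) R'(3) by blast
    show "(X, Z) \<in> H1_rel F" unfolding e
    proof (rule H1_relI[where R = "\<lambda>x. R x \<inter> R' x" and h = "\<lambda>x p. h x p + h' x p"])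
      show "(\<lambda>p. h x p + h' x p) \<in> F (R x \<inter> R' x)" for x
        by (rule D(2)[OF o]) (use D(4)[OF point_coverD(1)[OF R(3)] o _ R(5)] D(4)[OF point_coverD(1)[OF R'(3)] o _ R'(5)] in auto)
      show "s x y p - u x y p = h y p + h' y p - (h x p + h' x p)"
        if "p \<in> R x \<inter> R' x" "p \<in> R y \<inter> R' y" for x y p
        using R(6)[of p x y] R'(6)[of p x y] that by (simp add: algebra_simps)
      show "R x \<inter> R' x \<subseteq> V x \<inter> U x" for x using R(4) R'(4) by blast
    qed (use R R' point_cover_Int in auto)
  qed
qed

text \<open>For coverings with an arbitrary index type, before a refinement map to the point-indexed
  coverings of \<open>Z1\<close> is chosen.\<close>

definition cocycle_on :: "('m::topological_space, 'b::ab_group_add) sheaf \<Rightarrow> ('i \<Rightarrow> 'm set) \<Rightarrow>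
    ('i \<Rightarrow> 'i \<Rightarrow> 'm \<Rightarrow> 'b) \<Rightarrow> bool" where
  "cocycle_on F U s \<longleftrightarrow> (\<forall>\<alpha>. open (U \<alpha>)) \<and> (\<forall>\<alpha> \<beta>. s \<alpha> \<beta> \<in> F (U \<alpha> \<inter> U \<beta>)) \<and>
     (\<forall>\<alpha> \<beta> \<gamma>. \<forall>p\<in>U \<alpha> \<inter> U \<beta> \<inter> U \<gamma>. s \<alpha> \<beta> p + s \<beta> \<gamma> p = s \<alpha> \<gamma> p)"

lemma cocycle_onD:
  assumes "cocycle_on F U s"
  shows "open (U \<alpha>)" and "s \<alpha> \<beta> \<in> F (U \<alpha> \<inter> U \<beta>)"
    and "p \<in> U \<alpha> \<Longrightarrow> p \<in> U \<beta> \<Longrightarrow> p \<in> U \<gamma> \<Longrightarrow> s \<alpha> \<beta> p + s \<beta> \<gamma> p = s \<alpha> \<gamma> p"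
  using assms by (auto simp: cocycle_on_def)

lemma cocycle_on_Z1:
  assumes "cocycle_on F U s" "\<And>x. x \<in> U (r x)"
  shows "(\<lambda>x. U (r x), \<lambda>x y. s (r x) (r y)) \<in> Z1 F"
  using cocycle_onD[OF assms(1)] assms(2) by (simp add: Z1_def point_cover_def)

text \<open>Both \<open>cech_class\<close> and \<open>H1_map\<close> take the image of a whole set
  of representatives. When these are all equivalent, the image is the class of any one of
  them.\<close>

lemma H1_rel_Image_eq:
  assumes "subgroup_presheaf F" "\<And>X. X \<in> S \<Longrightarrow> (Y, X) \<in> H1_rel F" "Y \<in> S"
  shows "H1_rel F `` S = H1_rel F `` {Y}"
proof -
  have "H1_rel F `` {X} = H1_rel F `` {Y}" if "X \<in> S" for X
    using equiv_class_eq[OF equiv_H1_rel[OF assms(1)] assms(2)[OF that]] by simp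
  then show ?thesis using assms(3) by blast
qed

text \<open>The cocycles of two refinement maps r and r' differ by the coboundary of
  \<open>s (r' x) (r x)\<close>: the cocycle identity along the two paths from r' x to r y, through
  r x and through r' y, gives the relation.\<close>

lemma cech_class_eq:
  assumes F: "subgroup_presheaf F" and s: "cocycle_on F U s" and r: "\<And>x. x \<in> U (r x)"
  shows "cech_class F U s = H1_rel F `` {(\<lambda>x. U (r x), \<lambda>x y. s (r x) (r y))}"
  unfolding cech_class_def
proof (rule H1_rel_Image_eq[OF F], elim CollectE exE conjE)
  fix X r' assume X: "X = (\<lambda>x. U (r' x), \<lambda>x y. s (r' x) (r' y))" and "\<forall>x. x \<in> U (r' x)"
  then have r': "\<And>x. x \<in> U (r' x)" by blast
  show "((\<lambda>x. U (r x), \<lambda>x y. s (r x) (r y)), X) \<in> H1_rel F" unfolding X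
  proof (rule H1_relI[where R = "\<lambda>x. U (r x) \<inter> U (r' x)" and h = "\<lambda>x. s (r' x) (r x)"])
    show "s (r' x) (r x) \<in> F (U (r x) \<inter> U (r' x))" for x
      using cocycle_onD(2)[OF s, of "r' x" "r x"] by (simp only: Int_commute)
    show "s (r x) (r y) p - s (r' x) (r' y) p = s (r' y) (r y) p - s (r' x) (r x) p"
      if "p \<in> U (r x) \<inter> U (r' x)" "p \<in> U (r y) \<inter> U (r' y)" for x y p
      using that cocycle_onD(3)[OF s, of p "r' x" "r x" "r y"] cocycle_onD(3)[OF s, of p "r' x" "r' y" "r y"]
      by (simp add: algebra_simps)
  qed (use cocycle_on_Z1[OF s] r r' cocycle_onD(1)[OF s] in \<open>auto simp: point_cover_def\<close>)
qed (use r in blast)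

text \<open>The sum is tested through a third section k that agrees with it on V only. On a subgroup
  presheaf this includes locality: on V the values of \<open>f k\<close> depend only on those of
  k.\<close>

definition presheaf_hom :: "('m::topological_space, 'a::ab_group_add) sheaf \<Rightarrow>
    ('m, 'b::ab_group_add) sheaf \<Rightarrow> (('m \<Rightarrow> 'a) \<Rightarrow> ('m \<Rightarrow> 'b)) \<Rightarrow> bool" where
  "presheaf_hom F G f \<longleftrightarrow> (\<forall>V. open V \<longrightarrow> (\<forall>a\<in>F V. f a \<in> G V) \<and>
     (\<forall>a\<in>F V. \<forall>b\<in>F V. \<forall>k\<in>F V. (\<forall>p\<in>V. a p + b p = k p) \<longrightarrow> (\<forall>p\<in>V. f a p + f b p = f k p)))"

lemma presheaf_homD:
  assumes "presheaf_hom F G f" "open V" "a \<in> F V"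
  shows "f a \<in> G V"
    and "b \<in> F V \<Longrightarrow> k \<in> F V \<Longrightarrow> (\<And>p. p \<in> V \<Longrightarrow> a p + b p = k p) \<Longrightarrow> p \<in> V \<Longrightarrow> f a p + f b p = f k p"
  using assms unfolding presheaf_hom_def by blast+

lemma presheaf_hom_Z1:
  assumes F: "subgroup_presheaf F" and f: "presheaf_hom F G f" and s: "(V, s) \<in> Z1 F"
  shows "(V, \<lambda>x y. f (s x y)) \<in> Z1 G"
proof -
  note V = point_coverD[OF Z1D(1)[OF s]]
  have "f (s x y) \<in> G (V x \<inter> V y)" for x y
    using presheaf_homD(1)[OF f] V Z1D(2)[OF s] by blast
  moreover have "f (s x y) p + f (s y z) p = f (s x z) p" if "p \<in> V x \<inter> V y \<inter> V z" for x y z p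
  proof -
    let ?W = "V x \<inter> V y \<inter> V z"
    have W: "open ?W" using V by blast
    have "s x y \<in> F ?W" "s y z \<in> F ?W" "s x z \<in> F ?W"
      by (rule subgroup_presheafD(4)[OF F open_Int[OF V(1) V(1)] W _ Z1D(2)[OF s]]; blast)+
    then show ?thesis by (rule presheaf_homD(2)[OF f W _ _ _ _ that]) (use Z1D(3)[OF s] in auto)
  qed
  ultimately show ?thesis using Z1D(1)[OF s] by (simp add: Z1_def)
qed

lemma presheaf_hom_H1_rel:
  assumes F: "subgroup_presheaf F" and f: "presheaf_hom F G f" and st: "((V, s), (W, t)) \<in> H1_rel F"
  shows "((V, \<lambda>x y. f (s x y)), (W, \<lambda>x y. f (t x y))) \<in> H1_rel G"
proof -
  from st obtain R h where R: "(V, s) \<in> Z1 F" "(W, t) \<in> Z1 F" "point_cover R"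
    "\<And>x. R x \<subseteq> V x \<inter> W x" "\<And>x. h x \<in> F (R x)"
    "\<And>x y p. p \<in> R x \<Longrightarrow> p \<in> R y \<Longrightarrow> s x y p - t x y p = h y p - h x p"
    by (rule H1_relE) blast
  note D = subgroup_presheafD[OF F]
  show ?thesis
  proof (rule H1_relI[where R = R and h = "\<lambda>x. f (h x)"])
    show "f (h x) \<in> G (R x)" for x by (rule presheaf_homD(1)[OF f point_coverD(1)[OF R(3)] R(5)])
    fix x y p assume p: "p \<in> R x" "p \<in> R y"
    let ?O = "R x \<inter> R y"
    have O: "open ?O" using point_coverD[OF R(3)] by blast
    have h: "h x \<in> F ?O" "h y \<in> F ?O" using D(4)[OF point_coverD(1)[OF R(3)] O _ R(5)] by auto
    have sub: "?O \<subseteq> V x \<inter> V y" "?O \<subseteq> W x \<inter> W y" using R(4)[of x] R(4)[of y] by auto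
    note opens = point_coverD(1)[OF Z1D(1)[OF R(1)]] point_coverD(1)[OF Z1D(1)[OF R(2)]]
    have st: "s x y \<in> F ?O" "t x y \<in> F ?O"
      by (rule D(4)[OF open_Int O sub(1) Z1D(2)[OF R(1)]], rule opens, rule opens)
        (rule D(4)[OF open_Int O sub(2) Z1D(2)[OF R(2)]], rule opens, rule opens)
    \<comment> \<open>On the overlap, s plus h at x equals t plus h at y. With this common section
      the coboundary relation is transported by additivity alone.\<close>
    define k where "k = (\<lambda>q. s x y q + h x q)"
    have k: "k \<in> F ?O" unfolding k_def by (rule D(2)[OF O st(1) h(1)])
    have "f (s x y) p + f (h x) p = f k p"
      by (rule presheaf_homD(2)[OF f O st(1) h(1) k]) (use p in \<open>auto simp: k_def\<close>)
    moreover have "f (t x y) p + f (h y) p = f k p"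
    proof (rule presheaf_homD(2)[OF f O st(2) h(2) k])
      show "t x y q + h y q = k q" if "q \<in> ?O" for q
        using R(6)[of q x y] that by (simp add: k_def algebra_simps)
    qed (use p in auto)
    ultimately have "f (s x y) p = f (t x y) p + f (h y) p - f (h x) p" by (simp add: eq_diff_eq)
    then show "f (s x y) p - f (t x y) p = f (h y) p - f (h x) p" by simp
  qed (use R presheaf_hom_Z1[OF F f] in auto)
qed

lemma H1_map_class:
  assumes F: "subgroup_presheaf F" and G: "subgroup_presheaf G" and f: "presheaf_hom F G f"
    and s: "(V, s) \<in> Z1 F"
  shows "H1_map G f (H1_rel F `` {(V, s)}) = H1_rel G `` {(V, \<lambda>x y. f (s x y))}"
  unfolding H1_map_def
proof (rule H1_rel_Image_eq[OF G], elim CollectE exE conjE)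
  fix X W t assume "X = (W, \<lambda>x y. f (t x y))" "(W, t) \<in> H1_rel F `` {(V, s)}"
  then show "((V, \<lambda>x y. f (s x y)), X) \<in> H1_rel G" using presheaf_hom_H1_rel[OF F f] by blast
next
  have "(V, s) \<in> H1_rel F `` {(V, s)}"
    by (rule equiv_class_self[OF equiv_H1_rel[OF F] s])
  then show "(V, \<lambda>x y. f (s x y)) \<in> {(W, \<lambda>x y. f (t x y)) | W t. (W, t) \<in> H1_rel F `` {(V, s)}}"
    by blast
qed

lemma H1_class_zero_iff:
  assumes F: "subgroup_presheaf F" and s: "(V, s) \<in> Z1 F"
  shows "H1_rel F `` {(V, s)} = H1_zero F \<longleftrightarrow>
    (\<exists>R h. point_cover R \<and> (\<forall>x. R x \<subseteq> V x \<and> h x \<in> F (R x)) \<and>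
      (\<forall>x y. \<forall>p\<in>R x \<inter> R y. s x y p = h y p - h x p))" (is "_ \<longleftrightarrow> ?R")
proof -
  have z: "(\<lambda>x. UNIV, \<lambda>x y p. 0) \<in> Z1 F"
    using subgroup_presheafD(1)[OF F] by (simp add: Z1_def point_cover_def)
  have "H1_rel F `` {(V, s)} = H1_zero F \<longleftrightarrow> ((V, s), (\<lambda>x. UNIV, \<lambda>x y p. 0)) \<in> H1_rel F"
    unfolding H1_zero_def by (rule eq_equiv_class_iff[OF equiv_H1_rel[OF F] s z])
  also have "\<dots> \<longleftrightarrow> ?R"
    using s z by (simp add: H1_rel_def) meson
  finally show ?thesis .
qed

section \<open>Primitives and exterior derivatives\<close>

context adapted_atlas
begin

lemma one_form_eqI:
  assumes "one_form_on C V \<alpha>" "one_form_on C V \<beta>" "p \<in> V" "c \<in> charts_at C p" "\<And>e. \<alpha> p c e = \<beta> p c e"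
  shows "\<alpha> p = \<beta> p"
proof -
  have "\<alpha> p c' = \<beta> p c'" for c'
  proof (cases "c' \<in> charts_at C p")
    case True
    show ?thesis
    proof
      fix e
      have "\<alpha> p c' e = \<alpha> p c (jac c' c p e)" by (rule one_form_onD(2)[OF assms(1,3) True assms(4), symmetric])
      also have "\<dots> = \<beta> p c (jac c' c p e)" by (rule assms(5))
      also have "\<dots> = \<beta> p c' e" by (rule one_form_onD(2)[OF assms(2,3) True assms(4)])
      finally show "\<alpha> p c' e = \<beta> p c' e" .
    qed
  qed (simp add: one_form_onD(3)[OF assms(1,3)] one_form_onD(3)[OF assms(2,3)])
  then show ?thesis by (simp add: fun_eq_iff)
qed

lemma one_form_horizontal_sum:
  assumes "one_form_on C V \<alpha>" "p \<in> V" "c \<in> charts_at C p"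
  shows "\<alpha> p c (w, 0) = (\<Sum>i\<in>UNIV. \<alpha> p c (axis i 1, 0) * w $ i)"
proof -
  note l = one_form_onD(1)[OF assms]
  have "(w, 0) = (\<Sum>i\<in>UNIV. w $ i *\<^sub>R (axis i (1::real), 0::real ^ 'n))"
    using basis_expansion[of w]
    by (simp add: prod_eq_iff fst_sum snd_sum scalar_mult_eq_scaleR)
  then have "\<alpha> p c (w, 0) = \<alpha> p c (\<Sum>i\<in>UNIV. w $ i *\<^sub>R (axis i 1, 0))" by (rule arg_cong)
  also have "\<dots> = (\<Sum>i\<in>UNIV. \<alpha> p c (axis i 1, 0) * w $ i)"
    unfolding linear_sum[OF l] linear_cmul[OF l] by (simp add: mult.commute)
  finally show ?thesis .
qed

lemma A0_D:
  assumes "open V" "f \<in> A0 C V"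
  shows "smooth_fun C V f" and "foliated V (theta C f)"
  using assms A0_iff by blast+

lemma omega_diff:
  assumes "open V" "smooth_fun C V f" "smooth_fun C V h" "p \<in> V" "c \<in> charts_at C p"
  shows "omega C (\<lambda>p. f p - h p) p c u v = omega C f p c u v - omega C h p c u v"
proof -
  have "d1 C (theta C (\<lambda>p. f p - h p)) p = d1 C (\<lambda>p c e. theta C f p c e - theta C h p c e) p"
    by (rule d1_cong[OF assms(1,4)]) (simp add: theta_diff[OF assms(2,3,1)] fun_eq_iff)
  then show ?thesis
    using d1_diff[OF one_form_on_theta[OF assms(1,2)] one_form_on_theta[OF assms(1,3)] assms(5,4)]
    by (simp add: omega_def)
qed

text \<open>\<open>g_of\<close> is the contraction of \<open>omega\<close> with a vertical vector,
  so it inherits additivity from d.\<close>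

lemma g_of_diff:
  assumes "open V" "smooth_fun C V f" "smooth_fun C V h" "p \<in> V" "c \<in> charts_at C p"
  shows "g_of (\<lambda>p. f p - h p) p c u v = g_of f p c u v - g_of h p c u v"
  using omega_diff[OF assms, of "(0, fst u)" v]
    omega_vertical[OF assms(1) smooth_fun_diff[OF assms(1-3)] assms(4,5), of "fst u" v "snd u"]
    omega_vertical[OF assms(1,2,4,5), of "fst u" v "snd u"]
    omega_vertical[OF assms(1,3,4,5), of "fst u" v "snd u"] by simp

text \<open>By \<open>omega_vertical\<close>, the vertical contractions of d of
  \<open>theta C f\<close> are the values of \<open>g_of f\<close>. This is how two Lagrangians with
  the same metric give a section of \<open>A0 C\<close>.\<close>

lemma A0_iff_g_of:
  assumes V: "open V"
  shows "f \<in> A0 C V \<longleftrightarrow> smooth_fun C V f \<and> (\<forall>p\<in>V. \<forall>c\<in>charts_at C p. \<forall>u v. g_of f p c u v = 0)"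
proof -
  have "foliated V (theta C f) \<longleftrightarrow> (\<forall>p\<in>V. \<forall>c\<in>charts_at C p. \<forall>u v. g_of f p c u v = 0)"
    if sm: "smooth_fun C V f"
  proof -
    have t: "theta C f p c (0, w) = 0" if "p \<in> V" "c \<in> charts_at C p" for p c w
      by (simp add: theta_def)
    have "d1 C (theta C f) p c (0, fst u) v = g_of f p c u v" if "p \<in> V" "c \<in> charts_at C p" for p c u v
      using omega_vertical[OF V sm that, of "fst u" v "snd u"] by (simp add: omega_def)
    then have "(\<forall>w v. d1 C (theta C f) p c (0, w) v = 0) \<longleftrightarrow> (\<forall>u v. g_of f p c u v = 0)"
      if "p \<in> V" "c \<in> charts_at C p" for p c using that by (metis fst_conv)
    then show ?thesis unfolding foliated_def using one_form_on_theta[OF V sm] t by blast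
  qed
  then show ?thesis using A0_iff[OF V] by blast
qed

section \<open>The three sheaves as presheaves of groups, and the morphisms between them\<close>

lemma subgroup_presheaf_Phi: "subgroup_presheaf (Phi C)"
  unfolding subgroup_presheaf_def
proof (intro conjI allI impI ballI subsetI)
  fix V :: "'m set" assume V: "open V"
  show "(\<lambda>p. 0) \<in> Phi C V" by (simp add: Phi_iff[OF V] smooth_fun_const theta_const)
  fix f h assume "f \<in> Phi C V" "h \<in> Phi C V"
  then have f: "smooth_fun C V f" "\<And>p. p \<in> V \<Longrightarrow> theta C f p = 0"
    and h: "smooth_fun C V h" "\<And>p. p \<in> V \<Longrightarrow> theta C h p = 0" by (simp_all add: Phi_iff[OF V])
  show "(\<lambda>p. f p + h p) \<in> Phi C V"
    by (simp add: Phi_iff[OF V] smooth_fun_add[OF V f(1) h(1)] theta_add[OF f(1) h(1) V] f(2) h(2))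
  show "(\<lambda>p. f p - h p) \<in> Phi C V"
    by (simp add: Phi_iff[OF V] smooth_fun_diff[OF V f(1) h(1)] theta_diff[OF f(1) h(1) V] f(2) h(2))
next
  fix V W :: "'m set" and f assume "open V" "open W" "W \<subseteq> V" "f \<in> Phi C V"
  then show "f \<in> Phi C W" using smooth_fun_mono by (auto simp: Phi_iff)
qed

lemma subgroup_presheaf_Omega_pr: "subgroup_presheaf (Omega_pr C)"
  unfolding subgroup_presheaf_def
proof (intro conjI allI impI ballI subsetI)
  fix V :: "'m set" assume V: "open V"
  show "(\<lambda>p. 0) \<in> Omega_pr C V"
    using foliated_zero by (simp add: Omega_pr_iff[OF V] zero_fun_def)
  fix f h assume "f \<in> Omega_pr C V" "h \<in> Omega_pr C V"
  then have f: "foliated V f" and h: "foliated V h" by (simp_all add: Omega_pr_iff[OF V])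
  show "(\<lambda>p. f p + h p) \<in> Omega_pr C V"
    using foliated_add[OF V f h] by (simp add: Omega_pr_iff[OF V] plus_fun_def)
  show "(\<lambda>p. f p - h p) \<in> Omega_pr C V"
    using foliated_diff[OF V f h] by (simp add: Omega_pr_iff[OF V] fun_diff_def)
next
  fix V W :: "'m set" and f assume "open V" "open W" "W \<subseteq> V" "f \<in> Omega_pr C V"
  then show "f \<in> Omega_pr C W" using foliated_mono by (auto simp: Omega_pr_iff)
qed

lemma subgroup_presheaf_A0: "subgroup_presheaf (A0 C)"
  unfolding subgroup_presheaf_def
proof (intro conjI allI impI ballI subsetI)
  fix V :: "'m set" assume V: "open V"
  have "foliated V (theta C (\<lambda>p. 0))"
    by (rule foliated_cong[OF V foliated_zero]) (simp add: theta_const fun_eq_iff)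
  then show "(\<lambda>p. 0) \<in> A0 C V" by (simp add: A0_iff[OF V] smooth_fun_const)
  fix f h assume "f \<in> A0 C V" "h \<in> A0 C V"
  then have f: "smooth_fun C V f" "foliated V (theta C f)"
    and h: "smooth_fun C V h" "foliated V (theta C h)" by (simp_all add: A0_iff[OF V])
  have "foliated V (theta C (\<lambda>p. f p + h p))"
    by (rule foliated_cong[OF V foliated_add[OF V f(2) h(2)]]) (simp add: theta_add[OF f(1) h(1) V] fun_eq_iff)
  then show "(\<lambda>p. f p + h p) \<in> A0 C V" by (simp add: A0_iff[OF V] smooth_fun_add[OF V f(1) h(1)])
  have "foliated V (theta C (\<lambda>p. f p - h p))"
    by (rule foliated_cong[OF V foliated_diff[OF V f(2) h(2)]]) (simp add: theta_diff[OF f(1) h(1) V] fun_eq_iff)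
  then show "(\<lambda>p. f p - h p) \<in> A0 C V" by (simp add: A0_iff[OF V] smooth_fun_diff[OF V f(1) h(1)])
next
  fix V W :: "'m set" and f assume "open V" "open W" "W \<subseteq> V" "f \<in> A0 C V"
  then show "f \<in> A0 C W" using foliated_mono smooth_fun_mono by (auto simp: A0_iff)
qed

lemma presheaf_hom_theta: "presheaf_hom (A0 C) (Omega_pr C) (theta C)"
  unfolding presheaf_hom_def
proof (intro allI impI conjI ballI)
  fix V :: "'m set" and f assume V: "open V" and f: "f \<in> A0 C V"
  note F = A0_D[OF V f]
  show "theta C f \<in> Omega_pr C V" by (rule foliated_Omega_pr[OF F(2) V])
  fix h k p assume h: "h \<in> A0 C V" and k: "\<forall>p\<in>V. f p + h p = k p" and p: "p \<in> V"
  have "theta C f p + theta C h p = theta C (\<lambda>p. f p + h p) p"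
    by (rule theta_add[OF F(1) A0_D(1)[OF V h] V p, symmetric])
  also have "\<dots> = theta C k p" by (rule theta_cong[OF V p]) (use k in blast)
  finally show "theta C f p + theta C h p = theta C k p" .
qed

lemma presheaf_hom_inclusion: "presheaf_hom (Phi C) (A0 C) (\<lambda>f. f)"
  unfolding presheaf_hom_def
proof (intro allI impI conjI ballI)
  fix V :: "'m set" and f assume V: "open V" and f: "f \<in> Phi C V"
  have "foliated V (theta C f)"
    by (rule foliated_cong[OF V foliated_zero]) (use f in \<open>simp add: Phi_iff[OF V] fun_eq_iff\<close>)
  then show "f \<in> A0 C V" using f by (simp add: Phi_iff[OF V] A0_iff[OF V])
qed simp

text \<open>The primitive is \<open>\<phi>\<^sub>i y\<^sup>i\<close>. The coefficients \<open>\<phi>\<^sub>i\<close> are only locally constant along the leaves,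
  because the intersection of a leaf with the chart domain need not be connected.\<close>

lemma foliated_primitive:
  assumes c: "c \<in> C" and fol: "foliated (cdom c) \<beta>"
  shows "\<exists>a\<in>A0 C (cdom c). \<forall>p\<in>cdom c. theta C a p = \<beta> p"
proof -
  let ?V = "cdom c"
  have V: "open ?V" by (rule open_cdom[OF chart[OF c]])
  note \<beta> = foliatedD(1)[OF fol]
  define G where "G i = (\<lambda>z. \<beta> (cinv c z) c (axis i 1, 0))" for i
  define a where "a q = (\<Sum>i\<in>UNIV. \<beta> q c (axis i 1, 0) * snd (coord c q) $ i)" for q
  have o: "open (coord c ` ?V)" using chart[OF c] by (simp add: is_chart_def)
  have smG: "smooth_on (coord c ` ?V) (G i)" for i
    using one_form_onD(4)[OF \<beta> c] by (simp add: G_def)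
  have bl: "bounded_linear (\<lambda>z::'n model. snd z $ i)" for i
    by (rule bounded_linear_compose[OF bounded_linear_vec_nth bounded_linear_snd])
  have ac: "(\<Sum>i\<in>UNIV. G i z * snd z $ i) = (a \<circ> cinv c) z" if "z \<in> coord c ` ?V" for z
    using that by (auto simp: a_def G_def cinv_coord[OF chart[OF c]])
  have "smooth_on (coord c ` ?V) (\<lambda>z. \<Sum>i\<in>UNIV. G i z * snd z $ i)"
    by (intro smooth_on_sum smooth_on_mult o smG smooth_on_bounded_linear bl)
  then have "smooth_on (coord c ` ?V) (a \<circ> cinv c)" by (rule smooth_on_cong[OF o, rotated]) (rule ac)
  then have sm: "smooth_fun C ?V a"
    using c V by (intro smooth_funI) (auto simp: charts_at_iff)
  have \<theta>: "theta C a p = \<beta> p" if p: "p \<in> ?V" for p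
  proof (rule one_form_eqI[OF one_form_on_theta[OF V sm] \<beta> p])
    show cp: "c \<in> charts_at C p" using c p by (simp add: charts_at_iff)
    fix e
    let ?z = "coord c p"
    have z: "?z \<in> coord c ` ?V" using p by simp
    note dG = smooth_on_differentiable[OF smG z]
    have y: "((\<lambda>z::'n model. snd z $ i) has_derivative (\<lambda>z. snd z $ i)) (at ?z)" for i
      by (rule bounded_linear_imp_has_derivative[OF bl])
    then have dy: "(\<lambda>z::'n model. snd z $ i) differentiable at ?z" for i
      by (auto simp: differentiable_def)
    \<comment> \<open>This pointwise vanishing is all that the product rule below requires, so no
      global shape of the leaves in the domain enters.\<close>
    have G0: "pd (0, w) (G i) ?z = 0" for i w
      using foliated_derivative[OF fol V p cp] by (simp add: dfun_def G_def o_def)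
    have "theta C a p c e = pd (0, fst e) (a \<circ> cinv c) ?z"
      using theta_eq[OF sm p cp] by (simp add: dfun_def)
    also have "\<dots> = pd (0, fst e) (\<lambda>z. \<Sum>i\<in>UNIV. G i z * snd z $ i) ?z"
      by (rule fun_cong[OF pd_cong[OF o z]]) (rule ac[symmetric])
    also have "\<dots> = (\<Sum>i\<in>UNIV. pd (0, fst e) (\<lambda>z. G i z * snd z $ i) ?z)"
      by (rule pd_sum) (intro differentiable_mult dG dy)
    also have "\<dots> = (\<Sum>i\<in>UNIV. G i ?z * fst e $ i)"
      unfolding pd_mult[OF dG dy] G0 pd_eq[OF y] by simp
    also have "\<dots> = \<beta> p c (fst e, 0)"
      using one_form_horizontal_sum[OF \<beta> p cp, of "fst e"] p by (simp add: G_def cinv_coord[OF chart[OF c]])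
    also have "\<dots> = \<beta> p c e"
      using linear_add[OF one_form_onD(1)[OF \<beta> p cp], of "(fst e, 0)" "(0, snd e)"] foliatedD(2)[OF fol p]
      by simp
    finally show "theta C a p c e = \<beta> p c e" .
  qed
  have "foliated ?V (theta C a)" by (rule foliated_cong[OF V fol]) (rule \<theta>)
  then have "a \<in> A0 C ?V" using sm by (simp add: A0_iff[OF V])
  then show ?thesis using \<theta> by blast
qed

text \<open>Linearity in the second argument enters as a hypothesis and is later read off from the
  explicit \<open>omega_eq\<close>; antisymmetry gives the first argument.\<close>

lemma two_form_d1:
  assumes \<Theta>: "one_form_on C UNIV \<Theta>"
    and lin: "\<And>p c u. c \<in> charts_at C p \<Longrightarrow> linear (\<lambda>v. d1 C \<Theta> p c u v)"
  shows "two_form C (d1 C \<Theta>)"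
  unfolding two_form_def tensor2_def
proof (intro conjI allI ballI impI)
  fix p c c' u v assume "c \<in> charts_at C p" "c' \<in> charts_at C p"
  then show "d1 C \<Theta> p c u v = d1 C \<Theta> p c' (jac c c' p u) (jac c c' p v)"
    by (intro d1_change_chart[OF \<Theta>]) auto
next
  fix p c v assume c: "c \<in> charts_at C p"
  have "(\<lambda>u. d1 C \<Theta> p c u v) = (\<lambda>u. - d1 C \<Theta> p c v u)" by (simp add: d1_def fun_eq_iff)
  then show "linear (\<lambda>u. d1 C \<Theta> p c u v)" using linear_compose_neg[OF lin[OF c]] by simp
next
  fix c and u v :: "'n model" assume c: "c \<in> C"
  have o: "open (coord c ` cdom c)" using chart[OF c] by (simp add: is_chart_def)
  have sm: "smooth_on (coord c ` cdom c) (\<lambda>z. \<Theta> (cinv c z) c v)" for v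
    using one_form_onD(4)[OF \<Theta> c] by simp
  show "smooth_on (coord c ` cdom c) (\<lambda>q. d1 C \<Theta> (cinv c q) c u v)"
    by (rule smooth_on_cong[OF o _ smooth_on_diff[OF o smooth_on_pd[OF sm[of v], where v = u] smooth_on_pd[OF sm[of u], where v = v]]])
      (use c in \<open>auto simp: d1_def dfun_def o_def charts_at_iff cinv_coord[OF chart]\<close>)
qed (auto simp: lin d1_def fun_eq_iff)

text \<open>The six second derivatives cancel in pairs, by symmetry.\<close>

lemma d2_d1:
  assumes \<Theta>: "one_form_on C UNIV \<Theta>" and c: "c \<in> charts_at C p"
  shows "d2 (d1 C \<Theta>) p c u v w = 0"
proof -
  have cC: "c \<in> C" "p \<in> cdom c" using c by (auto simp: charts_at_iff)
  define G where "G v = (\<lambda>z. \<Theta> (cinv c z) c v)" for v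
  have o: "open (coord c ` cdom c)" and z: "coord c p \<in> coord c ` cdom c"
    using chart[OF cC(1)] cC by (auto simp: is_chart_def)
  have sm: "smooth_on (coord c ` cdom c) (G v)" for v
    using one_form_onD(4)[OF \<Theta> cC(1)] by (simp add: G_def)
  have "dfun (\<lambda>q. d1 C \<Theta> q c v w) p c u = pd u (\<lambda>z. pd v (G w) z - pd w (G v) z) (coord c p)" for u v w
    unfolding dfun_def
    by (rule fun_cong[OF pd_cong[OF o z]])
      (use cC in \<open>auto simp: d1_def dfun_def o_def G_def charts_at_iff cinv_coord[OF chart]\<close>)
  also have "pd u (\<lambda>z. pd v (G w) z - pd w (G v) z) (coord c p)
      = pd u (pd v (G w)) (coord c p) - pd u (pd w (G v)) (coord c p)" for u v w
    by (rule pd_diff) (rule smooth_on_differentiable[OF smooth_on_pd[OF sm] z])+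
  finally have *: "dfun (\<lambda>q. d1 C \<Theta> q c v w) p c u
      = pd u (pd v (G w)) (coord c p) - pd u (pd w (G v)) (coord c p)" for u v w .
  show ?thesis unfolding d2_def *
    using pd_commute[OF o z sm[of w], where v = u and u = v] pd_commute[OF o z sm[of u], where v = v and u = w]
      pd_commute[OF o z sm[of v], where v = u and u = w]
    by simp
qed

lemma g_of_symmetric:
  assumes "open V" "smooth_fun C V f" "p \<in> V" "c \<in> charts_at C p"
  shows "g_of f p c u v = g_of f p c v u"
  unfolding g_of_eq[OF assms]
  by (rule pd_commute[OF open_image_Int[OF _ assms(1)] smooth_fun_at(2,1)[OF assms(2,4,3)]])
    (use assms(4) in \<open>simp add: charts_at_iff\<close>)

text \<open>Nondegeneracy comes in two stages. If d\<Theta>(u, .) = 0, vertical test vectors give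
  g(u, .) = 0, so u is vertical. Then u = (0, w) and d\<Theta>(u, .) = g((w, 0), .), so w =
  0.\<close>

lemma symplectic_glued_omega:
  fixes U :: "'i \<Rightarrow> 'm set"
  assumes U: "\<And>\<alpha>. open (U \<alpha>)" "\<And>p. \<exists>\<alpha>. p \<in> U \<alpha>"
    and f: "\<And>\<alpha>. smooth_fun C (U \<alpha>) (f \<alpha>)" and reg: "\<And>\<alpha>. regular_on C (U \<alpha>) (f \<alpha>)"
    and \<Theta>: "one_form_on C UNIV \<Theta>" "\<And>\<alpha> p. p \<in> U \<alpha> \<Longrightarrow> \<Theta> p = theta C (f \<alpha>) p"
  shows "symplectic_form C (d1 C \<Theta>)" and "p \<in> U \<alpha> \<Longrightarrow> d1 C \<Theta> p = omega C (f \<alpha>) p"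
proof -
  show eq: "d1 C \<Theta> p = omega C (f \<alpha>) p" if "p \<in> U \<alpha>" for p \<alpha>
    unfolding omega_def by (rule d1_cong[OF U(1) that]) (rule \<Theta>(2))
  have "linear (\<lambda>v. d1 C \<Theta> p c u v)" if c: "c \<in> charts_at C p" for p c u
  proof -
    obtain \<alpha> where p: "p \<in> U \<alpha>" using U(2) by blast
    let ?F = "f \<alpha> \<circ> cinv c" and ?z = "coord c p"
    note F = smooth_fun_at(1,2)[OF f c p]
    have o: "open (coord c ` (cdom c \<inter> U \<alpha>))" using open_image_Int U(1) c by (simp add: charts_at_iff)
    have l: "linear (\<lambda>v. pd v (pd e ?F) ?z)" for e
      by (rule pd_linear[OF smooth_on_differentiable[OF smooth_on_pd[OF F(1)] F(2)]])
    \<comment> \<open>The derivatives in the first term are exchanged so that v occurs as the outer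
      direction, where linearity is visible.\<close>
    have "d1 C \<Theta> p c u v = pd (0, fst v) (pd u ?F) ?z - pd v (pd (0, fst u) ?F) ?z" for v
      using eq[OF p] omega_eq[OF U(1) f p c, of u v] pd_commute[OF o F(2,1), where v = u and u = "(0, fst v)"] by simp
    moreover have "linear (\<lambda>v::'n model. pd (0, fst v) (pd u ?F) ?z)"
    proof (rule linearI)
      fix x y :: "'n model" and r :: real
      show "pd (0, fst (x + y)) (pd u ?F) ?z = pd (0, fst x) (pd u ?F) ?z + pd (0, fst y) (pd u ?F) ?z"
        using linear_add[OF l[of u], of "(0, fst x)" "(0, fst y)"] by simp
      show "pd (0, fst (r *\<^sub>R x)) (pd u ?F) ?z = r *\<^sub>R pd (0, fst x) (pd u ?F) ?z"
        using linear_cmul[OF l[of u], of r "(0, fst x)"] by simp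
    qed
    ultimately show ?thesis using linear_compose_sub[OF _ l] by simp
  qed
  note two = two_form_d1[OF \<Theta>(1) this]
  have "u = 0" if c: "c \<in> charts_at C p" and 0: "\<And>v. d1 C \<Theta> p c u v = 0" for p c u
  proof -
    obtain \<alpha> where p: "p \<in> U \<alpha>" using U(2) by blast
    note vert = omega_vertical[OF U(1) f p c, folded eq[OF p]]
    have nd: "e \<in> vert" if "\<And>v. g_of (f \<alpha>) p c e v = 0" for e
      using reg[of \<alpha>] p c that unfolding regular_on_def by blast
    have "g_of (f \<alpha>) p c u v = 0" for v
    proof -
      have "g_of (f \<alpha>) p c u v = g_of (f \<alpha>) p c v u" by (rule g_of_symmetric[OF U(1) f p c])
      also have "\<dots> = d1 C \<Theta> p c (0, fst v) u" using vert[of "fst v" u "snd v"] by simp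
      also have "\<dots> = - d1 C \<Theta> p c u (0, fst v)" by (simp add: d1_def)
      finally show ?thesis using 0 by simp
    qed
    then have u: "u = (0, snd u)" using nd by (auto simp: vert_def prod_eq_iff)
    have "g_of (f \<alpha>) p c (snd u, 0) v = 0" for v using vert[of "snd u" v 0] 0[of v] u by simp
    then have "snd u = 0" using nd by (fastforce simp: vert_def)
    then show ?thesis using u by (simp add: zero_prod_def)
  qed
  then show "symplectic_form C (d1 C \<Theta>)"
    unfolding symplectic_form_def using two d2_d1[OF \<Theta>(1)] by blast
qed

end

section \<open>The vertical projection and the obstructions\<close>

context adapted_atlas
begin

context
  fixes N :: "'m \<Rightarrow> ('m, 'n) chart \<Rightarrow> 'n model set"
  assumes N: "normal_bundle C N"
begin

section \<open>The projection onto the vertical bundle along the normal bundle, and d''\<close>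

lemma normal_bundleD:
  assumes "c \<in> charts_at C p"
  shows "subspace (N p c)" and "N p c \<inter> vert = {0}" and "\<exists>a\<in>N p c. \<exists>b\<in>vert. e = a + b"
    and "c' \<in> charts_at C p \<Longrightarrow> N p c' = jac c c' p ` N p c"
proof -
  have *: "subspace (N p c) \<and> N p c \<inter> vert = {0} \<and> {a + b | a b. a \<in> N p c \<and> b \<in> vert} = UNIV"
    using N[unfolded normal_bundle_def, THEN conjunct1, THEN spec, THEN bspec, OF assms] .
  then show "subspace (N p c)" "N p c \<inter> vert = {0}" by blast+
  have "e \<in> {a + b | a b. a \<in> N p c \<and> b \<in> vert}" using * by simp
  then show "\<exists>a\<in>N p c. \<exists>b\<in>vert. e = a + b" by blast
  show "N p c' = jac c c' p ` N p c" if "c' \<in> charts_at C p"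
    using N[unfolded normal_bundle_def, THEN conjunct2, THEN conjunct1, THEN spec, THEN bspec, OF assms,
      THEN bspec, OF that] .
qed

lemma subspace_vert: "subspace (vert :: 'n model set)"
  by (simp add: subspace_def vert_def)

lemma vproj_eqI:
  assumes c: "c \<in> charts_at C p" and b: "b \<in> vert" "e - b \<in> N p c"
  shows "vproj N p c e = b"
  unfolding vproj_def
proof (rule the_equality)
  show "b \<in> vert \<and> e - b \<in> N p c" using b by simp
  fix b' assume b': "b' \<in> vert \<and> e - b' \<in> N p c"
  have "(e - b) - (e - b') \<in> N p c" using subspace_diff[OF normal_bundleD(1)[OF c]] b b' by blast
  moreover have "b' - b \<in> vert" using subspace_diff[OF subspace_vert] b b' by blast
  ultimately have "b' - b \<in> N p c \<inter> vert" by simp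
  then show "b' = b" using normal_bundleD(2)[OF c] by simp
qed

lemma vproj:
  assumes c: "c \<in> charts_at C p"
  shows "vproj N p c e \<in> vert" and "e - vproj N p c e \<in> N p c"
proof -
  obtain a b where ab: "a \<in> N p c" "b \<in> vert" "e = a + b" using normal_bundleD(3)[OF c] by blast
  have "vproj N p c e = b" by (rule vproj_eqI[OF c ab(2)]) (use ab in simp)
  then show "vproj N p c e \<in> vert" "e - vproj N p c e \<in> N p c" using ab by simp_all
qed

lemma vproj_vert: "c \<in> charts_at C p \<Longrightarrow> e \<in> vert \<Longrightarrow> vproj N p c e = e"
  by (rule vproj_eqI) (simp_all add: subspace_0 normal_bundleD(1))

lemma vproj_normal: "c \<in> charts_at C p \<Longrightarrow> e \<in> N p c \<Longrightarrow> vproj N p c e = 0"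
  by (rule vproj_eqI) (simp_all add: subspace_0[OF subspace_vert])

lemma linear_vproj:
  assumes c: "c \<in> charts_at C p" shows "linear (vproj N p c)"
proof (rule linearI)
  fix x y and r :: real
  note v = vproj[OF c]
  show "vproj N p c (x + y) = vproj N p c x + vproj N p c y"
  proof (rule vproj_eqI[OF c])
    show "vproj N p c x + vproj N p c y \<in> vert" by (intro subspace_add subspace_vert v)
    have "(x - vproj N p c x) + (y - vproj N p c y) \<in> N p c"
      by (intro subspace_add normal_bundleD(1)[OF c] v)
    then show "x + y - (vproj N p c x + vproj N p c y) \<in> N p c" by (simp add: algebra_simps)
  qed
  show "vproj N p c (r *\<^sub>R x) = r *\<^sub>R vproj N p c x"
  proof (rule vproj_eqI[OF c])
    show "r *\<^sub>R vproj N p c x \<in> vert" by (intro subspace_scale subspace_vert v)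
    have "r *\<^sub>R (x - vproj N p c x) \<in> N p c"
      by (intro subspace_scale normal_bundleD(1)[OF c] v)
    then show "r *\<^sub>R x - r *\<^sub>R vproj N p c x \<in> N p c" by (simp add: algebra_simps)
  qed
qed

lemma jac_vert:
  assumes "c \<in> charts_at C p" "c' \<in> charts_at C p" "e \<in> vert"
  shows "jac c c' p e \<in> vert"
proof -
  have "e = (0, fst (snd e, 0 :: real ^ 'n))" using assms(3) by (simp add: vert_def prod_eq_iff)
  then show ?thesis using adapted[OF assms(1,2), of "(snd e, 0)"] by (simp add: vert_def)
qed

lemma vproj_change_chart:
  assumes c: "c \<in> charts_at C p" and c': "c' \<in> charts_at C p"
  shows "vproj N p c' (jac c c' p e) = jac c c' p (vproj N p c e)"
proof (rule vproj_eqI[OF c'])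
  show "jac c c' p (vproj N p c e) \<in> vert" by (rule jac_vert[OF c c' vproj(1)[OF c]])
  have "jac c c' p (e - vproj N p c e) \<in> N p c'"
    using vproj(2)[OF c] normal_bundleD(4)[OF c c'] by blast
  then show "jac c c' p e - jac c c' p (vproj N p c e) \<in> N p c'"
    by (simp add: linear_diff[OF jac_transition(2)[OF c c']])
qed

text \<open>In the frame \<open>X\<^sub>i\<close> of the normal bundle, Cramer's rule gives the coefficients of the horizontal
  part of a constant vector as smooth functions.\<close>

lemma smooth_vproj:
  assumes c: "c \<in> charts_at C p"
  shows "\<exists>W. open W \<and> p \<in> W \<and> W \<subseteq> cdom c \<and> smooth_on (coord c ` W) (\<lambda>z. vproj N (cinv c z) c e)"
proof -
  obtain W X where WX: "open W \<and> p \<in> W \<and> W \<subseteq> cdom c \<and> (\<forall>i::'n. smooth_on (coord c ` W) (X i)) \<and>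
      (\<forall>q\<in>W. N q c = span (range (\<lambda>i. X i (coord c q))))"
    using N[unfolded normal_bundle_def, THEN conjunct2, THEN conjunct2, THEN spec, THEN bspec, OF c]
    by (elim exE)
  then have W: "open W" "p \<in> W" "W \<subseteq> cdom c" and X: "\<And>i. smooth_on (coord c ` W) (X i)"
    and sp: "\<And>q. q \<in> W \<Longrightarrow> N q c = span (range (\<lambda>i. X i (coord c q)))"
    by simp_all
  have cC: "c \<in> C" using c by (simp add: charts_at_iff)
  have o: "open (coord c ` W)" by (rule open_image[OF cC W(1,3)])
  \<comment> \<open>Sought is a combination of the frame with the same first component as e. The
    columns of \<open>M\<close> are the first components of the frame, \<open>K\<close> gives the
    numerators of Cramer's rule, and \<open>b\<close> is what remains of e, a vertical
    vector.\<close>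
  define M where "M z = (\<chi> r i. fst (X i z) $ r)" for z
  define K where "K z k = det (\<chi> i j. if j = k then fst e $ i else M z $ i $ j)" for z k
  define b where "b z = e - (\<Sum>k\<in>UNIV. (K z k * inverse (det (M z))) *\<^sub>R X k z)" for z
  have M: "smooth_on (coord c ` W) (\<lambda>z. M z $ i $ j)" for i j
    using smooth_on_bounded_linear_comp[OF bounded_linear_compose[OF bounded_linear_vec_nth bounded_linear_fst] o X]
    by (simp add: M_def)
  \<comment> \<open>The normal space is a complement of the vertical one, so the first projection
    maps it onto the whole x-space, and the columns of \<open>M\<close> span.\<close>
  have det: "det (M (coord c q)) \<noteq> 0" if q: "q \<in> W" for q
  proof -
    have cq: "c \<in> charts_at C q" using q W cC by (auto simp: charts_at_iff)
    have "fst ` N q c = UNIV"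
    proof -
      have "w \<in> fst ` N q c" for w
      proof -
        obtain a b' where "a \<in> N q c" "b' \<in> vert" "(w, 0) = a + b'" using normal_bundleD(3)[OF cq] by blast
        then have "fst a = w" by (simp add: vert_def prod_eq_iff)
        then show ?thesis using \<open>a \<in> N q c\<close> by blast
      qed
      then show ?thesis by blast
    qed
    moreover have "fst ` N q c = span (fst ` range (\<lambda>i. X i (coord c q)))"
      unfolding sp[OF q] by (rule linear_span_image[OF linear_fst, symmetric])
    moreover have "fst ` range (\<lambda>i. X i (coord c q)) = columns (M (coord c q))"
      by (auto simp: columns_def column_def M_def image_iff vec_eq_iff) 
    ultimately have "span (columns (M (coord c q))) = UNIV" by simp
    then show ?thesis
      using matrix_right_invertible_span_columns[of "M (coord c q)"]
      by (simp only: invertible_right_inverse invertible_det_nz[symmetric] span_vec_eq)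
  qed
  have smK: "smooth_on (coord c ` W) (\<lambda>z. K z k)" for k
    unfolding K_def 
  proof (rule smooth_on_det[OF o])
    show "smooth_on (coord c ` W) (\<lambda>z. (\<chi> i j. if j = k then fst e $ i else M z $ i $ j) $ i $ j)" for i j
      by (cases "j = k") (simp_all add: M smooth_on_const)
  qed
  have smb: "smooth_on (coord c ` W) b"
    unfolding b_def
    by (intro smooth_on_diff smooth_on_sum smooth_on_scaleR smooth_on_mult smooth_on_inverse smooth_on_det
        smooth_on_const o X smK M) (use det in auto)
  have bv: "b (coord c q) = vproj N (cinv c (coord c q)) c e" if q: "q \<in> W" for q
  proof -
    have cq: "c \<in> charts_at C q" "q \<in> cdom c" using q W cC by (auto simp: charts_at_iff)
    let ?z = "coord c q"
    let ?x = "\<chi> k. K ?z k / det (M ?z)"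
    have "M ?z *v ?x = fst e" using cramer[OF det[OF q], of ?x "fst e"] by (simp add: K_def)
    then have "(\<Sum>k\<in>UNIV. (K ?z k / det (M ?z)) * fst (X k ?z) $ r) = fst e $ r" for r
      by (auto simp: matrix_vector_mult_def M_def vec_eq_iff mult.commute)
    then have "b ?z \<in> vert"
      by (simp add: vert_def b_def fst_sum vec_eq_iff divide_inverse)
    moreover have "e - b ?z \<in> N q c"
    proof -
      have "(\<Sum>k\<in>UNIV. (K ?z k * inverse (det (M ?z))) *\<^sub>R X k ?z) \<in> N q c"
        unfolding sp[OF q] by (intro span_sum span_scale span_base rangeI)
      then show ?thesis by (simp add: b_def)
    qed
    ultimately show ?thesis using vproj_eqI[OF cq(1)] cinv_coord[OF chart[OF cC] cq(2)] by simp
  qed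
  have "smooth_on (coord c ` W) (\<lambda>z. vproj N (cinv c z) c e)"
    by (rule smooth_on_cong[OF o _ smb]) (use bv in blast)
  then show ?thesis using W by blast
qed

text \<open>The vertical part (0, w) of e is \<open>S\<close> applied to (w, 0), and
  \<open>theta\<close> is df composed with \<open>S\<close>.\<close>

lemma dpp0_eq_theta:
  assumes "smooth_fun C V f" "p \<in> V"
  shows "dpp0 C N f p c e = theta C f p c (snd (vproj N p c e), 0)"
proof (cases "c \<in> charts_at C p")
  case True
  have "vproj N p c e = (0, snd (vproj N p c e))" using vproj(1)[OF True] by (simp add: vert_def prod_eq_iff)
  then show ?thesis using True by (simp add: dpp0_def theta_eq[OF assms True])
qed (simp add: dpp0_def theta_def)

text \<open>\<kappa> applies \<Theta> to a preimage under \<open>S\<close> of the vertical part, so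
  it is defined globally, and \<open>dpp0_eq_theta\<close> identifies it with d'' of each
  \<open>f \<alpha>\<close>. Closedness is then the symmetry of second vertical derivatives.\<close>

lemma dpp_closed01_glued:
  fixes U :: "'i \<Rightarrow> 'm set"
  assumes U: "\<And>\<alpha>. open (U \<alpha>)" "\<And>p. \<exists>\<alpha>. p \<in> U \<alpha>"
    and f: "\<And>\<alpha>. smooth_fun C (U \<alpha>) (f \<alpha>)"
    and \<Theta>: "one_form_on C UNIV \<Theta>" "\<And>\<alpha> p. p \<in> U \<alpha> \<Longrightarrow> \<Theta> p = theta C (f \<alpha>) p"
  shows "\<exists>\<kappa>. dpp_closed01 C N \<kappa> \<and> (\<forall>\<alpha>. \<forall>p\<in>U \<alpha>. \<kappa> p = dpp0 C N (f \<alpha>) p)"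
proof -
  define \<kappa> where "\<kappa> p c e = \<Theta> p c (snd (vproj N p c e), 0)" for p c e
  have \<kappa>: "\<kappa> p = dpp0 C N (f \<alpha>) p" if "p \<in> U \<alpha>" for p \<alpha>
    by (intro ext) (simp add: \<kappa>_def \<Theta>(2)[OF that] dpp0_eq_theta[OF f that])
  \<comment> \<open>The vector (w, 0) depends on the chart, so the transformation law is checked on
    d'' of a local function instead.\<close>
  have nat: "\<kappa> p c e = \<kappa> p c' (jac c c' p e)" if c: "c \<in> charts_at C p" "c' \<in> charts_at C p" for p c c' e
  proof -
    obtain \<alpha> where p: "p \<in> U \<alpha>" using U(2) by blast
    show ?thesis
      using dfun_change_chart[OF c smooth_fun_at(3)[OF f c(2) p]] c
      by (simp add: \<kappa>[OF p] dpp0_def vproj_change_chart[OF c])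
  qed
  have lin: "linear (\<kappa> p c)" if c: "c \<in> charts_at C p" for p c
  proof (rule linearI)
    note l = one_form_onD(1)[OF \<Theta>(1) UNIV_I c]
    fix x y and r :: real
    show "\<kappa> p c (x + y) = \<kappa> p c x + \<kappa> p c y"
      using linear_add[OF l, of "(snd (vproj N p c x), 0)" "(snd (vproj N p c y), 0)"]
      by (simp add: \<kappa>_def linear_add[OF linear_vproj[OF c]])
    show "\<kappa> p c (r *\<^sub>R x) = r *\<^sub>R \<kappa> p c x"
      using linear_cmul[OF l, of r "(snd (vproj N p c x), 0)"]
      by (simp add: \<kappa>_def linear_cmul[OF linear_vproj[OF c]])
  qed
  have sm: "smooth_on (coord c ` (cdom c \<inter> UNIV)) (\<lambda>z. \<kappa> (cinv c z) c e)" if c: "c \<in> C" for c e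
  proof (rule smooth_on_local)
    show "open (coord c ` (cdom c \<inter> UNIV))" by (rule open_image_Int[OF c open_UNIV])
    fix z assume "z \<in> coord c ` (cdom c \<inter> UNIV)"
    then obtain p where p: "p \<in> cdom c" "z = coord c p" by auto
    then have "c \<in> charts_at C p" using c by (simp add: charts_at_iff)
    from smooth_vproj[OF this, of e] obtain W where W: "open W" "p \<in> W" "W \<subseteq> cdom c"
      "smooth_on (coord c ` W) (\<lambda>z. vproj N (cinv c z) c e)" by blast
    have o: "open (coord c ` W)" by (rule open_image[OF c W(1,3)])
    have sm\<Theta>: "smooth_on (coord c ` W) (\<lambda>z. \<Theta> (cinv c z) c v)" for v
      by (rule smooth_on_mono[OF one_form_onD(4)[OF \<Theta>(1) c]]) (use W(3) in auto)
    have "smooth_on (coord c ` W) (\<lambda>z. snd (vproj N (cinv c z) c e) $ i)" for i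
      using smooth_on_bounded_linear_comp[OF bounded_linear_compose[OF bounded_linear_vec_nth bounded_linear_snd] o W(4)] .
    then have "smooth_on (coord c ` W)
        (\<lambda>z. \<Sum>i\<in>UNIV. \<Theta> (cinv c z) c (axis i 1, 0) * snd (vproj N (cinv c z) c e) $ i)"
      by (intro smooth_on_sum smooth_on_mult o sm\<Theta>)
    then have "smooth_on (coord c ` W) (\<lambda>z. \<kappa> (cinv c z) c e)"
    proof (rule smooth_on_cong[OF o, rotated])
      fix z assume "z \<in> coord c ` W"
      then have "c \<in> charts_at C (cinv c z)" using W(3) c by (auto simp: charts_at_iff cinv_coord[OF chart[OF c]])
      then show "(\<Sum>i\<in>UNIV. \<Theta> (cinv c z) c (axis i 1, 0) * snd (vproj N (cinv c z) c e) $ i) = \<kappa> (cinv c z) c e"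
        unfolding \<kappa>_def by (rule one_form_horizontal_sum[OF \<Theta>(1) UNIV_I, symmetric])
    qed
    then show "\<exists>W. open W \<and> z \<in> W \<and> smooth_on W (\<lambda>z. \<kappa> (cinv c z) c e)"
      using o W(2) p(2) by blast
  qed
  have "one_form_on C UNIV \<kappa>"
    unfolding one_form_on_def
  proof (intro conjI ballI allI impI)
    fix p c assume "c \<notin> charts_at C p"
    then show "\<kappa> p c = (\<lambda>e. 0)" by (simp add: \<kappa>_def one_form_onD(3)[OF \<Theta>(1)] fun_eq_iff)
  qed (rule lin nat sm, assumption+)+
  moreover have "\<kappa> p c e = 0" if "c \<in> charts_at C p" "e \<in> N p c" for p c e
    using linear_0[OF one_form_onD(1)[OF \<Theta>(1) UNIV_I that(1)]]
    by (simp add: \<kappa>_def vproj_normal[OF that] zero_prod_def)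
  moreover have "dpp1 C N \<kappa> p c u v = 0" if c: "c \<in> charts_at C p" for p c u v
  proof -
    obtain \<alpha> where p: "p \<in> U \<alpha>" using U(2) by blast
    have cC: "c \<in> C" using c by (simp add: charts_at_iff)
    let ?T = "coord c ` (cdom c \<inter> U \<alpha>)"
    note F = smooth_fun_at(1,2)[OF f c p]
    have o: "open ?T" by (rule open_image_Int[OF cC U(1)])
    \<comment> \<open>On a constant vertical vector the projection is the identity at all nearby
      points, so derivatives of the projection itself do not occur.\<close>
    have "dfun (\<lambda>q. \<kappa> q c b) p c a = pd a (pd b (f \<alpha> \<circ> cinv c)) (coord c p)" if b: "b \<in> vert" for a b
      unfolding dfun_def
    proof (rule fun_cong[OF pd_cong[OF o F(2)]])
      fix z assume "z \<in> ?T"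
      then obtain q where q: "q \<in> cdom c" "q \<in> U \<alpha>" "z = coord c q" by auto
      then have cq: "c \<in> charts_at C q" using cC by (simp add: charts_at_iff)
      show "((\<lambda>q. \<kappa> q c b) \<circ> cinv c) z = pd b (f \<alpha> \<circ> cinv c) z"
        using q cq vproj_vert[OF cq b]
        by (simp add: cinv_coord[OF chart[OF cC]] \<kappa>[OF q(2)] dpp0_def dfun_def)
    qed
    then show ?thesis
      using vproj(1)[OF c] pd_commute[OF o F(2,1)] c by (simp add: dpp1_def d1_def)
  qed
  ultimately have "dpp_closed01 C N \<kappa>" by (simp add: dpp_closed01_def form01_def)
  then show ?thesis using \<kappa> by blast
qed

end

end

section \<open>The two Lagrangian obstructions and the subordinated structures\<close>

theorem proposition2p5:
  fixes A :: "('m::{second_countable_topology, t2_space}, 'n::finite) chart set"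
    and S :: "('m, 'n) endo"
    and g :: "('m, 'n) form2"
    and U :: "'i \<Rightarrow> 'm set"
    and L :: "'i \<Rightarrow> 'm \<Rightarrow> real"
    and C :: "('m, 'n) chart set"
    and N :: "'m \<Rightarrow> ('m, 'n) chart \<Rightarrow> 'n model set"
  assumes lagr: "locally_lagrange_space A S g U L"
    and C_def: "C = adapted_charts A S"
    and normal: "normal_bundle C N"
  shows "(first_obstruction C U L = H1_zero (Omega_pr C) \<longleftrightarrow>
            (\<exists>L'. subordinated C U L L' \<and> thetas_glue C U L')) \<and>
         (\<forall>L'. subordinated C U L L' \<and> thetas_glue C U L' \<longrightarrow>
            locally_lagrangian_symplectic C U L' \<and>
            (\<exists>\<kappa>. dpp_closed01 C N \<kappa> \<and> (\<forall>\<alpha>. \<forall>p\<in>U \<alpha>. \<kappa> p = dpp0 C N (L' \<alpha>) p) \<and>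
                 (\<exists>X. is_second_obstruction C U L X \<and> represents C N \<kappa> X) \<and>
                 (inj_on (iota_star C) (H1 (Phi C)) \<longrightarrow>
                    (\<exists>!X. is_second_obstruction C U L X) \<and>
                    represents C N \<kappa> (second_obstruction C U L))))"
proof -
  have tm: "tangent_manifold A S" and Uc: "\<And>\<alpha>. \<exists>c\<in>C. cdom c = U \<alpha>" and UU: "(\<Union>\<alpha>. U \<alpha>) = UNIV"
    and L: "\<And>\<alpha>. smooth_fun C (U \<alpha>) (L \<alpha>)" and reg: "\<And>\<alpha>. regular_on C (U \<alpha>) (L \<alpha>)"
    and gL: "\<And>\<alpha> p c u v. p \<in> U \<alpha> \<Longrightarrow> c \<in> charts_at C p \<Longrightarrow> g p c u v = g_of (L \<alpha>) p c u v"
    using lagr unfolding locally_lagrange_space_def C_def by blast+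
  have cov: "\<exists>\<alpha>. p \<in> U \<alpha>" for p using UU by blast
  interpret adapted_atlas C
    unfolding C_def by (rule adapted_atlas_adapted_charts[OF tm]) (use cov Uc in \<open>unfold C_def, metis\<close>)
  have U: "open (U \<alpha>)" for \<alpha> using Uc[of \<alpha>] open_cdom[OF chart] by metis
  then have UI: "open (U \<alpha> \<inter> U \<beta>)" for \<alpha> \<beta> by blast
  \<comment> \<open>All classes below are computed on the single point-indexed covering by the sets
    \<open>U (r x)\<close>.\<close>
  obtain r where r: "\<And>x. x \<in> U (r x)" using cov by metis
  \<comment> \<open>Both Lagrangians have the metric g, so their difference has metric zero.\<close>
  have LA0: "(\<lambda>p. L \<beta> p - L \<alpha> p) \<in> A0 C (U \<alpha> \<inter> U \<beta>)" for \<alpha> \<beta>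
  proof -
    have sm: "smooth_fun C (U \<alpha> \<inter> U \<beta>) (L \<alpha>)" "smooth_fun C (U \<alpha> \<inter> U \<beta>) (L \<beta>)"
      using smooth_fun_mono[OF L] by auto
    have "g_of (\<lambda>p. L \<beta> p - L \<alpha> p) p c u v = 0" if "p \<in> U \<alpha> \<inter> U \<beta>" "c \<in> charts_at C p" for p c u v
      using g_of_diff[OF UI sm(2,1) that, of u v] gL[of p \<alpha> c u v] gL[of p \<beta> c u v] that by simp
    then show ?thesis using A0_iff_g_of[OF UI] smooth_fun_diff[OF UI sm(2,1)] by blast
  qed
  have cL: "cocycle_on (A0 C) U (\<lambda>\<alpha> \<beta> p. L \<beta> p - L \<alpha> p)"
    using U LA0 by (simp add: cocycle_on_def)
  let ?V = "\<lambda>x. U (r x)" and ?s = "\<lambda>x y p. L (r y) p - L (r x) p"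
  have Vs: "(?V, ?s) \<in> Z1 (A0 C)" by (rule cocycle_on_Z1[OF cL r])
  have lc: "lagr_class C U L = H1_rel (A0 C) `` {(?V, ?s)}"
    unfolding lagr_class_def by (rule cech_class_eq[OF subgroup_presheaf_A0 cL r])
  have \<theta>L: "theta C (\<lambda>p. L \<beta> p - L \<alpha> p) p = theta C (L \<beta>) p - theta C (L \<alpha>) p"
    if "p \<in> U \<alpha>" "p \<in> U \<beta>" for \<alpha> \<beta> p
    by (rule theta_diff[where V = "U \<alpha> \<inter> U \<beta>"])
      (use smooth_fun_mono[OF L] U that in auto)
  have fo: "first_obstruction C U L = H1_rel (Omega_pr C) `` {(?V, \<lambda>x y. theta C (?s x y))}"
    unfolding first_obstruction_def pi_star_def lc
    by (rule H1_map_class[OF subgroup_presheaf_A0 subgroup_presheaf_Omega_pr presheaf_hom_theta Vs])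
  note zero_iff = H1_class_zero_iff[OF subgroup_presheaf_Omega_pr
      presheaf_hom_Z1[OF subgroup_presheaf_A0 presheaf_hom_theta Vs], folded fo]
  have potentials: "\<exists>L'. subordinated C U L L' \<and> thetas_glue C U L'"
    if zero: "first_obstruction C U L = H1_zero (Omega_pr C)"
  proof -
    obtain R h where Rh: "point_cover R \<and> (\<forall>x. R x \<subseteq> U (r x) \<and> h x \<in> Omega_pr C (R x)) \<and>
        (\<forall>x y. \<forall>p\<in>R x \<inter> R y. theta C (?s x y) p = h y p - h x p)"
      using zero unfolding zero_iff by (elim exE)
    then have R: "point_cover R" "\<And>x. R x \<subseteq> U (r x)" and h: "\<And>x. h x \<in> Omega_pr C (R x)"
      and eq: "\<And>x y p. p \<in> R x \<Longrightarrow> p \<in> R y \<Longrightarrow> theta C (?s x y) p = h y p - h x p"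
      by simp_all
    note Ro = point_coverD[OF R(1)]
    have hf: "foliated (R x) (h x)" for x by (rule Omega_pr_foliated[OF h Ro(1)])
    \<comment> \<open>At p the member of the refinement labelled by p itself is used. By the
      coboundary relation, every other label whose set contains p gives the same value, which is the
      next fact.\<close>
    define \<Theta> where "\<Theta> p = theta C (L (r p)) p - h p p" for p
    have \<Theta>R: "\<Theta> p = theta C (L (r x)) p - h x p" if "p \<in> R x" for p x
    proof -
      have "h p p - h x p = theta C (L (r p)) p - theta C (L (r x)) p"
        using eq[OF that Ro(2)] \<theta>L[of p "r x" "r p"] R(2)[of x] R(2)[of p] that Ro(2)[of p] by auto
      then show ?thesis unfolding \<Theta>_def by (simp add: algebra_simps)
    qed
    have \<Theta>: "one_form_on C UNIV \<Theta>"
    proof (rule one_form_on_local[OF open_UNIV])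
      fix p
      have "one_form_on C (R p) (\<lambda>q c e. theta C (L (r p)) q c e - h p q c e)"
        by (intro one_form_on_diff Ro(1) foliatedD(1)[OF hf] one_form_on_theta smooth_fun_mono[OF L R(2)])
      then have "one_form_on C (R p) \<Theta>"
        by (rule one_form_on_cong[OF Ro(1)]) (simp add: \<Theta>R fun_eq_iff)
      then show "\<exists>W. open W \<and> p \<in> W \<and> one_form_on C W \<Theta>" using Ro by blast
    qed
    \<comment> \<open>The correction is found on all of \<open>U \<alpha>\<close>, although h lives
      only on the sets \<open>R x\<close>: being foliated is a local property, and a primitive
      exists on any chart domain.\<close>
    have "\<exists>a\<in>A0 C (U \<alpha>). \<forall>p\<in>U \<alpha>. theta C a p = \<Theta> p - theta C (L \<alpha>) p" for \<alpha>
    proof -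
      obtain c where c: "c \<in> C" "cdom c = U \<alpha>" using Uc[of \<alpha>] by blast
      have "foliated (U \<alpha>) (\<lambda>p. \<Theta> p - theta C (L \<alpha>) p)"
      proof (rule foliated_local[OF U])
        fix p assume p: "p \<in> U \<alpha>"
        let ?W = "U \<alpha> \<inter> R p"
        have W: "open ?W" "p \<in> ?W" using U Ro p by auto
        \<comment> \<open>Near p the form in question is \<open>theta\<close> of
          \<open>L (r p)\<close> minus \<open>L \<alpha>\<close>, less \<open>h p\<close>; both
          parts are foliated.\<close>
        have "foliated (U \<alpha> \<inter> U (r p)) (theta C (\<lambda>p'. L (r p) p' - L \<alpha> p'))"
          using LA0 A0_iff[OF UI] by blast
        then have 1: "foliated ?W (theta C (\<lambda>p'. L (r p) p' - L \<alpha> p'))"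
          by (rule foliated_mono) (use R(2) in blast)
        have 2: "foliated ?W (h p)" by (rule foliated_mono[OF hf]) blast
        have "foliated ?W (\<lambda>q c e. theta C (\<lambda>p'. L (r p) p' - L \<alpha> p') q c e - h p q c e)"
          by (rule foliated_diff[OF W(1) 1 2])
        then have "foliated ?W (\<lambda>q. \<Theta> q - theta C (L \<alpha>) q)"
        proof (rule foliated_cong[OF W(1)])
          fix q assume q: "q \<in> ?W"
          then have "\<Theta> q - theta C (L \<alpha>) q = theta C (L (r p)) q - theta C (L \<alpha>) q - h p q"
            using \<Theta>R[of q p] by (simp add: algebra_simps)
          also have "\<dots> = theta C (\<lambda>p'. L (r p) p' - L \<alpha> p') q - h p q"
            using \<theta>L[of q \<alpha> "r p"] q R(2)[of p] by auto
          finally show "\<Theta> q - theta C (L \<alpha>) q = (\<lambda>c e. theta C (\<lambda>p'. L (r p) p' - L \<alpha> p') q c e - h p q c e)"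
            by (simp add: fun_eq_iff)
        qed
        then show "\<exists>W. open W \<and> p \<in> W \<and> foliated W (\<lambda>p. \<Theta> p - theta C (L \<alpha>) p)" using W by blast
      qed
      then show ?thesis using foliated_primitive[OF c(1)] by (simp only: c(2))
    qed
    then obtain a where a: "\<And>\<alpha>. a \<alpha> \<in> A0 C (U \<alpha>)"
      and \<theta>a: "\<And>\<alpha> p. p \<in> U \<alpha> \<Longrightarrow> theta C (a \<alpha>) p = \<Theta> p - theta C (L \<alpha>) p" by meson
    define L' where "L' = (\<lambda>\<alpha> p. L \<alpha> p + a \<alpha> p)"
    have d: "(\<lambda>p. L' \<alpha> p - L \<alpha> p) = a \<alpha>" for \<alpha> by (simp add: L'_def)
    have sma: "smooth_fun C (U \<alpha>) (a \<alpha>)" for \<alpha> using A0_D(1)[OF U a] .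
    have sm: "smooth_fun C (U \<alpha>) (L' \<alpha>)" for \<alpha>
      unfolding L'_def by (rule smooth_fun_add[OF U L sma])
    \<comment> \<open>Sections of \<open>A0 C\<close> have metric zero, so the correction preserves
      regularity.\<close>
    have "g_of (L' \<alpha>) p c u v = g_of (L \<alpha>) p c u v" if "p \<in> U \<alpha>" "c \<in> charts_at C p" for \<alpha> p c u v
      using g_of_diff[OF U sm L that, of u v] a[of \<alpha>] that unfolding d A0_iff_g_of[OF U] by simp
    then have "regular_on C (U \<alpha>) (L' \<alpha>)" for \<alpha>
      using reg[of \<alpha>] unfolding regular_on_def by simp
    then have "subordinated C U L L'" using sm a by (simp add: subordinated_def d)
    moreover have "\<Theta> p = theta C (L' \<alpha>) p" if "p \<in> U \<alpha>" for \<alpha> p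
      unfolding L'_def using theta_add[OF L sma U that] \<theta>a[OF that] by simp
    then have "thetas_glue C U L'" unfolding thetas_glue_def using \<Theta> by blast
    ultimately show ?thesis by blast
  qed
  have glued: "first_obstruction C U L = H1_zero (Omega_pr C) \<and>
      locally_lagrangian_symplectic C U L' \<and>
      (\<exists>\<kappa>. dpp_closed01 C N \<kappa> \<and> (\<forall>\<alpha>. \<forall>p\<in>U \<alpha>. \<kappa> p = dpp0 C N (L' \<alpha>) p) \<and>
           (\<exists>X. is_second_obstruction C U L X \<and> represents C N \<kappa> X))"
    if sub: "subordinated C U L L'" and glue: "thetas_glue C U L'" for L'
  proof -
    have L': "\<And>\<alpha>. smooth_fun C (U \<alpha>) (L' \<alpha>)" and reg': "\<And>\<alpha>. regular_on C (U \<alpha>) (L' \<alpha>)"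
      and a: "\<And>\<alpha>. (\<lambda>p. L' \<alpha> p - L \<alpha> p) \<in> A0 C (U \<alpha>)"
      using sub by (simp_all add: subordinated_def)
    obtain \<Theta> where \<Theta>: "one_form_on C UNIV \<Theta>" "\<And>\<alpha> p. p \<in> U \<alpha> \<Longrightarrow> \<Theta> p = theta C (L' \<alpha>) p"
      using glue unfolding thetas_glue_def by blast
    have "first_obstruction C U L = H1_zero (Omega_pr C)"
      unfolding zero_iff
    proof (intro exI conjI allI ballI)
      \<comment> \<open>The opposite of the correction, written as a difference to match the closure
        rules of the presheaf. Its \<open>theta\<close> is that of L minus \<Theta>, and \<Theta>
        drops out of the coboundary, so the covering serves as its own refinement.\<close>
      let ?a = "\<lambda>x p. 0 - (L' (r x) p - L (r x) p)"
      show "point_cover ?V" using U r by (simp add: point_cover_def)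
      show "U (r x) \<subseteq> U (r x)" for x by simp
      have "?a x \<in> A0 C (U (r x))" for x
        using subgroup_presheafD(3)[OF subgroup_presheaf_A0 U subgroup_presheafD(1)[OF subgroup_presheaf_A0 U] a] .
      then show "theta C (?a x) \<in> Omega_pr C (U (r x))" for x
        by (rule presheaf_homD(1)[OF presheaf_hom_theta U])
      fix x y p assume p: "p \<in> U (r x) \<inter> U (r y)"
      have "theta C (?a x) p = theta C (L (r x)) p - \<Theta> p" if "p \<in> U (r x)" for x
        using theta_diff[OF smooth_fun_const smooth_fun_diff[OF U L' L] U that, of 0]
          theta_diff[OF L' L U that] \<Theta>(2)[OF that] by (simp add: theta_const)
      then show "theta C (?s x y) p = theta C (?a y) p - theta C (?a x) p"
        using p \<theta>L[of p "r x" "r y"] by simp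
    qed
    moreover have "locally_lagrangian_symplectic C U L'"
      unfolding locally_lagrangian_symplectic_def
      using symplectic_glued_omega[OF U cov L' reg' \<Theta>] by blast
    moreover obtain \<kappa> where \<kappa>: "dpp_closed01 C N \<kappa>" "\<And>\<alpha> p. p \<in> U \<alpha> \<Longrightarrow> \<kappa> p = dpp0 C N (L' \<alpha>) p"
      using dpp_closed01_glued[OF normal U cov L' \<Theta>] by blast
    let ?t = "\<lambda>x y p. L' (r y) p - L' (r x) p"
    \<comment> \<open>The candidate for the second obstruction. Its cocycle takes values in
      \<open>Phi C\<close> because all the forms \<open>theta C (L' \<alpha>)\<close> restrict the
      same \<Theta>.\<close>
    define X where "X = H1_rel (Phi C) `` {(?V, ?t)}"
    have "(\<lambda>p. L' \<beta> p - L' \<alpha> p) \<in> Phi C (U \<alpha> \<inter> U \<beta>)" for \<alpha> \<beta>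
    proof -
      have sm: "smooth_fun C (U \<alpha> \<inter> U \<beta>) (L' \<alpha>)" "smooth_fun C (U \<alpha> \<inter> U \<beta>) (L' \<beta>)"
        using smooth_fun_mono[OF L'] by auto
      show ?thesis unfolding Phi_iff[OF UI]
        using smooth_fun_diff[OF UI sm(2,1)] theta_diff[OF sm(2,1) UI] by (simp flip: \<Theta>(2))
    qed
    then have cV: "cocycle_on (Phi C) ?V ?t" using U by (simp add: cocycle_on_def)
    \<comment> \<open>The covering is already indexed by points, so the identity serves as
      refinement map.\<close>
    have Vt: "(?V, ?t) \<in> Z1 (Phi C)" by (rule cocycle_on_Z1[OF cV, of "\<lambda>x. x"]) (rule r)
    have X_cech: "X = cech_class (Phi C) ?V ?t"
      unfolding X_def using cech_class_eq[OF subgroup_presheaf_Phi cV, of "\<lambda>x. x"] r by simp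
    have "represents C N \<kappa> X"
      unfolding represents_def
    proof (intro conjI exI allI ballI)
      show "point_cover ?V" using U r by (simp add: point_cover_def)
    qed (use \<kappa> L' X_cech in auto)
    moreover have "is_second_obstruction C U L X"
      unfolding is_second_obstruction_def
    proof
      show "X \<in> H1 (Phi C)" unfolding H1_def X_def by (rule quotientI[OF Vt])
      have Vt': "(?V, ?t) \<in> Z1 (A0 C)"
        using presheaf_hom_Z1[OF subgroup_presheaf_Phi presheaf_hom_inclusion Vt] .
      have "iota_star C X = H1_rel (A0 C) `` {(?V, ?t)}"
        unfolding iota_star_def X_def
        by (rule H1_map_class[OF subgroup_presheaf_Phi subgroup_presheaf_A0 presheaf_hom_inclusion Vt])
      also have "\<dots> = H1_rel (A0 C) `` {(?V, ?s)}"
      proof (rule equiv_class_eq[OF equiv_H1_rel[OF subgroup_presheaf_A0]])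
        \<comment> \<open>The cochain consists of the corrections, L' minus L, which are sections of
          \<open>A0 C\<close> on the members of the covering.\<close>
        show "((?V, ?t), (?V, ?s)) \<in> H1_rel (A0 C)"
          by (rule H1_relI[OF Vt' Vs Z1D(1)[OF Vs] _ a]) auto
      qed
      finally show "iota_star C X = lagr_class C U L" by (simp add: lc)
    qed
    ultimately show ?thesis using \<kappa> by blast
  qed
  \<comment> \<open>Two candidates have the same image under \<open>iota_star C\<close>, so
    injectivity turns existence into uniqueness and identifies the definite description with the
    class already found.\<close>
  have unique: "(\<exists>!X. is_second_obstruction C U L X) \<and> represents C N \<kappa> (second_obstruction C U L)"
    if "inj_on (iota_star C) (H1 (Phi C))" "is_second_obstruction C U L X" "represents C N \<kappa> X" for \<kappa> X
  proof -
    have uniq: "Y = X" if "is_second_obstruction C U L Y" for Y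
      using \<open>inj_on (iota_star C) (H1 (Phi C))\<close> \<open>is_second_obstruction C U L X\<close> that
      by (auto simp: is_second_obstruction_def inj_on_def)
    have "second_obstruction C U L = X"
      unfolding second_obstruction_def by (rule the_equality, rule that(2)) (rule uniq)
    moreover have "\<exists>!X. is_second_obstruction C U L X" by (rule ex1I, rule that(2)) (rule uniq)
    ultimately show ?thesis using that(3) by simp
  qed
  show ?thesis
  proof (intro conjI allI impI)
    show "first_obstruction C U L = H1_zero (Omega_pr C) \<longleftrightarrow>
        (\<exists>L'. subordinated C U L L' \<and> thetas_glue C U L')"
      using potentials glued by blast
    fix L' assume "subordinated C U L L' \<and> thetas_glue C U L'"
    then have L': "subordinated C U L L'" "thetas_glue C U L'" by simp_all
    show "locally_lagrangian_symplectic C U L'" using glued[OF L'] by blast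
    obtain \<kappa> X where "dpp_closed01 C N \<kappa>" "\<forall>\<alpha>. \<forall>p\<in>U \<alpha>. \<kappa> p = dpp0 C N (L' \<alpha>) p"
      "is_second_obstruction C U L X" "represents C N \<kappa> X"
      using glued[OF L'] by (elim conjE exE)
    then show "\<exists>\<kappa>. dpp_closed01 C N \<kappa> \<and> (\<forall>\<alpha>. \<forall>p\<in>U \<alpha>. \<kappa> p = dpp0 C N (L' \<alpha>) p) \<and>
        (\<exists>X. is_second_obstruction C U L X \<and> represents C N \<kappa> X) \<and>
        (inj_on (iota_star C) (H1 (Phi C)) \<longrightarrow>
          (\<exists>!X. is_second_obstruction C U L X) \<and> represents C N \<kappa> (second_obstruction C U L))"
      using unique[of X \<kappa>] by (intro exI[of _ \<kappa>] conjI exI[of _ X] impI) simp_all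
  qed
qed

end
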